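(* Let $W_h$, $V_h$ be the broken and unbroken finite-dimensional complexes described in the context, and let $0\le k\le n$. Then $$(\dim V_h^{k-1}+\dim V_h^k)-(\dim\overline{\mathfrak H}_h^k+\dim\widehat V_h^{k-1,\mathrm{tan}}+\dim\widehat V_h^{k,\mathrm{tan}})=\sum_{K\in\mathcal T_h}\bigl(\dim\mathring W_h^{k-1}(K)+\dim\mathring{\mathfrak B}_h^k(K)+\dim\mathring{\mathfrak Z}_h^{k\perp}(K)\bigr).$$ Consequently, the size $\dim\bigl(\mathfrak H_h^k\times\overline{\mathfrak H}_h^k\times\widehat V_h^{k-1,\mathrm{tan}}\times\widehat V_h^{k,\mathrm{tan}}\bigr)$ of the hybridized and statically condensed FEEC system is always less than or equal to the size $\dim\bigl(V_h^{k-1}\times V_h^k\times\mathfrak H_h^k\bigr)$ of the standard FEEC system, with equality if and only if $\mathring W_h^{k-1}(K)$ is trivial and $\mathring W_h^k(K)=\mathring{\mathfrak H}_h^k(K)$ for all $K\in\mathcal T_h$.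
   Context: $\Omega\subset\mathbb R^n$ is a bounded Lipschitz domain and $\mathcal T_h$ a finite decomposition of $\Omega$ into non-overlapping Lipschitz subdomains $K$. $H\Lambda^j(\Omega)=\{v\in L^2\Lambda^j(\Omega):\mathrm dv\in L^2\Lambda^{j+1}(\Omega)\}$ where $\mathrm d$ is the distributional exterior derivative; $\mathring H\Lambda^j(\Omega)$ is the closure in $H\Lambda^j(\Omega)$ of smooth compactly supported $j$-forms; likewise on each $K$. Spaces of forms of degree outside $\{0,\dots,n\}$ are zero. The tangential trace $v^{\mathrm{tan}}$ of $v\in H\Lambda^j(K)$ is its class in $H\Lambda^j(K)/\mathring H\Lambda^j(K)$ (for smooth forms, the pullback of $v$ to $\partial K$). For each $K\in\mathcal T_h$, $W_h(K)\subset H\Lambda(K)$ is a finite-dimensional subcomplex (finite-dimensional $W_h^j(K)\subset H\Lambda^j(K)$ with $\mathrm dW_h^j(K)\subset W_h^{j+1}(K)$). $W_h^j=\prod_KW_h^j(K)$, $V_h^j=H\Lambda^j(\Omega)\cap W_h^j$ (forms on $\Omega$ being viewed as broken forms by restriction). $\widehat V_h^{j,\mathrm{tan}}=\{v_h^{\mathrm{tan}}:v_h\in V_h^j\}$, where the trace is taken on $\partial\mathcal T_h=\bigsqcup_K\partial K$, i.e. it is the tuple of the tangential traces on the $\partial K$, $K\in\mathcal T_h$. $\mathring W_h^j(K)=W_h^j(K)\cap\mathring H\Lambda^j(K)$. Inside $\mathring W_h^k(K)$, with $L^2(K)$-orthogonality: $\mathring{\mathfrak B}_h^k(K)=\mathrm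 d\mathring W_h^{k-1}(K)$, $\mathring{\mathfrak Z}_h^k(K)=\{v\in\mathring W_h^k(K):\mathrm dv=0\}$, $\mathring{\mathfrak H}_h^k(K)=\mathring{\mathfrak Z}_h^k(K)\cap\mathring{\mathfrak B}_h^k(K)^\perp$, and $\mathring{\mathfrak Z}_h^{k\perp}(K)$ is the orthogonal complement of $\mathring{\mathfrak Z}_h^k(K)$ in $\mathring W_h^k(K)$. $\overline{\mathfrak H}_h^k=\prod_K\mathring{\mathfrak H}_h^k(K)$. $\mathfrak H_h^k=\{v\in V_h^k:\mathrm dv=0,\ v\perp_{L^2}\mathrm dV_h^{k-1}\}$. The standard FEEC system for the Hodge–Laplace problem has unknowns in $V_h^{k-1}\times V_h^k\times\mathfrak H_h^k$, and the hybridized and statically condensed system has unknowns in $\mathfrak H_h^k\times\overline{\mathfrak H}_h^k\times\widehat V_h^{k-1,\mathrm{tan}}\times\widehat V_h^{k,\mathrm{tan}}$; "size" means the dimension of the space of unknowns. *)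

theory Defs
  imports
    "HOL-Analysis.Analysis"
    "HOL-Library.FuncSet"
    "HOL-Algebra.AbelCoset"
    "Jordan_Normal_Form.Missing_VectorSpace"
begin

text \<open>
  Conventions. The space \<open>\<real>\<^sup>n\<close> is an arbitrary euclidean space \<open>'a\<close> with \<open>n = DIM('a)\<close>. Degrees of
  forms are integers, so that degree \<open>-1\<close> makes sense; the spaces of forms of degree outside
  \<open>{0..n}\<close> come out as zero. A \<open>j\<close>-covector is a function on lists of vectors which is supported
  on the lists of length \<open>j\<close>. The space \<open>L\<^sup>2\<Lambda>\<^sup>j(S)\<close> is realised isometrically inside the forms
  on the whole space, as the classes (modulo equality almost everywhere) of forms vanishing
  outside \<open>S\<close>; accordingly no integral below has to mention the domain.
\<close>


section \<open>Alternating covectors\<close>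

definition alternating :: "int \<Rightarrow> ('a::real_vector list \<Rightarrow> real) \<Rightarrow> bool" where
  "alternating j \<alpha> \<longleftrightarrow>
     (\<forall>vs. int (length vs) \<noteq> j \<longrightarrow> \<alpha> vs = 0) \<and>
     (\<forall>vs i. int (length vs) = j \<longrightarrow> i < length vs \<longrightarrow> linear (\<lambda>v. \<alpha> (vs[i := v]))) \<and>
     (\<forall>vs. \<not> distinct vs \<longrightarrow> \<alpha> vs = 0)"

text \<open>
  The usual inner product, for which the covectors \<open>e\<^sub>I\<close> with increasing multi-indices \<open>I\<close> are
  orthonormal. Summing over all lists of basis vectors counts each \<open>I\<close> exactly
  \<open>(length I)!\<close> times, whence the factor. Different degrees are orthogonal.
\<close>
definition alt_inner :: "('a::euclidean_space list \<Rightarrow> real) \<Rightarrow> ('a list \<Rightarrow> real) \<Rightarrow> real" where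
  "alt_inner \<alpha> \<beta> =
     (\<Sum>bs | set bs \<subseteq> Basis \<and> length bs \<le> DIM('a). \<alpha> bs * \<beta> bs / fact (length bs))"


section \<open>Test functions\<close>

primrec times_cont_diff :: "nat \<Rightarrow> ('a::real_normed_vector \<Rightarrow> real) \<Rightarrow> bool" where
  "times_cont_diff 0 f \<longleftrightarrow> continuous_on UNIV f"
| "times_cont_diff (Suc m) f \<longleftrightarrow>
     f differentiable_on UNIV \<and> (\<forall>v. times_cont_diff m (\<lambda>x. frechet_derivative f (at x) v))"

definition smooth :: "('a::real_normed_vector \<Rightarrow> real) \<Rightarrow> bool" where
  "smooth f \<longleftrightarrow> (\<forall>m. times_cont_diff m f)"

definition test_function :: "'a::euclidean_space set \<Rightarrow> ('a \<Rightarrow> real) \<Rightarrow> bool" where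
  "test_function S \<phi> \<longleftrightarrow>
     smooth \<phi> \<and> compact (closure {x. \<phi> x \<noteq> 0}) \<and> closure {x. \<phi> x \<noteq> 0} \<subseteq> S"


section \<open>Forms modulo equality almost everywhere\<close>

lemma lebesgue_integral_cong_AE:
  fixes f g :: "'a::euclidean_space \<Rightarrow> real"
  assumes fg: "AE x in lebesgue. f x = g x"
  shows "integral\<^sup>L lebesgue f = integral\<^sup>L lebesgue g"
proof (cases "f \<in> borel_measurable lebesgue")
  case True
  then show ?thesis
    using fg borel_measurable_AE[OF True fg] by (intro integral_cong_AE)
next
  case False
  have "AE x in lebesgue. g x = f x"
    using fg by (auto elim: AE_mp)
  then have "g \<notin> borel_measurable lebesgue"
    using False borel_measurable_AE by blast
  then show ?thesis
    using False by (metis borel_measurable_integrable not_integrable_integral_eq)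
qed

quotient_type (overloaded) 'a dform = "'a::euclidean_space \<Rightarrow> 'a list \<Rightarrow> real" /
  "\<lambda>f g. AE x in lebesgue. f x = g x"
proof (rule equivpI)
  show "reflp (\<lambda>f g::'a \<Rightarrow> 'a list \<Rightarrow> real. AE x in lebesgue. f x = g x)"
    by (rule reflpI) simp
  show "symp (\<lambda>f g::'a \<Rightarrow> 'a list \<Rightarrow> real. AE x in lebesgue. f x = g x)"
    by (rule sympI) (simp add: eq_commute)
  show "transp (\<lambda>f g::'a \<Rightarrow> 'a list \<Rightarrow> real. AE x in lebesgue. f x = g x)"
    by (rule transpI) (auto elim: AE_mp)
qed

instantiation dform :: (euclidean_space) real_vector
begin

lift_definition zero_dform :: "'a dform" is "\<lambda>x vs. 0" .

lift_definition plus_dform :: "'a dform \<Rightarrow> 'a dform \<Rightarrow> 'a dform" is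
  "\<lambda>f g x vs. f x vs + g x vs"
  by (auto elim!: AE_mp)

lift_definition minus_dform :: "'a dform \<Rightarrow> 'a dform \<Rightarrow> 'a dform" is
  "\<lambda>f g x vs. f x vs - g x vs"
  by (auto elim!: AE_mp)

lift_definition uminus_dform :: "'a dform \<Rightarrow> 'a dform" is "\<lambda>f x vs. - f x vs"
  by (auto elim!: AE_mp)

lift_definition scaleR_dform :: "real \<Rightarrow> 'a dform \<Rightarrow> 'a dform" is "\<lambda>c f x vs. c * f x vs"
  by (auto elim!: AE_mp)

instance
  by (standard; transfer) (auto simp: algebra_simps)

end

lift_definition form_inner :: "'a::euclidean_space dform \<Rightarrow> 'a dform \<Rightarrow> real" is
  "\<lambda>f g. LINT x|lebesgue. alt_inner (f x) (g x)"
  by (rule lebesgue_integral_cong_AE) (auto elim!: AE_mp)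

lift_definition restrict_form :: "'a::euclidean_space set \<Rightarrow> 'a dform \<Rightarrow> 'a dform" is
  "\<lambda>S f x. if x \<in> S then f x else (\<lambda>vs. 0)"
  by (auto elim!: AE_mp)

definition L2_forms :: "int \<Rightarrow> 'a::euclidean_space set \<Rightarrow> 'a dform set" where
  "L2_forms j S = {abs_dform f | f.
     (\<forall>x. alternating j (f x)) \<and>
     (\<forall>x. x \<notin> S \<longrightarrow> f x = (\<lambda>vs. 0)) \<and>
     (\<forall>vs. (\<lambda>x. f x vs) \<in> borel_measurable lebesgue) \<and>
     integrable lebesgue (\<lambda>x. alt_inner (f x) (f x))}"

definition test_forms :: "int \<Rightarrow> 'a::euclidean_space set \<Rightarrow> 'a dform set" where
  "test_forms j S = {abs_dform f | f.
     (\<forall>x. alternating j (f x)) \<and>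
     (\<forall>vs. smooth (\<lambda>x. f x vs)) \<and>
     compact (closure {x. f x \<noteq> (\<lambda>vs. 0)}) \<and> closure {x. f x \<noteq> (\<lambda>vs. 0)} \<subseteq> S}"


section \<open>The distributional exterior derivative\<close>

text \<open>
  For smooth \<open>f\<close> one has
  \<open>(df)(v\<^sub>0,\<dots>,v\<^sub>j) = (\<Sum>i\<le>j. (-1)\<^sup>i \<partial>\<^bsub>v\<^sub>i\<^esub> (f(v\<^sub>0,\<dots>,v\<^sub>j without v\<^sub>i)))\<close>; here the derivatives
  \<open>\<partial>\<^bsub>v\<^sub>i\<^esub>\<close> are taken in the sense of distributions on \<open>S\<close>.
\<close>
lift_definition weak_ext_deriv ::
    "'a::euclidean_space set \<Rightarrow> 'a dform \<Rightarrow> 'a dform \<Rightarrow> bool" is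
  "\<lambda>S f g. \<forall>\<phi> vs. test_function S \<phi> \<longrightarrow>
     (LINT x|lebesgue. g x vs * \<phi> x) =
     - (\<Sum>i<length vs. (-1) ^ i *
         (LINT x|lebesgue. f x (take i vs @ drop (Suc i) vs) *
                           frechet_derivative \<phi> (at x) (vs ! i)))"
proof -
  fix S :: "'a set" and f f' g g' :: "'a \<Rightarrow> 'a list \<Rightarrow> real"
  assume "AE x in lebesgue. f x = f' x" and "AE x in lebesgue. g x = g' x"
  then have "(LINT x|lebesgue. g x vs * \<phi> x) = (LINT x|lebesgue. g' x vs * \<phi> x)"
    and "(LINT x|lebesgue. f x ws * \<phi> x) = (LINT x|lebesgue. f' x ws * \<phi> x)"
    for vs ws and \<phi> :: "'a \<Rightarrow> real"
    by (auto intro!: lebesgue_integral_cong_AE elim!: AE_mp)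
  then show "(\<forall>\<phi> vs. test_function S \<phi> \<longrightarrow>
      (LINT x|lebesgue. g x vs * \<phi> x) =
      - (\<Sum>i<length vs. (-1) ^ i *
          (LINT x|lebesgue. f x (take i vs @ drop (Suc i) vs) *
                            frechet_derivative \<phi> (at x) (vs ! i)))) =
    (\<forall>\<phi> vs. test_function S \<phi> \<longrightarrow>
      (LINT x|lebesgue. g' x vs * \<phi> x) =
      - (\<Sum>i<length vs. (-1) ^ i *
          (LINT x|lebesgue. f' x (take i vs @ drop (Suc i) vs) *
                            frechet_derivative \<phi> (at x) (vs ! i))))"
    by presburger
qed

definition H_forms :: "int \<Rightarrow> 'a::euclidean_space set \<Rightarrow> 'a dform set" where
  "H_forms j S = {u \<in> L2_forms j S. \<exists>w \<in> L2_forms (j + 1) S. weak_ext_deriv S u w}"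

text \<open>For open \<open>S\<close> the weak derivative in \<open>L\<^sup>2\<close> is unique, by the fundamental lemma.\<close>
definition ext_d :: "int \<Rightarrow> 'a::euclidean_space set \<Rightarrow> 'a dform \<Rightarrow> 'a dform" where
  "ext_d j S u = (THE w. w \<in> L2_forms (j + 1) S \<and> weak_ext_deriv S u w)"

definition graph_norm :: "int \<Rightarrow> 'a::euclidean_space set \<Rightarrow> 'a dform \<Rightarrow> real" where
  "graph_norm j S u = sqrt (form_inner u u + form_inner (ext_d j S u) (ext_d j S u))"

definition H0_forms :: "int \<Rightarrow> 'a::euclidean_space set \<Rightarrow> 'a dform set" where
  "H0_forms j S =
     {u \<in> H_forms j S. \<forall>e>0. \<exists>\<phi> \<in> test_forms j S. graph_norm j S (u - \<phi>) < e}"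


section \<open>Lipschitz domains and decompositions\<close>

text \<open>
  Near each boundary point, \<open>S\<close> lies above the graph of a Lipschitz function \<open>g\<close> on a hyperplane;
  the unit vector \<open>e\<close> is the local vertical direction.
\<close>
definition lipschitz_domain :: "'a::euclidean_space set \<Rightarrow> bool" where
  "lipschitz_domain S \<longleftrightarrow> open S \<and> connected S \<and> S \<noteq> {} \<and>
     (\<forall>x \<in> frontier S. \<exists>U e L g. open U \<and> x \<in> U \<and> norm e = 1 \<and>
        L-lipschitz_on {y. y \<bullet> e = 0} g \<and>
        S \<inter> U = {y \<in> U. g (y - (y \<bullet> e) *\<^sub>R e) < y \<bullet> e})"

definition lipschitz_decomposition :: "'a::euclidean_space set \<Rightarrow> 'a set set \<Rightarrow> bool" where
  "lipschitz_decomposition \<Omega> T \<longleftrightarrow>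
     finite T \<and> (\<forall>K\<in>T. lipschitz_domain K \<and> K \<subseteq> \<Omega>) \<and> pairwise disjnt T \<and>
     closure \<Omega> = (\<Union>K\<in>T. closure K)"


section \<open>Vector spaces with explicit carriers\<close>

text \<open>
  Spaces of tangential traces consist of tuples of cosets, so dimensions are taken in the
  sense of vector spaces given by a record.
\<close>

definition real_ring :: "real ring" where
  "real_ring = \<lparr>carrier = UNIV, mult = (*), one = 1, zero = 0, add = (+)\<rparr>"

abbreviation vdim :: "(real, 'v, 'm) module_scheme \<Rightarrow> nat" where
  "vdim \<equiv> vectorspace.dim real_ring"

text \<open>
  The fields \<open>mult\<close> and \<open>one\<close> of a module record carry no meaning.
\<close>
definition lin_space :: "'v::real_vector set \<Rightarrow> (real, 'v) module" where
  "lin_space S = \<lparr>carrier = S, mult = (\<lambda>_ _. 0), one = 0, zero = 0, add = (+), smult = (*\<^sub>R)\<rparr>"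

definition quotient_space :: "(real, 'v) module \<Rightarrow> 'v set \<Rightarrow> (real, 'v set) module" where
  "quotient_space V N =
     \<lparr>carrier = A_RCOSETS V N, mult = (\<lambda>_ _. N), one = N, zero = N, add = set_add V,
      smult = (\<lambda>c A. \<Union>a\<in>A. a_r_coset V N (c \<odot>\<^bsub>V\<^esub> a))\<rparr>"

definition product_space :: "'i set \<Rightarrow> ('i \<Rightarrow> (real, 'v) module) \<Rightarrow> (real, 'i \<Rightarrow> 'v) module" where
  "product_space I V =
     \<lparr>carrier = (\<Pi>\<^sub>E i\<in>I. carrier (V i)),
      mult = (\<lambda>_ _. \<lambda>i\<in>I. \<zero>\<^bsub>V i\<^esub>), one = (\<lambda>i\<in>I. \<zero>\<^bsub>V i\<^esub>), zero = (\<lambda>i\<in>I. \<zero>\<^bsub>V i\<^esub>),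
      add = (\<lambda>f g. \<lambda>i\<in>I. f i \<oplus>\<^bsub>V i\<^esub> g i), smult = (\<lambda>c f. \<lambda>i\<in>I. c \<odot>\<^bsub>V i\<^esub> f i)\<rparr>"


section \<open>Broken and unbroken complexes\<close>

definition finite_dim_subcomplex ::
    "'a::euclidean_space set \<Rightarrow> (int \<Rightarrow> 'a dform set) \<Rightarrow> bool" where
  "finite_dim_subcomplex K W \<longleftrightarrow>
     (\<forall>j. W j \<subseteq> H_forms j K \<and> (\<exists>B. finite B \<and> W j = real_vector.span B) \<and>
          ext_d j K ` W j \<subseteq> W (j + 1))"

definition broken_forms ::
    "'a set set \<Rightarrow> ('a::euclidean_space set \<Rightarrow> int \<Rightarrow> 'a dform set) \<Rightarrow> int \<Rightarrow>
     ('a set \<Rightarrow> 'a dform) set" where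
  "broken_forms T W j = (\<Pi>\<^sub>E K\<in>T. W K j)"

definition unbroken_forms ::
    "'a set \<Rightarrow> 'a set set \<Rightarrow> ('a::euclidean_space set \<Rightarrow> int \<Rightarrow> 'a dform set) \<Rightarrow> int \<Rightarrow>
     'a dform set" where
  "unbroken_forms \<Omega> T W j =
     {v \<in> H_forms j \<Omega>. (\<lambda>K\<in>T. restrict_form K v) \<in> broken_forms T W j}"

definition tan_trace_space ::
    "int \<Rightarrow> 'a::euclidean_space set \<Rightarrow> (real, 'a dform set) module" where
  "tan_trace_space j K = quotient_space (lin_space (H_forms j K)) (H0_forms j K)"

definition tan_trace :: "int \<Rightarrow> 'a::euclidean_space set \<Rightarrow> 'a dform \<Rightarrow> 'a dform set" where
  "tan_trace j K v = a_r_coset (lin_space (H_forms j K)) (H0_forms j K) v"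

text \<open>
  The trace on the disjoint union of the boundaries \<open>\<partial>K\<close> is the tuple of the cosets
  \<open>tan_trace j K (v|\<^sub>K)\<close>; vector space operations are inherited from the product of the quotients.
\<close>
definition unbroken_traces ::
    "'a set \<Rightarrow> 'a set set \<Rightarrow> ('a::euclidean_space set \<Rightarrow> int \<Rightarrow> 'a dform set) \<Rightarrow> int \<Rightarrow>
     (real, 'a set \<Rightarrow> 'a dform set) module" where
  "unbroken_traces \<Omega> T W j =
     (product_space T (tan_trace_space j))
       \<lparr>carrier := (\<lambda>v. \<lambda>K\<in>T. tan_trace j K (restrict_form K v)) ` unbroken_forms \<Omega> T W j\<rparr>"

definition harmonic_forms ::
    "'a set \<Rightarrow> 'a set set \<Rightarrow> ('a::euclidean_space set \<Rightarrow> int \<Rightarrow> 'a dform set) \<Rightarrow> int \<Rightarrow>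
     'a dform set" where
  "harmonic_forms \<Omega> T W k =
     {v \<in> unbroken_forms \<Omega> T W k. ext_d k \<Omega> v = 0 \<and>
        (\<forall>w \<in> unbroken_forms \<Omega> T W (k - 1). form_inner v (ext_d (k - 1) \<Omega> w) = 0)}"


section \<open>Local spaces with vanishing trace\<close>

text \<open>In the next five definitions \<open>W\<close> is the complex on the single subdomain \<open>K\<close>.\<close>

definition local_W0 :: "'a::euclidean_space set \<Rightarrow> (int \<Rightarrow> 'a dform set) \<Rightarrow> int \<Rightarrow> 'a dform set" where
  "local_W0 K W j = W j \<inter> H0_forms j K"

definition local_B0 :: "'a::euclidean_space set \<Rightarrow> (int \<Rightarrow> 'a dform set) \<Rightarrow> int \<Rightarrow> 'a dform set" where
  "local_B0 K W k = ext_d (k - 1) K ` local_W0 K W (k - 1)"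

definition local_Z0 :: "'a::euclidean_space set \<Rightarrow> (int \<Rightarrow> 'a dform set) \<Rightarrow> int \<Rightarrow> 'a dform set" where
  "local_Z0 K W k = {v \<in> local_W0 K W k. ext_d k K v = 0}"

definition local_H0 :: "'a::euclidean_space set \<Rightarrow> (int \<Rightarrow> 'a dform set) \<Rightarrow> int \<Rightarrow> 'a dform set" where
  "local_H0 K W k = {v \<in> local_Z0 K W k. \<forall>b \<in> local_B0 K W k. form_inner v b = 0}"

definition local_Z0_perp ::
    "'a::euclidean_space set \<Rightarrow> (int \<Rightarrow> 'a dform set) \<Rightarrow> int \<Rightarrow> 'a dform set" where
  "local_Z0_perp K W k = {v \<in> local_W0 K W k. \<forall>z \<in> local_Z0 K W k. form_inner v z = 0}"

definition local_harmonics ::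
    "'a set set \<Rightarrow> ('a::euclidean_space set \<Rightarrow> int \<Rightarrow> 'a dform set) \<Rightarrow> int \<Rightarrow>
     (real, 'a set \<Rightarrow> 'a dform) module" where
  "local_harmonics T W k = product_space T (\<lambda>K. lin_space (local_H0 K (W K) k))"


section \<open>Spaces of unknowns\<close>

definition standard_unknowns where
  "standard_unknowns \<Omega> T W k =
     direct_sum (lin_space (unbroken_forms \<Omega> T W (k - 1)))
       (direct_sum (lin_space (unbroken_forms \<Omega> T W k))
          (lin_space (harmonic_forms \<Omega> T W k)))"

definition condensed_unknowns where
  "condensed_unknowns \<Omega> T W k =
     direct_sum (lin_space (harmonic_forms \<Omega> T W k))
       (direct_sum (local_harmonics T W k)
          (direct_sum (unbroken_traces \<Omega> T W (k - 1)) (unbroken_traces \<Omega> T W k)))"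

end

theory Submission
  imports Defs
begin

text \<open>
  The kernel of the tangential trace on \<open>V\<^sub>h\<close> consists of the forms whose restriction to every \<open>K\<close> has
  vanishing trace. A form with vanishing trace on \<open>K\<close> is a limit of test forms, so its extension by
  zero has a weak derivative on \<open>\<Omega>\<close>; since moreover the subdomains cover \<open>\<Omega>\<close> up to the null set of
  their Lipschitz boundaries, the kernel is the product of the local spaces with vanishing trace.
  Rank-nullity thus expresses \<open>dim V\<^sub>h\<close> in degrees \<open>k - 1\<close> and \<open>k\<close> by the dimensions of the traces and
  of the local spaces. In degree \<open>k\<close> the discrete Hodge decomposition splits each local space
  orthogonally into boundaries, harmonic forms and the complement of the cycles, and the harmonic
  part cancels against the local harmonic forms. The analytic input is that the weak derivative in
  \<open>L\<^sup>2\<close> is unique, vanishes when applied twice, is stable under limits, and extends the classical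
  derivative of test forms.
\<close>

section \<open>Smooth functions\<close>

text \<open>The local forms of the kernel can be prescribed independently of each other: a vanishing
  trace leaves no jump across an interface, so each of them, extended by zero, lies in
  \<open>H_forms j \<Omega>\<close> on its own. The trace spaces enter as images of
  \<open>unbroken_forms\<close>, so their dimensions are ranks. The exterior derivative is a
  definite description, so even its linearity has to wait for uniqueness, that is, for the
  fundamental lemma of the calculus of variations, which is derived here from explicit bump
  functions on boxes. That d applied twice vanishes is used for two purposes: boundaries are cycles,
  and \<open>ext_d\<close> maps \<open>H0_forms\<close> into itself, because an approximation of u
  in the graph norm then yields one of du. The difference of the two sizes is a sum of natural
  numbers, so the equality case asks when every summand is zero. The boundaries are an image of the
  local space in degree k - 1 and vanish together with it; this is why the criterion for equality
  does not list them separately.\<close>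

lemma has_derivative_frechet:
  assumes "f differentiable_on UNIV"
  shows "(f has_derivative frechet_derivative f (at x)) (at x)"
  using assms by (simp add: differentiable_on_def frechet_derivative_works)

lemma frechet_derivative_eqI:
  "(f has_derivative f') (at x) \<Longrightarrow> frechet_derivative f (at x) = f'"
  using frechet_derivative_at by metis

text \<open>Lets the derivative be supplied as an explicit formula; uniqueness of the Frechet
  derivative identifies it with the one chosen in \<open>times_cont_diff\<close>.\<close>

lemma times_cont_diff_SucI:
  assumes "\<And>x. (f has_derivative f' x) (at x)" "\<And>v. times_cont_diff m (\<lambda>x. f' x v)"
  shows "times_cont_diff (Suc m) f"
proof -
  have "frechet_derivative f (at x) = f' x" for x
    using assms(1) by (rule frechet_derivative_eqI)
  then show ?thesis
    using assms by (auto simp: differentiable_on_def differentiable_def)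
qed

lemma times_cont_diff_Suc_imp: "times_cont_diff (Suc m) f \<Longrightarrow> times_cont_diff m f"
  by (induction m arbitrary: f) (auto simp: differentiable_imp_continuous_on)

lemma times_cont_diff_const: "times_cont_diff m (\<lambda>x. c)"
  by (induction m arbitrary: c) (auto intro: times_cont_diff_SucI[where f' = "\<lambda>_ _. 0"])

lemma times_cont_diff_add:
  "times_cont_diff m f \<Longrightarrow> times_cont_diff m g \<Longrightarrow> times_cont_diff m (\<lambda>x. f x + g x)"
proof (induction m arbitrary: f g)
  case (Suc m)
  show ?case
    by (rule times_cont_diff_SucI[where
          f' = "\<lambda>x v. frechet_derivative f (at x) v + frechet_derivative g (at x) v"])
       (use Suc in \<open>auto intro!: has_derivative_add has_derivative_frechet\<close>)
qed (auto intro: continuous_on_add)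

lemma times_cont_diff_mult:
  "times_cont_diff m f \<Longrightarrow> times_cont_diff m g \<Longrightarrow> times_cont_diff m (\<lambda>x. f x * g x)"
proof (induction m arbitrary: f g)
  case (Suc m)
  show ?case
  proof (rule times_cont_diff_SucI[where
        f' = "\<lambda>x v. f x * frechet_derivative g (at x) v + frechet_derivative f (at x) v * g x"])
    show "((\<lambda>x. f x * g x) has_derivative
        (\<lambda>v. f x * frechet_derivative g (at x) v + frechet_derivative f (at x) v * g x)) (at x)" for x
      using Suc.prems by (intro has_derivative_mult has_derivative_frechet) auto
    show "times_cont_diff m
        (\<lambda>x. f x * frechet_derivative g (at x) v + frechet_derivative f (at x) v * g x)" for v
      using Suc.prems times_cont_diff_Suc_imp[OF Suc.prems(1)] times_cont_diff_Suc_imp[OF Suc.prems(2)]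
      by (intro times_cont_diff_add Suc.IH) auto
  qed
qed (auto intro: continuous_on_mult)

lemma smooth_const [simp]: "smooth (\<lambda>x. c)"
  by (simp add: smooth_def times_cont_diff_const)

lemma smooth_add: "smooth f \<Longrightarrow> smooth g \<Longrightarrow> smooth (\<lambda>x. f x + g x)"
  by (simp add: smooth_def times_cont_diff_add)

lemma smooth_mult: "smooth f \<Longrightarrow> smooth g \<Longrightarrow> smooth (\<lambda>x. f x * g x)"
  by (simp add: smooth_def times_cont_diff_mult)

lemma smooth_sum: "(\<And>i. i \<in> I \<Longrightarrow> smooth (f i)) \<Longrightarrow> smooth (\<lambda>x. \<Sum>i\<in>I. f i x)"
  by (induction I rule: infinite_finite_induct) (auto intro: smooth_add)

lemma smooth_prod: "(\<And>i. i \<in> I \<Longrightarrow> smooth (f i)) \<Longrightarrow> smooth (\<lambda>x. \<Prod>i\<in>I. f i x)"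
  by (induction I rule: infinite_finite_induct) (auto intro: smooth_mult)

lemma smooth_frechet_derivative: "smooth f \<Longrightarrow> smooth (\<lambda>x. frechet_derivative f (at x) v)"
  unfolding smooth_def by (metis times_cont_diff.simps(2))

lemma smooth_differentiable_on: "smooth f \<Longrightarrow> f differentiable_on UNIV"
  unfolding smooth_def by (metis times_cont_diff.simps(2))

lemma smooth_continuous_on: "smooth f \<Longrightarrow> continuous_on UNIV f"
  by (simp add: differentiable_imp_continuous_on smooth_differentiable_on)

lemma smooth_has_derivative: "smooth f \<Longrightarrow> (f has_derivative frechet_derivative f (at x)) (at x)"
  by (simp add: has_derivative_frechet smooth_differentiable_on)

section \<open>Symmetry of second derivatives\<close>

lemma smooth_DERIV_along_line:
  assumes "smooth f"
  shows "((\<lambda>t. f (x + t *\<^sub>R v)) has_real_derivative frechet_derivative f (at (x + t *\<^sub>R v)) v) (at t)"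
proof -
  have "((\<lambda>t. f (x + t *\<^sub>R v)) has_derivative (\<lambda>s. frechet_derivative f (at (x + t *\<^sub>R v)) (s *\<^sub>R v))) (at t)"
    by (rule has_derivative_compose[where g = f and f = "\<lambda>t. x + t *\<^sub>R v", rotated])
       (auto intro!: smooth_has_derivative assms derivative_eq_intros)
  moreover have "linear (frechet_derivative f (at (x + t *\<^sub>R v)))"
    using smooth_has_derivative[OF assms] has_derivative_linear by blast
  ultimately show ?thesis
    by (simp add: has_field_derivative_def linear_cmul mult.commute[of _ "frechet_derivative _ _ _"])
qed

text \<open>The increment along \<open>b\<close> is viewed as a function of the displacement along
  \<open>a\<close>. The mean value theorem in direction \<open>a\<close> leaves an increment along
  \<open>b\<close> of the derivative, to which it applies a second time.\<close>

lemma second_difference: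
  fixes f :: "'a::real_normed_vector \<Rightarrow> real"
  assumes f: "smooth f" and h: "0 < h"
  obtains s t where "0 < s" "s < h" "0 < t" "t < h"
    "f (x + h *\<^sub>R a + h *\<^sub>R b) - f (x + h *\<^sub>R a) - f (x + h *\<^sub>R b) + f x =
      h * h * frechet_derivative (\<lambda>y. frechet_derivative f (at y) a) (at (x + s *\<^sub>R a + t *\<^sub>R b)) b"
proof -
  define F where "F = (\<lambda>s. f (x + h *\<^sub>R b + s *\<^sub>R a) - f (x + s *\<^sub>R a))"
  have "\<exists>s. 0 < s \<and> s < h \<and> F h - F 0 = (h - 0) *
      (frechet_derivative f (at (x + h *\<^sub>R b + s *\<^sub>R a)) a - frechet_derivative f (at (x + s *\<^sub>R a)) a)"
    unfolding F_def
    by (rule MVT2[OF h]) (intro DERIV_diff smooth_DERIV_along_line f)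
  then obtain s where s: "0 < s" "s < h" "F h - F 0 = h *
      (frechet_derivative f (at (x + h *\<^sub>R b + s *\<^sub>R a)) a - frechet_derivative f (at (x + s *\<^sub>R a)) a)"
    by auto
  define g where "g = (\<lambda>y. frechet_derivative f (at y) a)"
  have g: "smooth g"
    unfolding g_def by (rule smooth_frechet_derivative[OF f])
  define G where "G = (\<lambda>t. g (x + s *\<^sub>R a + t *\<^sub>R b))"
  have "\<exists>t. 0 < t \<and> t < h \<and> G h - G 0 = (h - 0) *
      frechet_derivative g (at (x + s *\<^sub>R a + t *\<^sub>R b)) b"
    unfolding G_def by (rule MVT2[OF h]) (intro smooth_DERIV_along_line g)
  then obtain t where t: "0 < t" "t < h"
      "G h - G 0 = h * frechet_derivative g (at (x + s *\<^sub>R a + t *\<^sub>R b)) b"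
    by auto
  have "F h - F 0 = h * (G h - G 0)"
    using s(3) by (simp add: G_def g_def algebra_simps)
  with that[OF s(1,2) t(1,2)] t(3) show thesis
    by (simp add: F_def g_def algebra_simps)
qed

text \<open>The second difference quotient is symmetric in \<open>a\<close> and \<open>b\<close>, and both sides are its limit.\<close>
lemma frechet_derivative_commute:
  fixes f :: "'a::real_normed_vector \<Rightarrow> real"
  assumes f: "smooth f"
  shows "frechet_derivative (\<lambda>y. frechet_derivative f (at y) a) (at x) b =
    frechet_derivative (\<lambda>y. frechet_derivative f (at y) b) (at x) a"
proof -
  define D where "D = (\<lambda>a b y. frechet_derivative (\<lambda>y. frechet_derivative f (at y) a) (at y) b)"
  define h where "h = (\<lambda>n. 1 / real (Suc n))"
  have h: "0 < h n" for n
    by (simp add: h_def)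
  have h0: "h \<longlonglongrightarrow> 0"
    using LIMSEQ_inverse_real_of_nat by (simp add: h_def inverse_eq_divide)
  have cont: "isCont (D a b) y" for a b y
    using smooth_continuous_on[OF smooth_frechet_derivative[OF smooth_frechet_derivative[OF f]]]
    by (simp add: D_def continuous_on_eq_continuous_at)
  define R where "R = (\<lambda>a b n. (f (x + h n *\<^sub>R a + h n *\<^sub>R b) - f (x + h n *\<^sub>R a) - f (x + h n *\<^sub>R b) + f x) / (h n * h n))"
  have lim: "(R a b) \<longlonglongrightarrow> D a b x" for a b
  proof -
    have "\<exists>s t. 0 < s \<and> s < h n \<and> 0 < t \<and> t < h n \<and> R a b n = D a b (x + s *\<^sub>R a + t *\<^sub>R b)" for n
    proof -
      obtain s t where "0 < s" "s < h n" "0 < t" "t < h n"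
          "f (x + h n *\<^sub>R a + h n *\<^sub>R b) - f (x + h n *\<^sub>R a) - f (x + h n *\<^sub>R b) + f x =
            h n * h n * D a b (x + s *\<^sub>R a + t *\<^sub>R b)"
        unfolding D_def by (rule second_difference[OF f h])
      then show ?thesis
        using h[of n] by (intro exI[of _ s] exI[of _ t]) (simp add: R_def)
    qed
    then obtain s t where st: "0 < s n" "s n < h n" "0 < t n" "t n < h n"
        "R a b n = D a b (x + s n *\<^sub>R a + t n *\<^sub>R b)" for n
      by metis
    have "s \<longlonglongrightarrow> 0"
      by (rule tendsto_sandwich[OF _ _ tendsto_const h0]) (auto intro!: always_eventually less_imp_le st)
    moreover have "t \<longlonglongrightarrow> 0"
      by (rule tendsto_sandwich[OF _ _ tendsto_const h0]) (auto intro!: always_eventually less_imp_le st)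
    ultimately have "(\<lambda>n. x + s n *\<^sub>R a + t n *\<^sub>R b) \<longlonglongrightarrow> x + 0 *\<^sub>R a + 0 *\<^sub>R b"
      by (intro tendsto_intros)
    then have "(\<lambda>n. D a b (x + s n *\<^sub>R a + t n *\<^sub>R b)) \<longlonglongrightarrow> D a b x"
      using isCont_tendsto_compose[OF cont] by auto
    then show ?thesis
      using st(5) by (simp add: R_def)
  qed
  have "R a b = R b a"
    by (auto simp: R_def algebra_simps)
  then have "D a b x = D b a x"
    using lim[of a b] lim[of b a] LIMSEQ_unique by metis
  then show ?thesis
    by (simp add: D_def)
qed

section \<open>Smooth cutoffs on boxes, built from exp(-1/t)\<close>

definition flat_exp :: "real poly \<Rightarrow> real \<Rightarrow> real" where
  "flat_exp p t = (if t > 0 then poly p (1 / t) * exp (- (1 / t)) else 0)"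

lemma tendsto_poly_mult_exp_minus:
  fixes p :: "real poly"
  shows "((\<lambda>s. poly p s * exp (- s)) \<longlongrightarrow> 0) at_top"
proof -
  have "((\<lambda>s. \<Sum>i\<le>degree p. coeff p i * (s ^ i / exp s)) \<longlongrightarrow> (\<Sum>i\<le>degree p. coeff p i * 0)) at_top"
    by (intro tendsto_intros tendsto_power_div_exp_0)
  moreover have "(\<lambda>s. poly p s * exp (- s)) = (\<lambda>s. \<Sum>i\<le>degree p. coeff p i * (s ^ i / exp s))"
    by (auto simp: poly_altdef exp_minus sum_distrib_right divide_inverse mult.assoc)
  ultimately show ?thesis
    by simp
qed

lemma flat_exp_tendsto_0: "(flat_exp p \<longlongrightarrow> 0) (at 0)"
proof -
  have "((\<lambda>t. poly p (inverse t) * exp (- inverse t)) \<longlongrightarrow> 0) (at_right 0)"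
    by (rule filterlim_compose[OF tendsto_poly_mult_exp_minus filterlim_inverse_at_top_right])
  then have right: "(flat_exp p \<longlongrightarrow> 0) (at_right 0)"
    by (rule Lim_transform_eventually)
       (auto simp: flat_exp_def inverse_eq_divide eventually_at_right_less intro!: eventually_mono[OF eventually_at_right_less])
  have left: "(flat_exp p \<longlongrightarrow> 0) (at_left 0)"
    by (rule Lim_transform_eventually[OF tendsto_const])
       (auto simp: flat_exp_def eventually_at_filter)
  show ?thesis
    using left right by (simp add: filterlim_split_at)
qed

text \<open>With s = 1/t, differentiation in t is -s^2 times differentiation in s, and p(s) exp(-s)
  has derivative (p' - p)(s) exp(-s). The polynomial factor is carried along precisely because this
  family is closed under differentiation.\<close>

lemma flat_exp_DERIV:
  "(flat_exp p has_real_derivative flat_exp ([:0, 0, 1:] * (p - pderiv p)) t) (at t)"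
proof (cases t "0::real" rule: linorder_cases)
  case less
  have "((\<lambda>t. 0) has_real_derivative flat_exp ([:0, 0, 1:] * (p - pderiv p)) t) (at t)"
    using less by (simp add: flat_exp_def)
  then show ?thesis
    by (rule has_field_derivative_transform_within_open[where S = "{..<0}"])
       (use less in \<open>auto simp: flat_exp_def\<close>)
next
  case greater
  have "((\<lambda>t. poly p (1 / t) * exp (- (1 / t))) has_real_derivative
      flat_exp ([:0, 0, 1:] * (p - pderiv p)) t) (at t)"
    using greater by (auto intro!: derivative_eq_intros simp: flat_exp_def field_simps power2_eq_square)
  then show ?thesis
    by (rule has_field_derivative_transform_within_open[where S = "{0<..}"])
       (use greater in \<open>auto simp: flat_exp_def\<close>)
next
  case equal
  \<comment> \<open>At 0 the difference quotient is again a flat exponential, with the polynomial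
    multiplied by its variable, so it tends to 0.\<close>
  have "(\<lambda>h. (flat_exp p (0 + h) - flat_exp p 0) / h) = flat_exp (pCons 0 p)"
    by (auto simp: flat_exp_def)
  then show ?thesis
    using equal flat_exp_tendsto_0[of "pCons 0 p"] unfolding DERIV_def by (simp add: flat_exp_def)
qed

text \<open>The induction on the order keeps \<open>p\<close> arbitrary, since each derivative
  brings in a new polynomial.\<close>

lemma smooth_flat_exp_affine: "smooth (\<lambda>x::'a::real_inner. flat_exp p (x \<bullet> e + c))"
proof -
  have "times_cont_diff m (\<lambda>x::'a. flat_exp p (x \<bullet> e + c))" for m
  proof (induction m arbitrary: p)
    case 0
    have "isCont (flat_exp p) t" for t
      using flat_exp_DERIV DERIV_isCont by blast
    then have "isCont (\<lambda>x::'a. flat_exp p (x \<bullet> e + c)) x" for x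
      by (rule isCont_o2[rotated]) (intro continuous_intros)
    then show ?case
      by (simp add: continuous_at_imp_continuous_on)
  next
    case (Suc m)
    show ?case
    proof (rule times_cont_diff_SucI)
      show "((\<lambda>x::'a. flat_exp p (x \<bullet> e + c)) has_derivative
          (\<lambda>v. flat_exp ([:0, 0, 1:] * (p - pderiv p)) (x \<bullet> e + c) * (v \<bullet> e))) (at x)" for x
        by (rule has_derivative_compose[OF _ flat_exp_DERIV[unfolded has_field_derivative_def]])
           (auto intro!: derivative_eq_intros)
      show "times_cont_diff m
          (\<lambda>x::'a. flat_exp ([:0, 0, 1:] * (p - pderiv p)) (x \<bullet> e + c) * (v \<bullet> e))" for v
        by (intro times_cont_diff_mult times_cont_diff_const Suc.IH)
    qed
  qed
  then show ?thesis
    by (simp add: smooth_def)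
qed

text \<open>Dilation by \<open>Suc m\<close> drives exp(-1/t) to 1 for positive t and leaves the
  value 0 elsewhere. The product of these cutoffs over all faces of the box therefore converges to
  its indicator, with the uniform bound that dominated convergence requires.\<close>

lemma smooth_approx_box:
  fixes a b :: "'a::euclidean_space"
  obtains \<phi> :: "nat \<Rightarrow> 'a \<Rightarrow> real" where
    "\<And>m. smooth (\<phi> m)" "\<And>m x. \<bar>\<phi> m x\<bar> \<le> 1" "\<And>m x. x \<notin> box a b \<Longrightarrow> \<phi> m x = 0"
    "\<And>x. (\<lambda>m. \<phi> m x) \<longlonglongrightarrow> indicator (box a b) x"
proof -
  define \<psi> where "\<psi> = flat_exp 1"
  have \<psi>: "0 \<le> \<psi> t" "\<psi> t \<le> 1" "t \<le> 0 \<Longrightarrow> \<psi> t = 0" for t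
    by (auto simp: \<psi>_def flat_exp_def)
  have lim: "(\<lambda>m. \<psi> (real (Suc m) * t)) \<longlonglongrightarrow> 1" if "t > 0" for t
  proof -
    have "(\<lambda>m. exp (- ((1 / t) * inverse (real (Suc m))))) \<longlonglongrightarrow> exp (- ((1 / t) * 0))"
      by (intro tendsto_intros LIMSEQ_inverse_real_of_nat)
    moreover have "(\<lambda>m. \<psi> (real (Suc m) * t)) = (\<lambda>m. exp (- ((1 / t) * inverse (real (Suc m)))))"
      using that by (intro ext) (simp add: \<psi>_def flat_exp_def field_simps add_pos_nonneg)
    ultimately show ?thesis
      by simp
  qed
  define \<phi> where "\<phi> = (\<lambda>m x. \<Prod>i\<in>Basis. \<psi> (real (Suc m) * ((x - a) \<bullet> i)) * \<psi> (real (Suc m) * ((b - x) \<bullet> i)))"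
  show thesis
  proof
    have "smooth (\<lambda>x. \<psi> (x \<bullet> (c *\<^sub>R i) + - c * (a \<bullet> i)) * \<psi> (x \<bullet> (- c *\<^sub>R i) + c * (b \<bullet> i)))" for c i
      unfolding \<psi>_def by (intro smooth_mult smooth_flat_exp_affine)
    moreover have "x \<bullet> (c *\<^sub>R i) + - c * (a \<bullet> i) = c * ((x - a) \<bullet> i)"
        "x \<bullet> (- c *\<^sub>R i) + c * (b \<bullet> i) = c * ((b - x) \<bullet> i)" for c x i
      by (auto simp: algebra_simps)
    ultimately have "smooth (\<lambda>x. \<psi> (c * ((x - a) \<bullet> i)) * \<psi> (c * ((b - x) \<bullet> i)))" for c i
      by simp
    then show "smooth (\<phi> m)" for m
      unfolding \<phi>_def by (intro smooth_prod)
    show "\<bar>\<phi> m x\<bar> \<le> 1" for m x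
      unfolding \<phi>_def abs_prod by (rule prod_le_1) (auto simp: \<psi> abs_mult intro!: mult_le_one)
    show "\<phi> m x = 0" if "x \<notin> box a b" for m x
    proof -
      obtain i where i: "i \<in> Basis" "(x - a) \<bullet> i \<le> 0 \<or> (b - x) \<bullet> i \<le> 0"
        using \<open>x \<notin> box a b\<close> by (auto simp: mem_box inner_diff_left not_less)
      then have "\<psi> (real (Suc m) * ((x - a) \<bullet> i)) * \<psi> (real (Suc m) * ((b - x) \<bullet> i)) = 0"
        using \<psi>(3)[of "real (Suc m) * ((x - a) \<bullet> i)"] \<psi>(3)[of "real (Suc m) * ((b - x) \<bullet> i)"]
        by (auto simp: mult_nonneg_nonpos)
      then show ?thesis
        unfolding \<phi>_def using i(1) by (intro prod_zero) auto
    qed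
    then have out: "x \<notin> box a b \<Longrightarrow> (\<lambda>m. \<phi> m x) \<longlonglongrightarrow> 0" for x
      by simp
    have "(\<lambda>m. \<phi> m x) \<longlonglongrightarrow> (\<Prod>i\<in>(Basis::'a set). 1 * 1)" if "x \<in> box a b" for x
      unfolding \<phi>_def
      by (intro tendsto_prod tendsto_mult lim) (use that in \<open>auto simp: mem_box inner_diff_left\<close>)
    with out show "(\<lambda>m. \<phi> m x) \<longlonglongrightarrow> indicator (box a b) x" for x
      by (cases "x \<in> box a b") auto
  qed
qed

section \<open>Integration by parts and the fundamental lemma\<close>

lemma borel_measurable_lebesgueI: "f \<in> borel_measurable borel \<Longrightarrow> f \<in> borel_measurable lebesgue"
  by (simp add: measurable_completion)

lemma continuous_imp_lebesgue_measurable: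
  fixes f :: "'a::euclidean_space \<Rightarrow> real"
  shows "continuous_on UNIV f \<Longrightarrow> f \<in> borel_measurable lebesgue"
  by (intro borel_measurable_lebesgueI borel_measurable_continuous_onI)

lemma integrable_continuous_compact_support:
  fixes f :: "'a::euclidean_space \<Rightarrow> real"
  assumes f: "continuous_on UNIV f" and S: "compact S" "\<And>x. x \<notin> S \<Longrightarrow> f x = 0"
  shows "integrable lebesgue f"
proof -
  have "(\<lambda>x. indicat_real S x *\<^sub>R f x) = f"
  proof
    show "indicat_real S x *\<^sub>R f x = f x" for x
      by (cases "x \<in> S") (simp_all add: S(2))
  qed
  then have "integrable lborel f"
    using borel_integrable_compact[OF S(1) continuous_on_subset[OF f]] by simp
  then show ?thesis
    using f by (simp add: integrable_completion borel_measurable_continuous_onI)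
qed

lemma bounded_continuous_compact_support:
  fixes f :: "'a::euclidean_space \<Rightarrow> real"
  assumes f: "continuous_on UNIV f" and S: "compact S" "\<And>x. x \<notin> S \<Longrightarrow> f x = 0"
  obtains M where "\<And>x. \<bar>f x\<bar> \<le> M"
proof -
  have "bounded (f ` S)"
    using S(1) f by (intro compact_imp_bounded compact_continuous_image) (auto intro: continuous_on_subset)
  then obtain M where "\<And>x. x \<in> S \<Longrightarrow> \<bar>f x\<bar> \<le> M"
    by (auto simp: bounded_iff)
  then have "\<bar>f x\<bar> \<le> max M 0" for x
    using S(2)[of x] by (cases "x \<in> S") (auto simp: le_max_iff_disj)
  then show thesis
    by (rule that)
qed

lemma frechet_derivative_eq_0_outside:
  assumes "closed S" "\<And>x. x \<notin> S \<Longrightarrow> f x = 0" "x \<notin> S"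
  shows "frechet_derivative f (at x) = (\<lambda>v. 0)"
proof -
  have "((\<lambda>x. 0) has_derivative (\<lambda>v. 0)) (at x)"
    by simp
  then have "(f has_derivative (\<lambda>v. 0)) (at x)"
    by (rule has_derivative_transform_within_open[where s = "- S"]) (use assms in auto)
  then show ?thesis
    by (rule frechet_derivative_eqI)
qed

lemma lebesgue_integral_translate:
  fixes f :: "'a::euclidean_space \<Rightarrow> real"
  assumes "f \<in> borel_measurable borel"
  shows "(LINT x|lebesgue. f (x + a)) = integral\<^sup>L lebesgue f"
proof -
  have "(LINT x|lborel. f (a + x)) = integral\<^sup>L (distr lborel borel ((+) a)) f"
    using assms by (simp add: integral_distr)
  moreover have "(\<lambda>x. f (a + x)) \<in> borel_measurable borel"
    using assms by measurable
  ultimately show ?thesis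
    using assms by (simp add: lborel_distr_plus integral_completion add.commute)
qed

text \<open>The integral of a difference quotient vanishes by translation invariance.\<close>
lemma integral_frechet_derivative_eq_0:
  fixes h :: "'a::euclidean_space \<Rightarrow> real"
  assumes h: "smooth h" and S: "compact S" "\<And>x. x \<notin> S \<Longrightarrow> h x = 0"
  shows "(LINT x|lebesgue. frechet_derivative h (at x) v) = 0"
proof -
  define D where "D = (\<lambda>x. frechet_derivative h (at x) v)"
  have D0: "x \<notin> S \<Longrightarrow> D x = 0" for x
    using frechet_derivative_eq_0_outside[OF compact_imp_closed[OF S(1)] S(2)] by (simp add: D_def)
  have Dcont: "continuous_on UNIV D"
    unfolding D_def by (intro smooth_continuous_on smooth_frechet_derivative h)
  obtain M where M: "\<And>x. \<bar>D x\<bar> \<le> M"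
    using bounded_continuous_compact_support[OF Dcont S(1) D0] by blast
  define t where "t = (\<lambda>n. 1 / real (Suc n))"
  have t: "0 < t n" "t n \<le> 1" for n
    by (auto simp: t_def)
  have t0: "t \<longlonglongrightarrow> 0"
    using LIMSEQ_inverse_real_of_nat by (simp add: t_def inverse_eq_divide)
  define q where "q = (\<lambda>n x. (h (x + t n *\<^sub>R v) - h x) / t n)"
  \<comment> \<open>The region swept by the support when it is shifted back by up to one step along
    \<open>v\<close>. It is compact and contains the supports of all difference quotients, as
    \<open>t n \<le> 1\<close>.\<close>
  define S' where "S' = (\<lambda>(x, s). x - s *\<^sub>R v) ` (S \<times> {0..1::real})"
  have S': "compact S'"
    unfolding S'_def using S(1)
    by (intro compact_continuous_image compact_Times) (auto simp: case_prod_unfold intro!: continuous_intros)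
  have hcont: "continuous_on UNIV h"
    by (rule smooth_continuous_on[OF h])
  have hint: "integrable lebesgue h"
    by (rule integrable_continuous_compact_support[OF hcont S])
  have hborel: "h \<in> borel_measurable borel"
    by (rule borel_measurable_continuous_onI[OF hcont])
  have q_int: "integral\<^sup>L lebesgue (q n) = 0" for n
  proof -
    have "integrable lebesgue (\<lambda>x. h (x + t n *\<^sub>R v))"
    proof (rule integrable_continuous_compact_support)
      show "continuous_on UNIV (\<lambda>x. h (x + t n *\<^sub>R v))"
        by (rule continuous_on_compose2[OF hcont]) (auto intro!: continuous_intros)
      show "compact S'" by (fact S')
      show "h (x + t n *\<^sub>R v) = 0" if "x \<notin> S'" for x
      proof (rule S(2), rule notI)
        assume "x + t n *\<^sub>R v \<in> S"
        then have "x \<in> S'"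
          using t[of n] by (auto simp: S'_def intro!: image_eqI[where x = "(x + t n *\<^sub>R v, t n)"])
        with that show False by simp
      qed
    qed
    then show ?thesis
      using hint lebesgue_integral_translate[OF hborel, of "t n *\<^sub>R v"] by (simp add: q_def)
  qed
  have bound: "\<bar>q n x\<bar> \<le> M * indicator S' x" for n x
  proof -
    \<comment> \<open>A difference quotient is a value of the derivative at an intermediate point,
      so \<open>M\<close> bounds it uniformly in \<open>n\<close>.\<close>
    have "\<exists>s. 0 < s \<and> s < t n \<and> h (x + t n *\<^sub>R v) - h (x + 0 *\<^sub>R v) = (t n - 0) * D (x + s *\<^sub>R v)"
      unfolding D_def by (rule MVT2[OF t(1)]) (intro smooth_DERIV_along_line h)
    then obtain s where s: "0 < s" "s < t n" "q n x = D (x + s *\<^sub>R v)"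
      using t(1)[of n] by (auto simp: q_def)
    have "D (x + s *\<^sub>R v) = 0" if "x \<notin> S'"
    proof (rule D0, rule notI)
      assume "x + s *\<^sub>R v \<in> S"
      then have "x \<in> S'"
        using t[of n] s by (auto simp: S'_def intro!: image_eqI[where x = "(x + s *\<^sub>R v, s)"])
      with that show False by simp
    qed
    then show ?thesis
      using s(3) M by (cases "x \<in> S'") auto
  qed
  have lim: "(\<lambda>n. q n x) \<longlonglongrightarrow> D x" for x
  proof -
    have "((\<lambda>s. h (x + s *\<^sub>R v)) has_real_derivative D x) (at 0)"
      using smooth_DERIV_along_line[OF h, of x v 0] by (simp add: D_def)
    then have "((\<lambda>s. (h (x + s *\<^sub>R v) - h x) / s) \<longlongrightarrow> D x) (at 0)"
      by (simp add: DERIV_def)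
    moreover have "filterlim t (at 0) sequentially"
      using t0 t(1) by (auto simp: filterlim_at less_imp_neq[symmetric] intro!: always_eventually)
    ultimately show ?thesis
      unfolding q_def by (rule filterlim_compose)
  qed
  have "(\<lambda>n. integral\<^sup>L lebesgue (q n)) \<longlonglongrightarrow> integral\<^sup>L lebesgue D"
  proof (rule integral_dominated_convergence[where w = "\<lambda>x. M * indicator S' x"])
    show "D \<in> borel_measurable lebesgue"
      by (rule continuous_imp_lebesgue_measurable[OF Dcont])
    have "continuous_on UNIV (q n)" for n
      unfolding q_def using t(1)[of n]
      by (auto intro!: continuous_intros continuous_on_compose2[OF hcont])
    then show "q n \<in> borel_measurable lebesgue" for n
      by (rule continuous_imp_lebesgue_measurable)
    have "S' \<in> lmeasurable"
      using S' by (rule lmeasurable_compact)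
    then show "integrable lebesgue (\<lambda>x. M * indicator S' x)"
      by (auto simp: fmeasurable_def intro!: integrable_mult_right integrable_real_indicator)
  qed (use bound lim in auto)
  then have "(\<lambda>n::nat. 0) \<longlonglongrightarrow> integral\<^sup>L lebesgue D"
    by (simp add: q_int)
  then show ?thesis
    by (simp add: LIMSEQ_const_iff D_def)
qed

text \<open>The product inherits compact support from \<open>f\<close>, so its derivative integrates
  to 0. In the application \<open>f\<close> is a coefficient of a test form while \<open>g\<close>
  is a test function on an arbitrary set.\<close>

lemma integral_by_parts_compact_support:
  fixes f g :: "'a::euclidean_space \<Rightarrow> real"
  assumes f: "smooth f" and g: "smooth g" and S: "compact S" "\<And>x. x \<notin> S \<Longrightarrow> f x = 0"
  shows "(LINT x|lebesgue. frechet_derivative f (at x) v * g x) =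
    - (LINT x|lebesgue. f x * frechet_derivative g (at x) v)"
proof -
  have "frechet_derivative (\<lambda>x. f x * g x) (at x) =
      (\<lambda>v. f x * frechet_derivative g (at x) v + frechet_derivative f (at x) v * g x)" for x
    by (intro frechet_derivative_eqI has_derivative_mult smooth_has_derivative f g)
  moreover have "(LINT x|lebesgue. frechet_derivative (\<lambda>x. f x * g x) (at x) v) = 0"
    by (rule integral_frechet_derivative_eq_0[OF smooth_mult[OF f g] S(1)]) (simp add: S(2))
  ultimately have "(LINT x|lebesgue. f x * frechet_derivative g (at x) v +
      frechet_derivative f (at x) v * g x) = 0"
    by simp
  moreover have "integrable lebesgue (\<lambda>x. f x * frechet_derivative g (at x) v)"
    by (intro integrable_continuous_compact_support[OF _ S(1)] continuous_on_mult
        smooth_continuous_on f smooth_frechet_derivative g) (simp add: S(2))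
  moreover have "integrable lebesgue (\<lambda>x. frechet_derivative f (at x) v * g x)"
    by (intro integrable_continuous_compact_support[OF _ S(1)] continuous_on_mult
        smooth_continuous_on g smooth_frechet_derivative f)
       (simp add: frechet_derivative_eq_0_outside[OF compact_imp_closed[OF S(1)] S(2)])
  ultimately show ?thesis
    by simp
qed

text \<open>Boxes form an intersection-stable generator of the Borel sets, and the sets over which
  \<open>g\<close> integrates to 0 form a Dynkin system; \<open>all\<close> accounts for
  complements.\<close>

lemma borel_AE_0_if_box_integrals_0:
  fixes g :: "'a::euclidean_space \<Rightarrow> real"
  assumes g: "integrable lborel g" and box: "\<And>a b. set_lebesgue_integral lborel (box a b) g = 0"
    and all: "integral\<^sup>L lborel g = 0"
  shows "AE x in lborel. g x = 0"
proof (rule sigma_finite_measure.density_zero[OF lborel.sigma_finite_measure_axioms g])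
  have gset: "set_integrable lborel A g" if "A \<in> sets lborel" for A
    using that g by (auto simp: set_integrable_def intro: integrable_mult_indicator[of A lborel g, simplified])
  fix A :: "'a set"
  assume "A \<in> sets lborel"
  have "Int_stable (range (\<lambda>(a::'a, b). box a b))"
    by (auto simp: Int_stable_def box_Int_box)
  moreover have "range (\<lambda>(a::'a, b). box a b) \<subseteq> Pow UNIV"
    by simp
  moreover from \<open>A \<in> sets lborel\<close> have "A \<in> sigma_sets UNIV (range (\<lambda>(a, b). box a b))"
    by (simp add: borel_eq_box)
  ultimately show "set_lebesgue_integral lborel A g = 0"
  proof (induction rule: sigma_sets_induct_disjoint[consumes 3, case_names basic empty compl union])
    case (compl A)
    then have "A \<in> sets lborel"
      by (simp add: borel_eq_box)
    then have "set_lebesgue_integral lborel (A \<union> (UNIV - A)) g =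
        set_lebesgue_integral lborel A g + set_lebesgue_integral lborel (UNIV - A) g"
      by (intro set_integral_Un gset) auto
    moreover have "A \<union> (UNIV - A) = UNIV"
      by auto
    ultimately show ?case
      using compl.IH all by (simp add: set_lebesgue_integral_def)
  next
    case (union A)
    then have "A i \<in> sets lborel" for i
      by (auto simp: borel_eq_box)
    then show ?case
      using union by (subst lebesgue_integral_countable_add) (auto intro!: gset simp: disjoint_family_on_def)
  next
    case (basic A)
    then show ?case
      using box by auto
  next
    case empty
    show ?case
      by (simp add: set_lebesgue_integral_def)
  qed
qed

lemma integrable_mult_of_square_integrable:
  fixes f g :: "'a::euclidean_space \<Rightarrow> real"
  assumes f: "f \<in> borel_measurable lebesgue" "integrable lebesgue (\<lambda>x. (f x)\<^sup>2)"
    and g: "g \<in> borel_measurable lebesgue" "integrable lebesgue (\<lambda>x. (g x)\<^sup>2)"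
  shows "integrable lebesgue (\<lambda>x. f x * g x)"
proof (rule Bochner_Integration.integrable_bound)
  show "integrable lebesgue (\<lambda>x. (f x)\<^sup>2 + (g x)\<^sup>2)"
    by (intro Bochner_Integration.integrable_add f g)
  have "\<bar>f x * g x\<bar> \<le> (f x)\<^sup>2 + (g x)\<^sup>2" for x
    using sum_squares_bound[of "\<bar>f x\<bar>" "\<bar>g x\<bar>"] mult_nonneg_nonneg[of "\<bar>f x\<bar>" "\<bar>g x\<bar>"]
    by (simp add: abs_mult del: mult_nonneg_nonneg)
  then show "AE x in lebesgue. norm (f x * g x) \<le> norm ((f x)\<^sup>2 + (g x)\<^sup>2)"
    by (auto intro!: AE_I2 order_trans[OF _ abs_ge_self])
qed (use f g in measurable)

text \<open>Bumps approximating the indicator of a box show that \<open>f\<close> integrates to 0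
  over every box whose closed version lies in \<open>S\<close>. Cutting \<open>f\<close> off to one
  such box reduces the claim to the Dynkin argument, and countably many closed boxes cover
  \<open>S\<close>.\<close>

lemma fundamental_lemma:
  fixes f :: "'a::euclidean_space \<Rightarrow> real"
  assumes S: "open S" and f: "f \<in> borel_measurable lebesgue" "integrable lebesgue (\<lambda>x. (f x)\<^sup>2)"
    and test: "\<And>\<phi>. test_function S \<phi> \<Longrightarrow> (LINT x|lebesgue. f x * \<phi> x) = 0"
  shows "AE x in lebesgue. x \<in> S \<longrightarrow> f x = 0"
proof -
  \<comment> \<open>The indicator of a box is square integrable, so the product with
    \<open>f\<close> is integrable; it also serves as the dominating function for
    \<open>box0\<close>.\<close>
  have ind: "integrable lebesgue (\<lambda>x. f x * indicator (box a b) x)" for a b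
  proof (rule integrable_mult_of_square_integrable[OF f])
    have ind: "integrable lebesgue (indicat_real (box a b))"
      using lmeasurable_box[of a b] by (intro integrable_real_indicator) (auto simp: fmeasurable_def)
    then show "indicat_real (box a b) \<in> borel_measurable lebesgue"
      by (rule borel_measurable_integrable)
    have "(\<lambda>x. (indicat_real (box a b) x)\<^sup>2) = indicat_real (box a b)"
      by (auto simp: indicator_def)
    with ind show "integrable lebesgue (\<lambda>x. (indicat_real (box a b) x)\<^sup>2)"
      by simp
  qed
  have box0: "(LINT x|lebesgue. f x * indicator (box a b) x) = 0" if ab: "cbox a b \<subseteq> S" for a b
  proof -
    obtain \<phi> :: "nat \<Rightarrow> 'a \<Rightarrow> real" where \<phi>: "\<And>m. smooth (\<phi> m)" "\<And>m x. \<bar>\<phi> m x\<bar> \<le> 1"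
        "\<And>m x. x \<notin> box a b \<Longrightarrow> \<phi> m x = 0" "\<And>x. (\<lambda>m. \<phi> m x) \<longlonglongrightarrow> indicator (box a b) x"
    proof -
      show thesis
        by (rule smooth_approx_box[of a b]) (rule that)
    qed
    have "closure {x. \<phi> m x \<noteq> 0} \<subseteq> cbox a b" for m
      using \<phi>(3)[of _ m] box_subset_cbox[of a b] by (intro closure_minimal closed_cbox) blast
    then have "closure {x. \<phi> m x \<noteq> 0} \<subseteq> S" "compact (closure {x. \<phi> m x \<noteq> 0})" for m
      using ab compact_Int_closed[OF compact_cbox[of a b] closed_closure[of "{x. \<phi> m x \<noteq> 0}"]]
      by (blast, metis Int_absorb1)
    then have "test_function S (\<phi> m)" for m
      using \<phi>(1) by (simp add: test_function_def)
    then have "(LINT x|lebesgue. f x * \<phi> m x) = 0" for m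
      by (rule test)
    moreover have "(\<lambda>m. LINT x|lebesgue. f x * \<phi> m x) \<longlonglongrightarrow> (LINT x|lebesgue. f x * indicator (box a b) x)"
    proof (rule integral_dominated_convergence[where w = "\<lambda>x. \<bar>f x * indicator (box a b) x\<bar>"])
      have "\<phi> m \<in> borel_measurable lebesgue" for m
        by (intro continuous_imp_lebesgue_measurable smooth_continuous_on \<phi>)
      then show "(\<lambda>x. f x * \<phi> m x) \<in> borel_measurable lebesgue" for m
        using f(1) by measurable
      show "AE x in lebesgue. (\<lambda>m. f x * \<phi> m x) \<longlonglongrightarrow> f x * indicator (box a b) x"
        by (intro AE_I2 tendsto_mult tendsto_const \<phi>)
      show "AE x in lebesgue. norm (f x * \<phi> m x) \<le> \<bar>f x * indicator (box a b) x\<bar>" for m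
        using \<phi>(2)[of m] \<phi>(3)[of _ m] by (intro AE_I2) (auto simp: indicator_def abs_mult mult_left_le)
    qed (use ind[of a b] in \<open>auto intro!: borel_measurable_integrable\<close>)
    ultimately show ?thesis
      by (simp add: LIMSEQ_const_iff)
  qed
  have on_box: "AE x in lebesgue. f x * indicator (box a b) x = 0" if ab: "cbox a b \<subseteq> S" for a b
  proof -
    \<comment> \<open>The Dynkin argument runs over Borel sets and \<open>lborel\<close>, so the
      Lebesgue measurable function is replaced by a Borel representative.\<close>
    obtain g where g: "g \<in> borel_measurable lborel" "AE x in lborel. f x * indicator (box a b) x = g x"
      using completion_ex_borel_measurable_real[OF borel_measurable_integrable[OF ind[of a b]]] by auto
    then have fg: "AE x in lebesgue. f x * indicator (box a b) x = g x"
      by (intro AE_completion)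
    have "integrable lebesgue g"
      by (rule integrable_cong_AE_imp[OF ind[of a b] _ fg]) (use g(1) in \<open>auto intro: borel_measurable_lebesgueI\<close>)
    then have gint: "integrable lborel g"
      using g(1) by (simp add: integrable_completion)
    have sub: "set_lebesgue_integral lborel (box c d) g = 0" for c d
    proof -
      \<comment> \<open>The corners of the intersection of the two boxes; its closed version still
        lies in \<open>S\<close>, so \<open>box0\<close> applies to it.\<close>
      define e where "e = (\<Sum>i\<in>Basis. max (a \<bullet> i) (c \<bullet> i) *\<^sub>R i)"
      define e' where "e' = (\<Sum>i\<in>Basis. min (b \<bullet> i) (d \<bullet> i) *\<^sub>R i)"
      have "cbox e e' \<subseteq> S"
        using ab Int_interval[of a b c d] by (auto simp: e_def e'_def)
      have "set_lebesgue_integral lborel (box c d) g = (LINT x|lebesgue. indicator (box c d) x * g x)"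
        using g(1) by (subst integral_completion) (auto simp: set_lebesgue_integral_def)
      also have "\<dots> = (LINT x|lebesgue. f x * indicator (box e e') x)"
      proof (rule lebesgue_integral_cong_AE)
        have "box e e' = box a b \<inter> box c d"
          by (simp add: e_def e'_def box_Int_box)
        then have *: "f x * indicator (box e e') x = indicator (box c d) x * (f x * indicator (box a b) x)" for x
          by (auto simp: indicator_def)
        from fg show "AE x in lebesgue. indicator (box c d) x * g x = f x * indicator (box e e') x"
          by eventually_elim (simp only: *)
      qed
      finally show ?thesis
        using box0[OF \<open>cbox e e' \<subseteq> S\<close>] by simp
    qed
    have "integral\<^sup>L lborel g = integral\<^sup>L lebesgue g"
      using g(1) by (simp add: integral_completion)
    also have "\<dots> = 0"
      using lebesgue_integral_cong_AE[OF fg] box0[OF ab] by simp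
    finally have "AE x in lborel. g x = 0"
      by (intro borel_AE_0_if_box_integrals_0 gint sub)
    then have "AE x in lebesgue. g x = 0"
      by (rule AE_completion)
    with fg show ?thesis
      by eventually_elim simp
  qed
  obtain \<D> where \<D>: "countable \<D>" "\<D> \<subseteq> Pow S" "\<And>X. X \<in> \<D> \<Longrightarrow> \<exists>a b. X = cbox a b" "\<Union>\<D> = S"
  proof -
    show thesis
      by (rule open_countable_Union_open_cbox[OF S]) (rule that)
  qed
  have "AE x in lebesgue. x \<in> X \<longrightarrow> f x = 0" if X: "X \<in> \<D>" for X
  proof -
    obtain a b where ab: "X = cbox a b" "cbox a b \<subseteq> S"
      using \<D>(2) \<D>(3)[OF X] X by auto
    \<comment> \<open>The cover uses closed boxes, the previous step open ones; they differ by the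
      faces, a null set.\<close>
    have "AE x in lebesgue. x \<notin> cbox a b - box a b"
      using negligible_frontier_interval[of a b] by (intro AE_not_in) (simp add: negligible_iff_null_sets)
    with on_box[OF ab(2)] show ?thesis
      by eventually_elim (auto simp: ab(1))
  qed
  then have "AE x in lebesgue. \<forall>X\<in>\<D>. x \<in> X \<longrightarrow> f x = 0"
    unfolding AE_ball_countable[OF \<D>(1)] by blast
  then show ?thesis
    by eventually_elim (use \<D>(4) in auto)
qed

section \<open>Alternating covectors and square integrable forms\<close>

text \<open>Expansion in a basis allows the entries of a list to be traded for basis vectors one at
  a time. This is the induction scheme for extending facts about multilinear maps from basis lists
  to all lists.\<close>

lemma list_basis_induct:
  fixes vs :: "'a::euclidean_space list"
  assumes base: "\<And>vs. set vs \<subseteq> Basis \<Longrightarrow> P vs"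
    and step: "\<And>vs i. i < length vs \<Longrightarrow> (\<And>b. b \<in> Basis \<Longrightarrow> P (vs[i := b])) \<Longrightarrow> P vs"
  shows "P vs"
proof -
  \<comment> \<open>\<open>k\<close> is the length of the initial segment whose entries may still be
    arbitrary; \<open>step\<close> at position \<open>k\<close> shortens it from
    \<open>Suc k\<close> to \<open>k\<close>.\<close>
  have "(\<forall>i<length vs. k \<le> i \<longrightarrow> vs ! i \<in> Basis) \<Longrightarrow> P vs" for k and vs :: "'a list"
  proof (induction k arbitrary: vs)
    case 0
    then show ?case
      by (intro base) (auto simp: in_set_conv_nth)
  next
    case (Suc k)
    show ?case
    proof (cases "k < length vs")
      case True
      then show ?thesis
      proof (rule step)
        fix b :: 'a
        assume "b \<in> Basis"
        then show "P (vs[k := b])"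
          using Suc.prems by (intro Suc.IH) (auto simp: nth_list_update)
      qed
    next
      case False
      then show ?thesis
        by (intro Suc.IH) auto
    qed
  qed
  from this[of vs "length vs"] show ?thesis
    by auto
qed

lemma alternating_length: "alternating j \<alpha> \<Longrightarrow> int (length vs) \<noteq> j \<Longrightarrow> \<alpha> vs = 0"
  by (simp add: alternating_def)

lemma alternating_not_distinct: "alternating j \<alpha> \<Longrightarrow> \<not> distinct vs \<Longrightarrow> \<alpha> vs = 0"
  by (simp add: alternating_def)

lemma alternating_linear:
  assumes "alternating j \<alpha>" "i < length vs"
  shows "linear (\<lambda>v. \<alpha> (vs[i := v]))"
proof (cases "int (length vs) = j")
  case False
  then have "(\<lambda>v. \<alpha> (vs[i := v])) = (\<lambda>v. 0)"
    using assms by (auto simp: alternating_def)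
  then show ?thesis
    by (simp add: linear_zero)
qed (use assms in \<open>auto simp: alternating_def\<close>)

lemma alternating_zero: "alternating j (\<lambda>vs. 0)"
  by (auto simp: alternating_def linear_zero)

lemma alternating_add: "alternating j \<alpha> \<Longrightarrow> alternating j \<beta> \<Longrightarrow> alternating j (\<lambda>vs. \<alpha> vs + \<beta> vs)"
  by (auto simp: alternating_def linear_compose_add)

lemma alternating_scale: "alternating j \<alpha> \<Longrightarrow> alternating j (\<lambda>vs. c * \<alpha> vs)"
  using linear_compose_scale_right[where c = c and ?'b = real, unfolded real_scaleR_def]
  by (fastforce simp: alternating_def)

lemma alternating_expand:
  fixes \<alpha> :: "'a::euclidean_space list \<Rightarrow> real"
  assumes "alternating j \<alpha>" "i < length vs"
  shows "\<alpha> vs = (\<Sum>b\<in>Basis. ((vs ! i) \<bullet> b) * \<alpha> (vs[i := b]))"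
proof -
  interpret linear "\<lambda>v. \<alpha> (vs[i := v])"
    by (rule alternating_linear[OF assms])
  have "\<alpha> vs = \<alpha> (vs[i := (\<Sum>b\<in>Basis. ((vs ! i) \<bullet> b) *\<^sub>R b)])"
    by (simp add: euclidean_representation)
  also have "\<dots> = (\<Sum>b\<in>Basis. ((vs ! i) \<bullet> b) * \<alpha> (vs[i := b]))"
    by (simp add: sum scale)
  finally show ?thesis .
qed

text \<open>By the pigeonhole principle such a list repeats a basis vector. Hence the sum in
  \<open>alt_inner\<close>, cut off at length \<open>DIM('a)\<close>, misses no coefficient on basis
  lists.\<close>

lemma alternating_long_basis_list:
  fixes \<alpha> :: "'a::euclidean_space list \<Rightarrow> real"
  assumes "alternating j \<alpha>" "set bs \<subseteq> Basis" "length bs > DIM('a)"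
  shows "\<alpha> bs = 0"
proof -
  have "card (set bs) \<le> DIM('a)"
    using assms(2) by (intro card_mono) auto
  then have "\<not> distinct bs"
    using assms(3) by (auto simp: distinct_card)
  then show ?thesis
    using assms(1) by (rule alternating_not_distinct[rotated])
qed

lemma alternating_eqI:
  fixes \<alpha> :: "'a::euclidean_space list \<Rightarrow> real"
  assumes "alternating j \<alpha>" "alternating j \<beta>"
    and eq: "\<And>bs. set bs \<subseteq> Basis \<Longrightarrow> length bs \<le> DIM('a) \<Longrightarrow> \<alpha> bs = \<beta> bs"
  shows "\<alpha> = \<beta>"
proof
  show "\<alpha> vs = \<beta> vs" for vs
  proof (induction vs rule: list_basis_induct)
    case (1 vs)
    then show ?case
      using eq alternating_long_basis_list[OF assms(1), of vs] alternating_long_basis_list[OF assms(2), of vs]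
      by (cases "length vs \<le> DIM('a)") auto
  next
    case (2 vs i)
    then show ?case
      using alternating_expand[OF assms(1) 2(1)] alternating_expand[OF assms(2) 2(1)] by simp
  qed
qed

text \<open>Polarisation: the value with two equal adjacent entries is 0, and this is expanded for
  the entry \<open>u + v\<close>.\<close>

lemma alternating_swap_adjacent:
  assumes \<alpha>: "alternating j \<alpha>"
  shows "\<alpha> (xs @ u # v # zs) = - \<alpha> (xs @ v # u # zs)"
proof -
  have L: "linear (\<lambda>a. \<alpha> (xs @ a # b # zs))" "linear (\<lambda>b. \<alpha> (xs @ a # b # zs))" for a b
    using alternating_linear[OF \<alpha>, of "length xs" "xs @ a # b # zs"]
      alternating_linear[OF \<alpha>, of "Suc (length xs)" "xs @ a # b # zs"]
    by (simp_all add: list_update_append)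
  have "\<alpha> (xs @ a # a # zs) = 0" for a
    by (rule alternating_not_distinct[OF \<alpha>]) auto
  from this[of u] this[of v] this[of "u + v"] show ?thesis
    by (simp add: linear_add[OF L(1)] linear_add[OF L(2)])
qed

lemma alternating_move:
  assumes \<alpha>: "alternating j \<alpha>"
  shows "\<alpha> (xs @ v # ys @ zs) = (-1) ^ length ys * \<alpha> (xs @ ys @ v # zs)"
proof (induction ys arbitrary: xs)
  case (Cons y ys)
  show ?case
    using alternating_swap_adjacent[OF \<alpha>, of xs v y "ys @ zs"] Cons.IH[of "xs @ [y]"] by simp
qed simp

section \<open>The pointwise inner product and square integrability\<close>

lemma finite_basis_lists: "finite {bs::'a::euclidean_space list. set bs \<subseteq> Basis \<and> length bs \<le> n}"
  by (rule finite_lists_length_le) simp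

lemma alt_inner_commute: "alt_inner \<alpha> \<beta> = alt_inner \<beta> \<alpha>"
  by (simp add: alt_inner_def mult.commute)

lemma alt_inner_nonneg: "0 \<le> alt_inner \<alpha> \<alpha>"
  unfolding alt_inner_def by (intro sum_nonneg) simp

lemma alt_inner_add_left: "alt_inner (\<lambda>vs. \<alpha> vs + \<beta> vs) \<gamma> = alt_inner \<alpha> \<gamma> + alt_inner \<beta> \<gamma>"
  by (simp add: alt_inner_def algebra_simps add_divide_distrib sum.distrib)

lemma alt_inner_scale_left: "alt_inner (\<lambda>vs. c * \<alpha> vs) \<gamma> = c * alt_inner \<alpha> \<gamma>"
  by (simp add: alt_inner_def sum_distrib_left mult.assoc)

lemma square_le_alt_inner:
  fixes \<alpha> :: "'a::euclidean_space list \<Rightarrow> real"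
  assumes "set bs \<subseteq> Basis" "length bs \<le> DIM('a)"
  shows "(\<alpha> bs)\<^sup>2 \<le> fact (length bs) * alt_inner \<alpha> \<alpha>"
proof -
  have "\<alpha> bs * \<alpha> bs / fact (length bs) \<le> alt_inner \<alpha> \<alpha>"
    unfolding alt_inner_def
    by (rule member_le_sum) (use assms finite_basis_lists in auto)
  then show ?thesis
    by (simp add: field_simps power2_eq_square)
qed

definition square_integrable :: "('a::euclidean_space \<Rightarrow> real) \<Rightarrow> bool" where
  "square_integrable f \<longleftrightarrow> f \<in> borel_measurable lebesgue \<and> integrable lebesgue (\<lambda>x. (f x)\<^sup>2)"

lemma square_integrable_mult:
  "square_integrable f \<Longrightarrow> square_integrable g \<Longrightarrow> integrable lebesgue (\<lambda>x. f x * g x)"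
  unfolding square_integrable_def by (intro integrable_mult_of_square_integrable) auto

lemma square_integrable_zero: "square_integrable (\<lambda>x. 0)"
  by (simp add: square_integrable_def)

lemma square_integrable_add:
  assumes "square_integrable f" "square_integrable g"
  shows "square_integrable (\<lambda>x. f x + g x)"
proof -
  have "integrable lebesgue (\<lambda>x. (f x)\<^sup>2 + (g x)\<^sup>2 + 2 * (f x * g x))"
    using assms square_integrable_mult[OF assms] by (auto simp: square_integrable_def)
  moreover have "(f x + g x)\<^sup>2 = (f x)\<^sup>2 + (g x)\<^sup>2 + 2 * (f x * g x)" for x
    by (simp add: power2_sum)
  ultimately show ?thesis
    using assms by (auto simp: square_integrable_def)
qed

lemma square_integrable_scale: "square_integrable f \<Longrightarrow> square_integrable (\<lambda>x. c * f x)"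
  by (auto simp: square_integrable_def power_mult_distrib)

lemma square_integrable_sum:
  "(\<And>i. i \<in> I \<Longrightarrow> square_integrable (f i)) \<Longrightarrow> square_integrable (\<lambda>x. \<Sum>i\<in>I. f i x)"
  by (induction I rule: infinite_finite_induct) (auto intro: square_integrable_add square_integrable_zero)

lemma square_integrable_continuous:
  assumes f: "continuous_on UNIV f" and S: "compact S" "\<And>x. x \<notin> S \<Longrightarrow> f x = 0"
  shows "square_integrable f"
  unfolding square_integrable_def
  by (intro conjI continuous_imp_lebesgue_measurable f
      integrable_continuous_compact_support[OF _ S(1)] continuous_intros) (simp add: S(2))

text \<open>Replaces integrability of the pointwise norm by square integrability of every
  coefficient, including those at lists that are not made of basis vectors. The two conditions agree
  by \<open>L2_forms_eq\<close>, and this one is inherited coefficient by coefficient by sums and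
  multiples.\<close>

definition L2_fun :: "int \<Rightarrow> 'a::euclidean_space set \<Rightarrow> ('a \<Rightarrow> 'a list \<Rightarrow> real) \<Rightarrow> bool" where
  "L2_fun j S f \<longleftrightarrow> (\<forall>x. alternating j (f x)) \<and> (\<forall>x. x \<notin> S \<longrightarrow> f x = (\<lambda>vs. 0)) \<and>
     (\<forall>vs. square_integrable (\<lambda>x. f x vs))"

lemma integrable_alt_inner:
  assumes "\<And>vs. square_integrable (\<lambda>x. f x vs)" "\<And>vs. square_integrable (\<lambda>x. g x vs)"
  shows "integrable lebesgue (\<lambda>x. alt_inner (f x) (g x))"
  unfolding alt_inner_def
  by (intro Bochner_Integration.integrable_sum integrable_divide square_integrable_mult assms)

text \<open>At a basis list the coefficient is dominated by the pointwise norm; at any other list it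
  is a finite linear combination of such coefficients.\<close>

lemma square_integrable_coefficients:
  fixes f :: "'a::euclidean_space \<Rightarrow> 'a list \<Rightarrow> real"
  assumes alt: "\<And>x. alternating j (f x)" and meas: "\<And>vs. (\<lambda>x. f x vs) \<in> borel_measurable lebesgue"
    and int: "integrable lebesgue (\<lambda>x. alt_inner (f x) (f x))"
  shows "square_integrable (\<lambda>x. f x vs)"
proof (induction vs rule: list_basis_induct)
  case (1 vs)
  show ?case
  proof (cases "length vs \<le> DIM('a)")
    case True
    have "integrable lebesgue (\<lambda>x. (f x vs)\<^sup>2)"
    proof (rule Bochner_Integration.integrable_bound)
      show "integrable lebesgue (\<lambda>x. fact (length vs) * alt_inner (f x) (f x))"
        using int by simp
      show "(\<lambda>x. (f x vs)\<^sup>2) \<in> borel_measurable lebesgue"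
        using meas by measurable
      show "AE x in lebesgue. norm ((f x vs)\<^sup>2) \<le> norm (fact (length vs) * alt_inner (f x) (f x))"
        using square_le_alt_inner[OF 1 True] by (simp add: abs_mult alt_inner_nonneg)
    qed
    then show ?thesis
      using meas by (simp add: square_integrable_def)
  next
    case False
    then show ?thesis
      using alternating_long_basis_list[OF alt 1] by (simp add: square_integrable_zero)
  qed
next
  case (2 vs i)
  have "(\<lambda>x. f x vs) = (\<lambda>x. \<Sum>b\<in>Basis. ((vs ! i) \<bullet> b) * f x (vs[i := b]))"
    by (intro ext alternating_expand[OF alt 2(1)])
  then show ?case
    using 2(2) by (auto intro!: square_integrable_sum square_integrable_scale)
qed

lemma L2_forms_eq: "L2_forms j S = {abs_dform f | f. L2_fun j S f}"
proof -
  have "L2_fun j S f \<longleftrightarrow> (\<forall>x. alternating j (f x)) \<and>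
     (\<forall>x. x \<notin> S \<longrightarrow> f x = (\<lambda>vs. 0)) \<and> (\<forall>vs. (\<lambda>x. f x vs) \<in> borel_measurable lebesgue) \<and>
     integrable lebesgue (\<lambda>x. alt_inner (f x) (f x))" for f :: "'a \<Rightarrow> 'a list \<Rightarrow> real"
    using integrable_alt_inner[of f f] square_integrable_coefficients[of j f]
    by (auto simp: L2_fun_def) (auto simp: square_integrable_def)
  then show ?thesis
    by (simp add: L2_forms_def)
qed

lemma L2_forms_cases:
  assumes "u \<in> L2_forms j S"
  obtains f where "u = abs_dform f" "L2_fun j S f"
  using assms by (auto simp: L2_forms_eq)

lemma L2_fun_add: "L2_fun j S f \<Longrightarrow> L2_fun j S g \<Longrightarrow> L2_fun j S (\<lambda>x vs. f x vs + g x vs)"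
  by (auto simp: L2_fun_def alternating_add square_integrable_add)

lemma L2_fun_scale: "L2_fun j S f \<Longrightarrow> L2_fun j S (\<lambda>x vs. c * f x vs)"
  by (auto simp: L2_fun_def alternating_scale square_integrable_scale)

lemma zero_L2_forms: "0 \<in> L2_forms j S"
  unfolding L2_forms_eq zero_dform_def
  by (auto simp: L2_fun_def alternating_zero square_integrable_zero intro!: exI[of _ "\<lambda>x vs. 0"])

lemma L2_forms_add: "u \<in> L2_forms j S \<Longrightarrow> v \<in> L2_forms j S \<Longrightarrow> u + v \<in> L2_forms j S"
  unfolding L2_forms_eq by (auto simp: plus_dform.abs_eq intro: L2_fun_add)

lemma L2_forms_scale: "u \<in> L2_forms j S \<Longrightarrow> c *\<^sub>R u \<in> L2_forms j S"
  unfolding L2_forms_eq by (auto simp: scaleR_dform.abs_eq intro: L2_fun_scale)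

lemma subspace_L2_forms: "real_vector.subspace (L2_forms j S)"
  by (intro real_vector.subspaceI zero_L2_forms L2_forms_add L2_forms_scale)

lemma L2_forms_mono: "S \<subseteq> S' \<Longrightarrow> L2_forms j S \<subseteq> L2_forms j S'"
  unfolding L2_forms_eq L2_fun_def by blast

lemma L2_forms_UNIV: "u \<in> L2_forms j S \<Longrightarrow> u \<in> L2_forms j UNIV"
  using L2_forms_mono[of S UNIV] by blast

lemma form_inner_commute: "form_inner u v = form_inner v u"
  by transfer (simp add: alt_inner_commute)

lemma form_inner_nonneg: "0 \<le> form_inner u u"
  by transfer (simp add: alt_inner_nonneg)

lemma form_inner_add_left:
  assumes "u \<in> L2_forms j UNIV" "v \<in> L2_forms j UNIV" "w \<in> L2_forms j UNIV"
  shows "form_inner (u + v) w = form_inner u w + form_inner v w"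
proof -
  obtain f g h where "u = abs_dform f" "L2_fun j UNIV f" "v = abs_dform g" "L2_fun j UNIV g"
      "w = abs_dform h" "L2_fun j UNIV h"
    using assms by (metis L2_forms_cases)
  then show ?thesis
    by (simp add: form_inner.abs_eq plus_dform.abs_eq alt_inner_add_left integrable_alt_inner L2_fun_def)
qed

lemma form_inner_scale_left: "form_inner (c *\<^sub>R u) w = c * form_inner u w"
  by transfer (simp add: alt_inner_scale_left)

text \<open>The pointwise inner product sees basis lists only; an alternating representative is
  determined by its values there, which makes the inner product definite on L2 forms.\<close>

lemma form_inner_eq_0_imp:
  assumes u: "u \<in> L2_forms j UNIV" and 0: "form_inner u u = 0"
  shows "u = 0"
proof -
  obtain f where f: "u = abs_dform f" "L2_fun j UNIV f"
    using L2_forms_cases[OF u] .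
  have "integrable lebesgue (\<lambda>x. alt_inner (f x) (f x))"
    using f(2) by (auto simp: L2_fun_def intro: integrable_alt_inner)
  moreover have "(LINT x|lebesgue. alt_inner (f x) (f x)) = 0"
    using 0 f(1) by (simp add: form_inner.abs_eq)
  ultimately have "AE x in lebesgue. alt_inner (f x) (f x) = 0"
    by (subst (asm) integral_nonneg_eq_0_iff_AE) (auto simp: alt_inner_nonneg)
  then have "AE x in lebesgue. f x = (\<lambda>vs. 0)"
  proof eventually_elim
    case (elim x)
    show ?case
    proof (rule alternating_eqI[OF _ alternating_zero])
      show "alternating j (f x)"
        using f(2) by (simp add: L2_fun_def)
      show "f x bs = 0" if "set bs \<subseteq> Basis" "length bs \<le> DIM('a)" for bs
        using square_le_alt_inner[OF that, of "f x"] elim by simp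
    qed
  qed
  then show ?thesis
    by (simp add: f(1) zero_dform_def dform.abs_eq_iff)
qed

text \<open>The pairing of a coefficient with a function, lifted to classes, so that weak
  derivatives can be handled without choosing representatives.\<close>

lift_definition coeff_integral :: "'a::euclidean_space dform \<Rightarrow> 'a list \<Rightarrow> ('a \<Rightarrow> real) \<Rightarrow> real" is
  "\<lambda>f vs \<psi>. LINT x|lebesgue. f x vs * \<psi> x"
  by (auto intro!: ext lebesgue_integral_cong_AE elim!: AE_mp)

lemma coeff_integral_add:
  assumes "u \<in> L2_forms j UNIV" "v \<in> L2_forms j UNIV" "square_integrable \<psi>"
  shows "coeff_integral (u + v) vs \<psi> = coeff_integral u vs \<psi> + coeff_integral v vs \<psi>"
proof -
  obtain f g where "u = abs_dform f" "L2_fun j UNIV f" "v = abs_dform g" "L2_fun j UNIV g"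
    using assms by (metis L2_forms_cases)
  then show ?thesis
    using assms(3)
    by (simp add: coeff_integral.abs_eq plus_dform.abs_eq square_integrable_mult L2_fun_def distrib_right)
qed

lemma coeff_integral_scale: "coeff_integral (c *\<^sub>R u) vs \<psi> = c * coeff_integral u vs \<psi>"
  by transfer (simp add: mult.assoc)

lemma coeff_integral_expand:
  assumes u: "u \<in> L2_forms j UNIV" and \<psi>: "square_integrable \<psi>" and i: "i < length vs"
  shows "coeff_integral u vs \<psi> = (\<Sum>b\<in>Basis. ((vs ! i) \<bullet> b) * coeff_integral u (vs[i := b]) \<psi>)"
proof -
  obtain f where f: "u = abs_dform f" "L2_fun j UNIV f"
    using L2_forms_cases[OF u] .
  have "f x vs * \<psi> x = (\<Sum>b\<in>Basis. ((vs ! i) \<bullet> b) * (f x (vs[i := b]) * \<psi> x))" for x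
    using alternating_expand[OF _ i, of j "f x"] f(2) by (simp add: L2_fun_def sum_distrib_right mult.assoc)
  then show ?thesis
    using f \<psi> by (simp add: coeff_integral.abs_eq L2_fun_def square_integrable_mult)
qed

text \<open>Stated in this form, with \<open>\<epsilon>\<close> in place of the norm of \<open>u\<close>, the bound needs only the
  inequality between arithmetic and geometric means.\<close>
lemma coeff_integral_bound:
  fixes \<psi> :: "'a::euclidean_space \<Rightarrow> real"
  assumes \<psi>: "square_integrable \<psi>"
  shows "\<exists>C. \<forall>\<epsilon>>0. \<forall>u\<in>L2_forms j UNIV. form_inner u u \<le> \<epsilon>\<^sup>2 \<longrightarrow> \<bar>coeff_integral u vs \<psi>\<bar> \<le> C * \<epsilon>"
proof (induction vs rule: list_basis_induct)
  case (1 vs)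
  \<comment> \<open>The product of coefficient and \<open>\<psi>\<close> is at most
    \<open>f\<^sup>2 / \<epsilon> + \<epsilon> * \<psi>\<^sup>2\<close>; the two summands of
    \<open>C\<close> bound the integrals of these two terms, each divided by
    \<open>\<epsilon>\<close>.\<close>
  define C where "C = fact (length vs) + (LINT x|lebesgue. (\<psi> x)\<^sup>2)"
  have "\<bar>coeff_integral u vs \<psi>\<bar> \<le> C * \<epsilon>"
    if \<epsilon>: "\<epsilon> > 0" and u: "u \<in> L2_forms j UNIV" and le: "form_inner u u \<le> \<epsilon>\<^sup>2" for \<epsilon> :: real and u
  proof -
    obtain f where f: "u = abs_dform f" "L2_fun j UNIV f"
      using L2_forms_cases[OF u] .
    have sq: "square_integrable (\<lambda>x. f x vs)"
      using f(2) by (simp add: L2_fun_def)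
    have "(LINT x|lebesgue. (f x vs)\<^sup>2) \<le> fact (length vs) * \<epsilon>\<^sup>2"
    proof (cases "length vs \<le> DIM('a)")
      case True
      have "(LINT x|lebesgue. (f x vs)\<^sup>2) \<le> (LINT x|lebesgue. fact (length vs) * alt_inner (f x) (f x))"
        using sq f(2) by (intro integral_mono square_le_alt_inner 1 True)
          (auto simp: square_integrable_def L2_fun_def intro: integrable_alt_inner)
      also have "\<dots> \<le> fact (length vs) * \<epsilon>\<^sup>2"
        using le f(1) by (simp add: form_inner.abs_eq)
      finally show ?thesis .
    next
      case False
      then have "f x vs = 0" for x
        using alternating_long_basis_list[OF _ 1, of j "f x"] f(2) by (simp add: L2_fun_def)
      then show ?thesis
        by simp
    qed
    then have "(LINT x|lebesgue. (f x vs)\<^sup>2) / \<epsilon> \<le> fact (length vs) * \<epsilon>"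
      using \<epsilon> by (simp add: divide_le_eq power2_eq_square mult.assoc)
    moreover have "\<bar>coeff_integral u vs \<psi>\<bar> \<le> (LINT x|lebesgue. (f x vs)\<^sup>2 / \<epsilon> + \<epsilon> * (\<psi> x)\<^sup>2)"
    proof -
      have "\<bar>f x vs * \<psi> x\<bar> \<le> (f x vs)\<^sup>2 / \<epsilon> + \<epsilon> * (\<psi> x)\<^sup>2" for x
      proof -
        have "0 \<le> (\<bar>f x vs\<bar> - \<epsilon> * \<bar>\<psi> x\<bar>)\<^sup>2"
          by simp
        then have "2 * (\<epsilon> * \<bar>f x vs * \<psi> x\<bar>) \<le> (f x vs)\<^sup>2 + \<epsilon>\<^sup>2 * (\<psi> x)\<^sup>2"
          by (simp add: power2_diff power_mult_distrib abs_mult algebra_simps)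
        then have "\<epsilon> * \<bar>f x vs * \<psi> x\<bar> \<le> (f x vs)\<^sup>2 + \<epsilon>\<^sup>2 * (\<psi> x)\<^sup>2"
          using \<epsilon> mult_nonneg_nonneg[of \<epsilon> "\<bar>f x vs * \<psi> x\<bar>"] by linarith
        then show ?thesis
          using \<epsilon> by (simp add: field_simps power2_eq_square)
      qed
      then show ?thesis
        unfolding f(1) coeff_integral.abs_eq
        by (intro order_trans[OF integral_abs_bound] integral_mono integrable_abs square_integrable_mult sq \<psi>)
           (use sq \<psi> in \<open>auto simp: square_integrable_def\<close>)
    qed
    moreover have "(LINT x|lebesgue. (f x vs)\<^sup>2 / \<epsilon> + \<epsilon> * (\<psi> x)\<^sup>2) =
        (LINT x|lebesgue. (f x vs)\<^sup>2) / \<epsilon> + \<epsilon> * (LINT x|lebesgue. (\<psi> x)\<^sup>2)"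
      using sq \<psi> by (simp add: square_integrable_def)
    ultimately show ?thesis
      by (simp add: C_def algebra_simps)
  qed
  then show ?case
    by blast
next
  case (2 vs i)
  then have "\<forall>b\<in>Basis. \<exists>C. \<forall>\<epsilon>>0. \<forall>u\<in>L2_forms j UNIV. form_inner u u \<le> \<epsilon>\<^sup>2 \<longrightarrow>
      \<bar>coeff_integral u (vs[i := b]) \<psi>\<bar> \<le> C * \<epsilon>"
    by blast
  then obtain C where C: "\<And>b \<epsilon> u. b \<in> Basis \<Longrightarrow> \<epsilon> > 0 \<Longrightarrow> u \<in> L2_forms j UNIV \<Longrightarrow>
      form_inner u u \<le> \<epsilon>\<^sup>2 \<Longrightarrow> \<bar>coeff_integral u (vs[i := b]) \<psi>\<bar> \<le> C b * \<epsilon>"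
    by metis
  have "\<bar>coeff_integral u vs \<psi>\<bar> \<le> (\<Sum>b\<in>Basis. \<bar>(vs ! i) \<bullet> b\<bar> * C b) * \<epsilon>"
    if "\<epsilon> > 0" "u \<in> L2_forms j UNIV" "form_inner u u \<le> \<epsilon>\<^sup>2" for \<epsilon> u
  proof -
    have "\<bar>coeff_integral u vs \<psi>\<bar> \<le> (\<Sum>b\<in>Basis. \<bar>((vs ! i) \<bullet> b) * coeff_integral u (vs[i := b]) \<psi>\<bar>)"
      unfolding coeff_integral_expand[OF that(2) \<psi> 2(1)] by (rule sum_abs)
    also have "\<dots> \<le> (\<Sum>b\<in>Basis. \<bar>(vs ! i) \<bullet> b\<bar> * (C b * \<epsilon>))"
      unfolding abs_mult by (intro sum_mono mult_left_mono C that) auto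
    finally show ?thesis
      by (simp add: sum_distrib_right mult.assoc)
  qed
  then show ?case
    by blast
qed

section \<open>Weak exterior derivatives\<close>

abbreviation del_nth :: "nat \<Rightarrow> 'a list \<Rightarrow> 'a list" where
  "del_nth i vs \<equiv> take i vs @ drop (Suc i) vs"

lemma nth_del_nth: "i < length vs \<Longrightarrow> l < length vs - 1 \<Longrightarrow> del_nth i vs ! l = vs ! (if l < i then l else Suc l)"
  by (auto simp: nth_append min_def)

text \<open>The simplicial identity of face maps: once the earlier entry \<open>l\<close> is gone,
  the entry \<open>i\<close> sits one place further left.\<close>

lemma del_nth_del_nth:
  assumes "l < i" "i < length vs"
  shows "del_nth l (del_nth i vs) = del_nth (i - 1) (del_nth l vs)"
proof (rule nth_equalityI)
  fix k
  assume "k < length (del_nth l (del_nth i vs))"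
  then have k: "k < length vs - 2"
    using assms by simp
  have "del_nth l (del_nth i vs) ! k = vs ! (if k < l then k else if Suc k < i then Suc k else Suc (Suc k))"
    using assms k by (subst nth_del_nth; simp add: nth_del_nth del: nth_append)
  moreover have "del_nth (i - 1) (del_nth l vs) ! k = vs ! (if k < l then k else if Suc k < i then Suc k else Suc (Suc k))"
    using assms k by (subst nth_del_nth; auto simp: nth_del_nth)
  ultimately show "del_nth l (del_nth i vs) ! k = del_nth (i - 1) (del_nth l vs) ! k"
    by simp
qed (use assms in simp)

lemma del_nth_update_same: "i < length vs \<Longrightarrow> del_nth i (vs[i := v]) = del_nth i vs"
  by (simp add: take_update_cancel drop_update_cancel)

lemma del_nth_update_other:
  assumes "i < length vs" "m < length vs" "i \<noteq> m"
  shows "del_nth i (vs[m := v]) = (del_nth i vs)[if m < i then m else m - 1 := v]"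
  using assms by (intro nth_equalityI) (auto simp: nth_append nth_list_update min_def)

lemma weak_ext_deriv_iff:
  "weak_ext_deriv S u w \<longleftrightarrow> (\<forall>\<phi> vs. test_function S \<phi> \<longrightarrow> coeff_integral w vs \<phi> =
     - (\<Sum>i<length vs. (-1) ^ i *
         coeff_integral u (del_nth i vs) (\<lambda>x. frechet_derivative \<phi> (at x) (vs ! i))))"
  by transfer simp

lemma coeff_integral_zero [simp]: "coeff_integral 0 vs \<psi> = 0"
  by transfer simp

lemma coeff_integral_diff:
  assumes "u \<in> L2_forms j UNIV" "v \<in> L2_forms j UNIV" "square_integrable \<psi>"
  shows "coeff_integral (u - v) vs \<psi> = coeff_integral u vs \<psi> - coeff_integral v vs \<psi>"
  using coeff_integral_add[OF assms(1) L2_forms_scale[OF assms(2), of "-1"] assms(3), of vs]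
  by (simp add: coeff_integral_scale[of "-1", simplified])

lemma test_function_smooth: "test_function S \<phi> \<Longrightarrow> smooth \<phi>"
  by (simp add: test_function_def)

lemma test_function_square_integrable: "test_function S \<phi> \<Longrightarrow> square_integrable \<phi>"
  using closure_subset[of "{x. \<phi> x \<noteq> 0}"]
  by (intro square_integrable_continuous[of _ "closure {x. \<phi> x \<noteq> 0}"])
     (auto simp: test_function_def intro: smooth_continuous_on)

lemma frechet_derivative_support:
  "closure {x. frechet_derivative f (at x) v \<noteq> 0} \<subseteq> closure {x. f x \<noteq> 0}"
proof (rule closure_minimal)
  show "{x. frechet_derivative f (at x) v \<noteq> 0} \<subseteq> closure {x. f x \<noteq> 0}"
  proof (rule subsetI, rule ccontr)
    fix x
    assume x: "x \<in> {x. frechet_derivative f (at x) v \<noteq> 0}" "x \<notin> closure {x. f x \<noteq> 0}"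
    have "f y = 0" if "y \<notin> closure {x. f x \<noteq> 0}" for y
      using that closure_subset[of "{x. f x \<noteq> 0}"] by auto
    then have "frechet_derivative f (at x) = (\<lambda>v. 0)"
      using x(2) by (rule frechet_derivative_eq_0_outside[OF closed_closure])
    with x(1) show False
      by simp
  qed
qed simp

lemma test_function_frechet_derivative:
  assumes "test_function S \<phi>"
  shows "test_function S (\<lambda>x. frechet_derivative \<phi> (at x) v)"
  unfolding test_function_def
proof (intro conjI)
  let ?C = "closure {x. frechet_derivative \<phi> (at x) v \<noteq> 0}"
  show "smooth (\<lambda>x. frechet_derivative \<phi> (at x) v)"
    using assms by (intro smooth_frechet_derivative test_function_smooth)
  have "?C = closure {x. \<phi> x \<noteq> 0} \<inter> ?C"
    using frechet_derivative_support[of \<phi> v] by auto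
  moreover have "compact (closure {x. \<phi> x \<noteq> 0} \<inter> ?C)"
    using assms by (intro compact_Int_closed) (auto simp: test_function_def)
  ultimately show "compact ?C"
    by simp
  show "?C \<subseteq> S"
    using assms frechet_derivative_support[of \<phi> v] by (auto simp: test_function_def)
qed

lemma weak_ext_deriv_zero: "weak_ext_deriv S 0 0"
  by (simp add: weak_ext_deriv_iff)

lemma weak_ext_deriv_scale: "weak_ext_deriv S u w \<Longrightarrow> weak_ext_deriv S (c *\<^sub>R u) (c *\<^sub>R w)"
  by (simp add: weak_ext_deriv_iff coeff_integral_scale sum_distrib_left mult.left_commute)

text \<open>A function that is not integrable has integral 0 by convention, so additivity of the
  pairings needs integrability. The L2 hypotheses provide it, together with square integrability of
  test functions and their derivatives.\<close>

lemma weak_ext_deriv_add: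
  assumes "u \<in> L2_forms j UNIV" "w \<in> L2_forms i UNIV" "weak_ext_deriv S u w"
    and "u' \<in> L2_forms j UNIV" "w' \<in> L2_forms i UNIV" "weak_ext_deriv S u' w'"
  shows "weak_ext_deriv S (u + u') (w + w')"
proof -
  have "coeff_integral (w + w') vs \<phi> = coeff_integral w vs \<phi> + coeff_integral w' vs \<phi>"
    and "coeff_integral (u + u') vs' (\<lambda>x. frechet_derivative \<phi> (at x) v) =
      coeff_integral u vs' (\<lambda>x. frechet_derivative \<phi> (at x) v) +
      coeff_integral u' vs' (\<lambda>x. frechet_derivative \<phi> (at x) v)"
    if "test_function S \<phi>" for \<phi> vs vs' v
    using test_function_square_integrable[OF that]
      test_function_square_integrable[OF test_function_frechet_derivative[OF that]]
    by (simp_all add: coeff_integral_add[OF assms(2,5)] coeff_integral_add[OF assms(1,4)])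
  then show ?thesis
    using assms(3,6) by (simp add: weak_ext_deriv_iff distrib_left sum.distrib)
qed

text \<open>The fundamental lemma is applied to each coefficient at a basis list. There are finitely
  many of them, so the exceptional sets unite to a null set; off \<open>S\<close> the representative
  is 0 at every point.\<close>

lemma weak_ext_deriv_zero_unique:
  fixes S :: "'a::euclidean_space set"
  assumes S: "open S" and w: "w \<in> L2_forms j S" and weak: "weak_ext_deriv S 0 w"
  shows "w = 0"
proof -
  obtain f where f: "w = abs_dform f" "L2_fun j S f"
    using L2_forms_cases[OF w] .
  have "AE x in lebesgue. x \<in> S \<longrightarrow> f x bs = 0" for bs
  proof (rule fundamental_lemma[OF S])
    show "(LINT x|lebesgue. f x bs * \<phi> x) = 0" if "test_function S \<phi>" for \<phi>
    proof -
      have "coeff_integral w bs \<phi> = 0"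
        using weak that by (simp add: weak_ext_deriv_iff)
      then show ?thesis
        by (simp add: f(1) coeff_integral.abs_eq)
    qed
  qed (use f(2) in \<open>auto simp: L2_fun_def square_integrable_def\<close>)
  then have "AE x in lebesgue. \<forall>bs\<in>{bs. set bs \<subseteq> Basis \<and> length bs \<le> DIM('a)}. x \<in> S \<longrightarrow> f x bs = 0"
    by (intro AE_finite_allI finite_basis_lists) auto
  then have "AE x in lebesgue. f x = (\<lambda>vs. 0)"
  proof eventually_elim
    case (elim x)
    show ?case
    proof (cases "x \<in> S")
      case True
      then show ?thesis
        using f(2) elim by (intro alternating_eqI[OF _ alternating_zero]) (auto simp: L2_fun_def)
    next
      case False
      then show ?thesis
        using f(2) by (simp add: L2_fun_def)
    qed
  qed
  then show ?thesis
    by (simp add: f(1) zero_dform_def dform.abs_eq_iff)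
qed

lemma weak_ext_deriv_unique:
  assumes S: "open S" and w: "w \<in> L2_forms j S" "w' \<in> L2_forms j S"
    and u: "u \<in> L2_forms i UNIV"
    and weak: "weak_ext_deriv S u w" "weak_ext_deriv S u w'"
  shows "w = w'"
proof -
  have "weak_ext_deriv S (u + (-1) *\<^sub>R u) (w + (-1) *\<^sub>R w')"
    by (rule weak_ext_deriv_add[OF u L2_forms_UNIV[OF w(1)] weak(1) L2_forms_scale[OF u]
          L2_forms_scale[OF L2_forms_UNIV[OF w(2)]] weak_ext_deriv_scale[OF weak(2)]])
  then have "w + (-1) *\<^sub>R w' = 0"
    using weak_ext_deriv_zero_unique[OF S L2_forms_add[OF w(1) L2_forms_scale[OF w(2), of "-1"]]] by simp
  then show ?thesis
    by simp
qed

text \<open>Uniqueness turns the definite description into an equation: values of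
  \<open>ext_d\<close> are computed by exhibiting a weak derivative.\<close>

lemma ext_d_eqI:
  assumes "open S" "u \<in> L2_forms j S" "w \<in> L2_forms (j + 1) S" "weak_ext_deriv S u w"
  shows "ext_d j S u = w"
  unfolding ext_d_def
proof (rule the_equality)
  show "w' = w" if "w' \<in> L2_forms (j + 1) S \<and> weak_ext_deriv S u w'" for w'
    using that assms(4)
    by (intro weak_ext_deriv_unique[OF assms(1) _ assms(3) L2_forms_UNIV[OF assms(2)]]) auto
qed (use assms in simp)

section \<open>The spaces \<open>H_forms\<close> and linearity of the exterior derivative\<close>

lemma H_formsI:
  assumes "u \<in> L2_forms j S" "w \<in> L2_forms (j + 1) S" "weak_ext_deriv S u w"
  shows "u \<in> H_forms j S"
  using assms by (auto simp: H_forms_def)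

lemma H_forms_L2: "u \<in> H_forms j S \<Longrightarrow> u \<in> L2_forms j S"
  by (simp add: H_forms_def)

lemma ext_d_H_forms:
  assumes "open S" "u \<in> H_forms j S"
  shows "ext_d j S u \<in> L2_forms (j + 1) S" "weak_ext_deriv S u (ext_d j S u)"
  using assms by (auto simp: H_forms_def ext_d_eqI)

lemma
  assumes S: "open S" and u: "u \<in> H_forms j S" and v: "v \<in> H_forms j S"
  shows H_forms_add: "u + v \<in> H_forms j S"
    and ext_d_add: "ext_d j S (u + v) = ext_d j S u + ext_d j S v"
proof -
  note u' = ext_d_H_forms[OF S u] H_forms_L2[OF u] and v' = ext_d_H_forms[OF S v] H_forms_L2[OF v]
  have weak: "weak_ext_deriv S (u + v) (ext_d j S u + ext_d j S v)"
    by (rule weak_ext_deriv_add[OF L2_forms_UNIV[OF u'(3)] L2_forms_UNIV[OF u'(1)] u'(2)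
          L2_forms_UNIV[OF v'(3)] L2_forms_UNIV[OF v'(1)] v'(2)])
  show "u + v \<in> H_forms j S"
    by (rule H_formsI[OF _ _ weak]) (intro L2_forms_add u' v')+
  show "ext_d j S (u + v) = ext_d j S u + ext_d j S v"
    by (rule ext_d_eqI[OF S _ _ weak]) (intro L2_forms_add u' v')+
qed

lemma
  assumes S: "open S" and u: "u \<in> H_forms j S"
  shows H_forms_scale: "c *\<^sub>R u \<in> H_forms j S"
    and ext_d_scale: "ext_d j S (c *\<^sub>R u) = c *\<^sub>R ext_d j S u"
proof -
  note u' = ext_d_H_forms[OF S u] H_forms_L2[OF u]
  have weak: "weak_ext_deriv S (c *\<^sub>R u) (c *\<^sub>R ext_d j S u)"
    by (intro weak_ext_deriv_scale u')
  show "c *\<^sub>R u \<in> H_forms j S"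
    by (rule H_formsI[OF _ _ weak]) (intro L2_forms_scale u')+
  show "ext_d j S (c *\<^sub>R u) = c *\<^sub>R ext_d j S u"
    by (rule ext_d_eqI[OF S _ _ weak]) (intro L2_forms_scale u')+
qed

lemma subspace_H_forms: "open S \<Longrightarrow> real_vector.subspace (H_forms j S)"
  by (intro real_vector.subspaceI H_forms_add H_forms_scale)
     (auto intro: H_formsI[OF zero_L2_forms zero_L2_forms weak_ext_deriv_zero])

lemma ext_d_zero: "open S \<Longrightarrow> ext_d j S 0 = 0"
  by (intro ext_d_eqI zero_L2_forms weak_ext_deriv_zero)

lemma ext_d_diff:
  assumes "open S" "u \<in> H_forms j S" "v \<in> H_forms j S"
  shows "ext_d j S (u - v) = ext_d j S u - ext_d j S v"
  using ext_d_add[OF assms(1,2) H_forms_scale[OF assms(1,3), of "-1"]] ext_d_scale[OF assms(1,3), of "-1"]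
  by simp

text \<open>The pairs with \<open>l < i\<close> are matched with all the others by sending
  \<open>(i, l)\<close> to \<open>(l, i - 1)\<close>. This keeps the value of \<open>F\<close> and
  changes the parity of \<open>i + l\<close>, so the terms cancel.\<close>

lemma alternating_double_sum:
  fixes F :: "nat \<Rightarrow> nat \<Rightarrow> real"
  assumes F: "\<And>i l. l < i \<Longrightarrow> i < n \<Longrightarrow> F i l = F l (i - 1)"
  shows "(\<Sum>i<n. \<Sum>l<n - 1. (-1) ^ (i + l) * F i l) = 0"
proof -
  define G where "G = (\<lambda>(i, l). (-1) ^ (i + l) * F i l)"
  define A where "A = {(i, l). l < i \<and> i < n}"
  define B where "B = {(i, l). i \<le> l \<and> l < n - 1}"
  have "A \<subseteq> {..<n} \<times> {..<n}" "B \<subseteq> {..<n} \<times> {..<n}"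
    by (auto simp: A_def B_def)
  then have fin: "finite A" "finite B"
    by (simp_all add: finite_subset)
  have "(\<Sum>i<n. \<Sum>l<n - 1. (-1) ^ (i + l) * F i l) = sum G ({..<n} \<times> {..<n - 1})"
    by (simp add: sum.cartesian_product G_def)
  also have "{..<n} \<times> {..<n - 1} = A \<union> B"
    by (auto simp: A_def B_def)
  also have "sum G (A \<union> B) = sum G A + sum G B"
    using fin by (intro sum.union_disjoint) (auto simp: A_def B_def)
  also have "sum G B = (\<Sum>p\<in>A. - G p)"
  proof (rule sum.reindex_bij_witness[where i = "\<lambda>(i, l). (l, i - 1)" and j = "\<lambda>(i, l). (Suc l, i)"])
    fix p
    assume "p \<in> B"
    then obtain i l where p: "p = (i, l)" "i \<le> l" "l < n - 1"
      by (auto simp: B_def)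
    then show "- G (case p of (i, l) \<Rightarrow> (Suc l, i)) = G p"
      using F[of i "Suc l"] by (simp add: G_def add.commute)
  qed (auto simp: A_def B_def)
  finally show ?thesis
    by (simp add: sum_negf)
qed

text \<open>Both derivatives fall on the test function, whose second derivatives are symmetric. With
  the simplicial identity for the deleted entries the double sum cancels.\<close>

lemma weak_ext_deriv_twice:
  assumes weak: "weak_ext_deriv S u w"
  shows "weak_ext_deriv S w 0"
  unfolding weak_ext_deriv_iff
proof (intro allI impI)
  fix \<phi> and vs :: "'a list"
  assume \<phi>: "test_function S \<phi>"
  define n where "n = length vs"
  define D where "D = (\<lambda>v x. frechet_derivative \<phi> (at x) v)"
  define F where "F = (\<lambda>i l. coeff_integral u (del_nth l (del_nth i vs))
      (\<lambda>x. frechet_derivative (D (vs ! i)) (at x) (del_nth i vs ! l)))"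
  have "(-1) ^ i * coeff_integral w (del_nth i vs) (D (vs ! i)) = - (\<Sum>l<n - 1. (-1) ^ (i + l) * F i l)"
    if "i < n" for i
  proof -
    \<comment> \<open>A directional derivative of a test function is a test function, so the weak
      formula for \<open>w\<close> may be tested with it.\<close>
    have "test_function S (D (vs ! i))"
      unfolding D_def by (rule test_function_frechet_derivative[OF \<phi>])
    then have "coeff_integral w (del_nth i vs) (D (vs ! i)) =
        - (\<Sum>l<length (del_nth i vs). (-1) ^ l * F i l)"
      using weak[unfolded weak_ext_deriv_iff, rule_format] by (simp only: F_def)
    moreover have "length (del_nth i vs) = n - 1"
      using that by (simp add: n_def)
    ultimately show ?thesis
      by (simp add: sum_distrib_left power_add mult.assoc)
  qed
  then have "(\<Sum>i<n. (-1) ^ i * coeff_integral w (del_nth i vs) (D (vs ! i))) =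
      - (\<Sum>i<n. \<Sum>l<n - 1. (-1) ^ (i + l) * F i l)"
    by (simp add: sum_negf)
  also have "(\<Sum>i<n. \<Sum>l<n - 1. (-1) ^ (i + l) * F i l) = 0"
  proof (rule alternating_double_sum)
    fix i l
    assume il: "l < i" "i < n"
    \<comment> \<open>Deleting \<open>i\<close> does not move the earlier position \<open>l\<close>,
      whereas deleting \<open>l\<close> moves \<open>vs ! i\<close> to position
      \<open>i - 1\<close>. Both orders thus differentiate in the directions \<open>vs ! i\<close>
      and \<open>vs ! l\<close>.\<close>
    then have "del_nth i vs ! l = vs ! l" "del_nth l vs ! (i - 1) = vs ! i"
      by (auto simp: nth_del_nth n_def)
    then show "F i l = F l (i - 1)"
      using il del_nth_del_nth[of l i vs] frechet_derivative_commute[OF test_function_smooth[OF \<phi>]]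
      by (simp add: F_def D_def n_def)
  qed
  finally show "coeff_integral 0 vs \<phi> = - (\<Sum>i<length vs. (-1) ^ i *
      coeff_integral w (del_nth i vs) (\<lambda>x. frechet_derivative \<phi> (at x) (vs ! i)))"
    by (simp add: n_def D_def)
qed

text \<open>For a fixed test function and list, both sides of the weak formula are continuous in the
  L2 norm by \<open>coeff_integral_bound\<close>.\<close>

lemma weak_ext_deriv_limit:
  assumes u: "u \<in> L2_forms j UNIV" and w: "w \<in> L2_forms i UNIV"
    and lim: "\<And>\<epsilon>::real. \<epsilon> > 0 \<Longrightarrow> \<exists>u'\<in>L2_forms j UNIV. \<exists>w'\<in>L2_forms i UNIV. weak_ext_deriv S u' w' \<and>
      form_inner (u - u') (u - u') \<le> \<epsilon>\<^sup>2 \<and> form_inner (w - w') (w - w') \<le> \<epsilon>\<^sup>2"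
  shows "weak_ext_deriv S u w"
  unfolding weak_ext_deriv_iff
proof (intro allI impI)
  fix \<phi> and vs :: "'a list"
  assume \<phi>: "test_function S \<phi>"
  define D where "D = (\<lambda>i x. frechet_derivative \<phi> (at x) (vs ! i))"
  have sq: "square_integrable \<phi>" "\<And>i. square_integrable (D i)"
    unfolding D_def
    using test_function_square_integrable[OF \<phi>]
      test_function_square_integrable[OF test_function_frechet_derivative[OF \<phi>]] by auto
  obtain C where C: "\<And>\<epsilon> u. \<epsilon> > 0 \<Longrightarrow> u \<in> L2_forms i UNIV \<Longrightarrow> form_inner u u \<le> \<epsilon>\<^sup>2 \<Longrightarrow>
      \<bar>coeff_integral u vs \<phi>\<bar> \<le> C * \<epsilon>"
    using coeff_integral_bound[OF sq(1), of i vs] by blast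
  have "\<forall>i. \<exists>C. \<forall>\<epsilon>>0. \<forall>u\<in>L2_forms j UNIV. form_inner u u \<le> \<epsilon>\<^sup>2 \<longrightarrow>
      \<bar>coeff_integral u (del_nth i vs) (D i)\<bar> \<le> C * \<epsilon>"
    by (intro allI coeff_integral_bound sq)
  from choice[OF this] obtain C' where "\<forall>i. \<forall>\<epsilon>>0. \<forall>u\<in>L2_forms j UNIV. form_inner u u \<le> \<epsilon>\<^sup>2 \<longrightarrow>
      \<bar>coeff_integral u (del_nth i vs) (D i)\<bar> \<le> C' i * \<epsilon>" ..
  then have C': "\<And>i \<epsilon> u. \<epsilon> > 0 \<Longrightarrow> u \<in> L2_forms j UNIV \<Longrightarrow> form_inner u u \<le> \<epsilon>\<^sup>2 \<Longrightarrow>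
      \<bar>coeff_integral u (del_nth i vs) (D i)\<bar> \<le> C' i * \<epsilon>"
    by simp
  \<comment> \<open>The defect of \<open>(u, w)\<close> in the weak formula: linear in the pair, and
    zero for the approximating pairs.\<close>
  define \<Delta> where "\<Delta> = (\<lambda>u w. coeff_integral w vs \<phi> +
      (\<Sum>i<length vs. (-1) ^ i * coeff_integral u (del_nth i vs) (D i)))"
  define M where "M = C + (\<Sum>i<length vs. C' i)"
  have bound: "\<bar>\<Delta> u w\<bar> \<le> M * \<epsilon>" if \<epsilon>: "\<epsilon> > 0" for \<epsilon>
  proof -
    obtain u' w' where u': "u' \<in> L2_forms j UNIV" "w' \<in> L2_forms i UNIV" "weak_ext_deriv S u' w'"
        "form_inner (u - u') (u - u') \<le> \<epsilon>\<^sup>2" "form_inner (w - w') (w - w') \<le> \<epsilon>\<^sup>2"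
      using lim[OF \<epsilon>] by blast
    have mem: "u - u' \<in> L2_forms j UNIV" "w - w' \<in> L2_forms i UNIV"
      using u w u' subspace_L2_forms by (auto intro: real_vector.subspace_diff)
    have "\<Delta> u' w' = 0"
      using u'(3) \<phi> by (simp add: weak_ext_deriv_iff \<Delta>_def D_def)
    moreover have "\<Delta> u w - \<Delta> u' w' = \<Delta> (u - u') (w - w')"
      using u w u'(1,2) sq
      by (simp add: \<Delta>_def coeff_integral_diff[where j = j] coeff_integral_diff[where j = i] right_diff_distrib sum_subtractf)
    moreover have "\<bar>\<Delta> (u - u') (w - w')\<bar> \<le> C * \<epsilon> + (\<Sum>i<length vs. C' i * \<epsilon>)"
      unfolding \<Delta>_def
      by (intro order_trans[OF abs_triangle_ineq] add_mono order_trans[OF sum_abs] sum_mono)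
         (use C[OF \<epsilon> mem(2) u'(5)] C'[OF \<epsilon> mem(1) u'(4)] in \<open>auto simp: abs_mult\<close>)
    ultimately show ?thesis
      by (simp add: M_def algebra_simps sum_distrib_left)
  qed
  have "\<Delta> u w = 0"
  proof (rule ccontr)
    assume "\<Delta> u w \<noteq> 0"
    \<comment> \<open>Chosen so that the bound \<open>M * \<epsilon>\<close> is at most half the
      defect; \<open>\<bar>M\<bar> + 1\<close> keeps the denominator positive whatever the sign of
      \<open>M\<close>.\<close>
    define \<epsilon> where "\<epsilon> = \<bar>\<Delta> u w\<bar> / (2 * (\<bar>M\<bar> + 1))"
    have "\<epsilon> > 0"
      using \<open>\<Delta> u w \<noteq> 0\<close> by (simp add: \<epsilon>_def)
    have "M * \<epsilon> \<le> (\<bar>M\<bar> + 1) * \<epsilon>"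
      using \<open>\<epsilon> > 0\<close> by (intro mult_right_mono) auto
    also have "\<dots> = \<bar>\<Delta> u w\<bar> / 2"
      by (simp add: \<epsilon>_def field_simps)
    finally show False
      using bound[OF \<open>\<epsilon> > 0\<close>] \<open>\<Delta> u w \<noteq> 0\<close> by simp
  qed
  then show "coeff_integral w vs \<phi> = - (\<Sum>i<length vs. (-1) ^ i *
      coeff_integral u (del_nth i vs) (\<lambda>x. frechet_derivative \<phi> (at x) (vs ! i)))"
    by (simp add: \<Delta>_def D_def)
qed

section \<open>Test forms and vanishing traces\<close>

definition classical_d :: "('a::euclidean_space \<Rightarrow> 'a list \<Rightarrow> real) \<Rightarrow> 'a \<Rightarrow> 'a list \<Rightarrow> real" where
  "classical_d f x vs =
     (\<Sum>i<length vs. (-1) ^ i * frechet_derivative (\<lambda>y. f y (del_nth i vs)) (at x) (vs ! i))"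

lemma linear_frechet_derivative_smooth: "smooth f \<Longrightarrow> linear (frechet_derivative f (at x))"
  by (rule has_derivative_linear[OF smooth_has_derivative])

text \<open>The argument \<open>v\<close> occurs once in each summand: for \<open>i = m\<close> as
  the direction of differentiation, otherwise among the arguments of the form, whose linearity
  passes through the derivative.\<close>

lemma classical_d_linear:
  assumes alt: "\<And>x. alternating j (f x)" and sm: "\<And>vs. smooth (\<lambda>x. f x vs)" and m: "m < length vs"
  shows "linear (\<lambda>v. classical_d f x (vs[m := v]))"
proof -
  have "linear (\<lambda>v. (-1) ^ i * frechet_derivative (\<lambda>y. f y (del_nth i (vs[m := v]))) (at x) (vs[m := v] ! i))"
    if i: "i < length vs" for i
  proof (cases "i = m")
    case True
    then show ?thesis
      using m linear_compose_scale_right[OF linear_frechet_derivative_smooth[OF sm], of "(-1) ^ m"]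
      by (simp add: del_nth_update_same del: append_take_drop_id)
  next
    case False
    define ws where "ws = del_nth i vs"
    \<comment> \<open>The position of entry \<open>m\<close> after entry \<open>i\<close> has been
      deleted.\<close>
    define m' where "m' = (if m < i then m else m - 1)"
    have upd: "del_nth i (vs[m := v]) = ws[m' := v]" for v
      using del_nth_update_other[OF i m False] by (simp add: ws_def m'_def)
    have "m' < length ws"
      using i m False by (auto simp: ws_def m'_def)
    then have lin: "linear (\<lambda>v. f y (ws[m' := v]))" for y
      by (intro alternating_linear[OF alt])
    have "linear (\<lambda>v. frechet_derivative (\<lambda>y. f y (ws[m' := v])) (at x) (vs ! i))"
    proof (rule linearI)
      fix v w :: 'a and c :: real
      have "frechet_derivative (\<lambda>y. f y (ws[m' := v]) + f y (ws[m' := w])) (at x) =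
          (\<lambda>u. frechet_derivative (\<lambda>y. f y (ws[m' := v])) (at x) u + frechet_derivative (\<lambda>y. f y (ws[m' := w])) (at x) u)"
        by (intro frechet_derivative_eqI has_derivative_add smooth_has_derivative sm)
      then show "frechet_derivative (\<lambda>y. f y (ws[m' := v + w])) (at x) (vs ! i) =
          frechet_derivative (\<lambda>y. f y (ws[m' := v])) (at x) (vs ! i) + frechet_derivative (\<lambda>y. f y (ws[m' := w])) (at x) (vs ! i)"
        by (simp add: linear_add[OF lin])
      have "frechet_derivative (\<lambda>y. c *\<^sub>R f y (ws[m' := v])) (at x) =
          (\<lambda>u. c *\<^sub>R frechet_derivative (\<lambda>y. f y (ws[m' := v])) (at x) u)"
        by (intro frechet_derivative_eqI has_derivative_scaleR_right smooth_has_derivative sm)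
      then show "frechet_derivative (\<lambda>y. f y (ws[m' := c *\<^sub>R v])) (at x) (vs ! i) =
          c *\<^sub>R frechet_derivative (\<lambda>y. f y (ws[m' := v])) (at x) (vs ! i)"
        by (simp add: linear_cmul[OF lin])
    qed
    then have "linear (\<lambda>v. (-1) ^ i *\<^sub>R frechet_derivative (\<lambda>y. f y (ws[m' := v])) (at x) (vs ! i))"
      by (rule linear_compose_scale_right)
    then show ?thesis
      using False by (simp add: upd del: append_take_drop_id)
  qed
  then show ?thesis
    unfolding classical_d_def length_list_update by (intro linear_compose_sum) auto
qed

text \<open>If any entry other than the two equal ones is deleted, a repetition remains and the
  summand vanishes. The two summands left over differ by moving \<open>v\<close> past
  \<open>ys\<close>, and the signs of their positions make them cancel.\<close>

lemma classical_d_not_distinct: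
  assumes alt: "\<And>x. alternating j (f x)" and sm: "\<And>vs. smooth (\<lambda>x. f x vs)" and vs: "\<not> distinct vs"
  shows "classical_d f x vs = 0"
proof -
  obtain xs v ys zs where dec: "vs = xs @ [v] @ ys @ [v] @ zs"
    using not_distinct_decomp[OF vs] by blast
  define a where "a = length xs"
  define b where "b = Suc (length xs + length ys)"
  have ab: "a < b" "b < length vs" "vs ! a = v" "vs ! b = v"
    by (auto simp: a_def b_def dec nth_append)
  have del: "del_nth a vs = xs @ ys @ v # zs" "del_nth b vs = xs @ v # ys @ zs"
    by (auto simp: a_def b_def dec)
  define D where "D = (\<lambda>i. frechet_derivative (\<lambda>y. f y (del_nth i vs)) (at x) (vs ! i))"
  have 0: "D i = 0" if i: "i < length vs" "i \<noteq> a" "i \<noteq> b" for i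
  proof -
    \<comment> \<open>The positions of the two equal entries after the deletion of entry
      \<open>i\<close>.\<close>
    define a' where "a' = (if a < i then a else a - 1)"
    define b' where "b' = (if b < i then b else b - 1)"
    have ne: "a' \<noteq> b'" and lt: "a' < length vs - 1" "b' < length vs - 1"
      using ab(1,2) i by (auto simp: a'_def b'_def)
    have "(if a' < i then a' else Suc a') = a" "(if b' < i then b' else Suc b') = b"
      using ab(1) i by (auto simp: a'_def b'_def)
    then have "del_nth i vs ! a' = v" "del_nth i vs ! b' = v"
      using ab(3,4) nth_del_nth[OF i(1) lt(1)] nth_del_nth[OF i(1) lt(2)] by simp_all
    moreover have "length (del_nth i vs) = length vs - 1"
      using i by simp
    ultimately have "\<not> distinct (del_nth i vs)"
      using nth_eq_iff_index_eq[of "del_nth i vs" a' b'] lt ne by auto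
    then have "(\<lambda>y. f y (del_nth i vs)) = (\<lambda>y. 0)"
      using alternating_not_distinct[OF alt] by blast
    then show ?thesis
      by (simp add: D_def frechet_derivative_const del: append_take_drop_id)
  qed
  have "f y (del_nth b vs) = (-1) ^ length ys * f y (del_nth a vs)" for y
    unfolding del by (rule alternating_move[OF alt])
  moreover have "frechet_derivative (\<lambda>y. (-1) ^ length ys *\<^sub>R f y (del_nth a vs)) (at x) =
      (\<lambda>u. (-1) ^ length ys *\<^sub>R frechet_derivative (\<lambda>y. f y (del_nth a vs)) (at x) u)"
    by (intro frechet_derivative_eqI has_derivative_scaleR_right smooth_has_derivative sm)
  ultimately have "D b = (-1) ^ length ys * D a"
    by (simp add: D_def ab del: append_take_drop_id)
  \<comment> \<open>The positions differ by \<open>length ys + 1\<close>: moving \<open>v\<close>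
    accounts for \<open>length ys\<close> signs, and the one left over produces the
    cancellation.\<close>
  moreover have "(-1::real) ^ b = - ((-1) ^ a * (-1) ^ length ys)"
    by (simp add: a_def b_def power_add)
  ultimately have "(-1) ^ b * D b = - ((-1) ^ a * ((-1) ^ length ys * (-1) ^ length ys) * D a)"
    by (simp only: mult.assoc mult_minus_left)
  moreover have "(-1::real) ^ length ys * (-1) ^ length ys = 1"
    by (simp flip: power_mult_distrib)
  ultimately have "(-1) ^ b * D b = - ((-1) ^ a * D a)"
    by simp
  moreover have "classical_d f x vs = (\<Sum>i<length vs. (-1) ^ i * D i)"
    by (simp add: classical_d_def D_def del: append_take_drop_id)
  moreover have "(\<Sum>i<length vs. (-1) ^ i * D i) = (\<Sum>i\<in>{a, b}. (-1) ^ i * D i)"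
    using ab 0 by (intro sum.mono_neutral_right) auto
  ultimately show ?thesis
    using ab(1) by simp
qed

lemma alternating_classical_d:
  assumes alt: "\<And>x. alternating j (f x)" and sm: "\<And>vs. smooth (\<lambda>x. f x vs)"
  shows "alternating (j + 1) (classical_d f x)"
  unfolding alternating_def
proof (intro conjI allI impI)
  fix vs :: "'a list"
  assume "int (length vs) \<noteq> j + 1"
  then have "(\<lambda>y. f y (del_nth i vs)) = (\<lambda>y. 0)" if "i < length vs" for i
    using alternating_length[OF alt, of "del_nth i vs"] that by (auto simp: fun_eq_iff)
  then show "classical_d f x vs = 0"
    by (simp add: classical_d_def frechet_derivative_const del: append_take_drop_id)
qed (use classical_d_linear[OF alt sm] classical_d_not_distinct[OF alt sm] in auto)

lemma smooth_classical_d: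
  assumes "\<And>vs. smooth (\<lambda>x. f x vs)"
  shows "smooth (\<lambda>x. classical_d f x vs)"
  unfolding classical_d_def by (intro smooth_sum smooth_mult smooth_const smooth_frechet_derivative assms)

lemma classical_d_eq_0_outside:
  assumes "closed S" "\<And>x. x \<notin> S \<Longrightarrow> f x = (\<lambda>vs. 0)" "x \<notin> S"
  shows "classical_d f x = (\<lambda>vs. 0)"
proof -
  have "frechet_derivative (\<lambda>y. f y ws) (at x) = (\<lambda>v. 0)" for ws
    by (rule frechet_derivative_eq_0_outside[OF assms(1) _ assms(3)]) (simp add: assms(2))
  then show ?thesis
    by (simp add: classical_d_def fun_eq_iff)
qed

section \<open>Test forms and their derivatives\<close>

lemma test_formsI:
  assumes "\<And>x. alternating j (f x)" "\<And>vs. smooth (\<lambda>x. f x vs)"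
    and C: "compact C" "C \<subseteq> S" "\<And>x. x \<notin> C \<Longrightarrow> f x = (\<lambda>vs. 0)"
  shows "abs_dform f \<in> test_forms j S"
proof -
  have "closure {x. f x \<noteq> (\<lambda>vs. 0)} \<subseteq> C"
    using C by (intro closure_minimal compact_imp_closed) auto
  moreover from this have "compact (closure {x. f x \<noteq> (\<lambda>vs. 0)})"
    using compact_Int_closed[OF C(1) closed_closure[of "{x. f x \<noteq> (\<lambda>vs. 0)}"]] by (simp add: Int_absorb1)
  ultimately show ?thesis
    unfolding test_forms_def using assms by blast
qed

lemma test_formsE:
  assumes "\<phi> \<in> test_forms j S"
  obtains f C where "\<phi> = abs_dform f" "\<forall>x. alternating j (f x)" "\<forall>vs. smooth (\<lambda>x. f x vs)"
    "compact C" "C \<subseteq> S" "\<forall>x. x \<notin> C \<longrightarrow> f x = (\<lambda>vs. 0)"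
proof -
  obtain f where f: "\<phi> = abs_dform f" "\<forall>x. alternating j (f x)" "\<forall>vs. smooth (\<lambda>x. f x vs)"
      "compact (closure {x. f x \<noteq> (\<lambda>vs. 0)})" "closure {x. f x \<noteq> (\<lambda>vs. 0)} \<subseteq> S"
    using assms by (auto simp: test_forms_def)
  moreover have "\<forall>x. x \<notin> closure {x. f x \<noteq> (\<lambda>vs. 0)} \<longrightarrow> f x = (\<lambda>vs. 0)"
    using closure_subset[of "{x. f x \<noteq> (\<lambda>vs. 0)}"] by auto
  ultimately show thesis
    by (rule that)
qed

lemma test_forms_L2: "\<phi> \<in> test_forms j S \<Longrightarrow> \<phi> \<in> L2_forms j S"
proof (erule test_formsE)
  fix f C
  assume f: "\<phi> = abs_dform f" "\<forall>x. alternating j (f x)" "\<forall>vs. smooth (\<lambda>x. f x vs)"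
    "compact C" "C \<subseteq> S" "\<forall>x. x \<notin> C \<longrightarrow> f x = (\<lambda>vs. 0)"
  then have "square_integrable (\<lambda>x. f x vs)" for vs
    by (intro square_integrable_continuous[OF _ f(4)] smooth_continuous_on) auto
  then have "L2_fun j S f"
    using f by (auto simp: L2_fun_def)
  then show "\<phi> \<in> L2_forms j S"
    using f(1) by (auto simp: L2_forms_eq)
qed

lemma test_forms_add:
  assumes "\<phi> \<in> test_forms j S" "\<psi> \<in> test_forms j S"
  shows "\<phi> + \<psi> \<in> test_forms j S"
proof -
  obtain f C where f: "\<phi> = abs_dform f" "\<forall>x. alternating j (f x)" "\<forall>vs. smooth (\<lambda>x. f x vs)"
      "compact C" "C \<subseteq> S" "\<forall>x. x \<notin> C \<longrightarrow> f x = (\<lambda>vs. 0)"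
    using test_formsE[OF assms(1)] .
  obtain g D where g: "\<psi> = abs_dform g" "\<forall>x. alternating j (g x)" "\<forall>vs. smooth (\<lambda>x. g x vs)"
      "compact D" "D \<subseteq> S" "\<forall>x. x \<notin> D \<longrightarrow> g x = (\<lambda>vs. 0)"
    using test_formsE[OF assms(2)] .
  have "abs_dform (\<lambda>x vs. f x vs + g x vs) \<in> test_forms j S"
    using f g by (intro test_formsI[of _ _ "C \<union> D"] alternating_add smooth_add compact_Un) auto
  then show ?thesis
    by (simp add: f(1) g(1) plus_dform.abs_eq)
qed

lemma test_forms_scale:
  assumes "\<phi> \<in> test_forms j S"
  shows "c *\<^sub>R \<phi> \<in> test_forms j S"
proof -
  obtain f C where f: "\<phi> = abs_dform f" "\<forall>x. alternating j (f x)" "\<forall>vs. smooth (\<lambda>x. f x vs)"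
      "compact C" "C \<subseteq> S" "\<forall>x. x \<notin> C \<longrightarrow> f x = (\<lambda>vs. 0)"
    using test_formsE[OF assms(1)] .
  have "abs_dform (\<lambda>x vs. c * f x vs) \<in> test_forms j S"
    using f by (intro test_formsI[of _ _ C] alternating_scale smooth_mult smooth_const) auto
  then show ?thesis
    by (simp add: f(1) scaleR_dform.abs_eq)
qed

lemma zero_test_forms: "0 \<in> test_forms j S"
  unfolding zero_dform_def by (intro test_formsI[of _ _ "{}"] alternating_zero smooth_const) auto

text \<open>The classical derivative works for all \<open>S'\<close> at once: compact support of the
  form itself removes the boundary terms, whatever the test function does. This is the source of
  extension by zero.\<close>

lemma test_forms_weak_ext_deriv:
  assumes "\<phi> \<in> test_forms j S"
  obtains \<psi> where "\<psi> \<in> test_forms (j + 1) S" "\<And>S'. weak_ext_deriv S' \<phi> \<psi>"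
proof -
  obtain f C where f: "\<phi> = abs_dform f" "\<forall>x. alternating j (f x)" "\<forall>vs. smooth (\<lambda>x. f x vs)"
      and C: "compact C" "C \<subseteq> S" "\<forall>x. x \<notin> C \<longrightarrow> f x = (\<lambda>vs. 0)"
    using test_formsE[OF assms] .
  have f': "\<And>x. alternating j (f x)" "\<And>vs. smooth (\<lambda>x. f x vs)" "\<And>x. x \<notin> C \<Longrightarrow> f x = (\<lambda>vs. 0)"
    using f C by auto
  note clC = compact_imp_closed[OF C(1)]
  have test: "abs_dform (classical_d f) \<in> test_forms (j + 1) S"
    by (intro test_formsI[OF _ _ C(1,2)] alternating_classical_d smooth_classical_d f' classical_d_eq_0_outside[OF clC])
  have "weak_ext_deriv S' \<phi> (abs_dform (classical_d f))" for S'
    unfolding weak_ext_deriv_iff f(1) coeff_integral.abs_eq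
  proof (intro allI impI)
    fix \<theta> and vs :: "'a list"
    assume \<theta>: "test_function S' \<theta>"
    have sm: "smooth \<theta>"
      using \<theta> by (rule test_function_smooth)
    let ?D = "\<lambda>i x. frechet_derivative (\<lambda>y. f y (del_nth i vs)) (at x) (vs ! i)"
    have zero: "x \<notin> C \<Longrightarrow> ?D i x = 0" for i x
      using frechet_derivative_eq_0_outside[OF clC, of "\<lambda>y. f y (del_nth i vs)"] f'(3) by simp
    have "integrable lebesgue (\<lambda>x. ?D i x * \<theta> x)" for i
      by (intro integrable_continuous_compact_support[OF _ C(1)] smooth_continuous_on smooth_mult
          smooth_frechet_derivative f' sm) (simp add: zero del: append_take_drop_id)
    then have "(LINT x|lebesgue. classical_d f x vs * \<theta> x) =
        (\<Sum>i<length vs. (-1) ^ i * (LINT x|lebesgue. ?D i x * \<theta> x))"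
      by (simp add: classical_d_def sum_distrib_right mult.assoc del: append_take_drop_id)
    also have "\<dots> = (\<Sum>i<length vs. (-1) ^ i *
        - (LINT x|lebesgue. f x (del_nth i vs) * frechet_derivative \<theta> (at x) (vs ! i)))"
      using f'(3) by (intro sum.cong refl arg_cong2[where f = "(*)"]
          integral_by_parts_compact_support[OF f'(2) sm C(1)]) simp
    finally show "(LINT x|lebesgue. classical_d f x vs * \<theta> x) =
        - (\<Sum>i<length vs. (-1) ^ i *
            (LINT x|lebesgue. f x (del_nth i vs) * frechet_derivative \<theta> (at x) (vs ! i)))"
      by (simp add: sum_negf)
  qed
  with test show thesis
    by (rule that)
qed

lemma test_forms_H_forms: "\<phi> \<in> test_forms j S \<Longrightarrow> \<phi> \<in> H_forms j S"
  by (metis H_formsI test_forms_L2 test_forms_weak_ext_deriv)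

lemma H_forms_diff_test_forms:
  assumes "open S" "u \<in> H_forms j S" "\<phi> \<in> test_forms j S"
  shows "u - \<phi> \<in> H_forms j S"
  using assms(2) test_forms_H_forms[OF assms(3)] by (rule real_vector.subspace_diff[OF subspace_H_forms[OF assms(1)]])

lemma
  assumes S: "open S" and \<phi>: "\<phi> \<in> test_forms j S"
  shows ext_d_test_forms: "ext_d j S \<phi> \<in> test_forms (j + 1) S"
    and weak_ext_deriv_test_forms: "weak_ext_deriv S' \<phi> (ext_d j S \<phi>)"
proof -
  obtain \<psi> where \<psi>: "\<psi> \<in> test_forms (j + 1) S" "\<And>S'. weak_ext_deriv S' \<phi> \<psi>"
    using test_forms_weak_ext_deriv[OF \<phi>] by blast
  then have "ext_d j S \<phi> = \<psi>"
    by (intro ext_d_eqI[OF S] test_forms_L2 \<phi>)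
  with \<psi> show "ext_d j S \<phi> \<in> test_forms (j + 1) S" "weak_ext_deriv S' \<phi> (ext_d j S \<phi>)"
    by auto
qed

text \<open>The square of \<open>graph_norm\<close>. Closeness can be measured with it equally well,
  and it is additive in its two parts and free of square roots.\<close>

definition graph_energy :: "int \<Rightarrow> 'a::euclidean_space set \<Rightarrow> 'a dform \<Rightarrow> real" where
  "graph_energy j S u = form_inner u u + form_inner (ext_d j S u) (ext_d j S u)"

lemma H0_forms_iff:
  "u \<in> H0_forms j S \<longleftrightarrow> u \<in> H_forms j S \<and> (\<forall>e>0. \<exists>\<phi>\<in>test_forms j S. graph_energy j S (u - \<phi>) < e)"
proof -
  have "(\<forall>e>0. \<exists>\<phi>\<in>test_forms j S. graph_norm j S (u - \<phi>) < e) \<longleftrightarrow>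
      (\<forall>e>0. \<exists>\<phi>\<in>test_forms j S. graph_energy j S (u - \<phi>) < e)" (is "?L \<longleftrightarrow> ?R")
  proof
    assume ?L
    show ?R
    proof (intro allI impI)
      fix e :: real
      assume "e > 0"
      then obtain \<phi> where "\<phi> \<in> test_forms j S" "graph_norm j S (u - \<phi>) < sqrt e"
        using \<open>?L\<close>[rule_format, of "sqrt e"] by auto
      then show "\<exists>\<phi>\<in>test_forms j S. graph_energy j S (u - \<phi>) < e"
        by (auto simp: graph_norm_def graph_energy_def)
    qed
  next
    assume ?R
    show ?L
    proof (intro allI impI)
      fix e :: real
      assume "e > 0"
      then obtain \<phi> where "\<phi> \<in> test_forms j S" "graph_energy j S (u - \<phi>) < e\<^sup>2"
        using \<open>?R\<close>[rule_format, of "e\<^sup>2"] by auto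
      then show "\<exists>\<phi>\<in>test_forms j S. graph_norm j S (u - \<phi>) < e"
        using \<open>e > 0\<close> by (auto simp: graph_norm_def graph_energy_def intro!: bexI[of _ \<phi>] real_less_lsqrt)
    qed
  qed
  then show ?thesis
    by (simp add: H0_forms_def)
qed

lemma H0_forms_H_forms: "u \<in> H0_forms j S \<Longrightarrow> u \<in> H_forms j S"
  by (simp add: H0_forms_def)

lemma form_inner_zero_left [simp]: "form_inner 0 w = 0"
  using form_inner_scale_left[of 0 0 w] by simp

lemma form_inner_zero_right [simp]: "form_inner w 0 = 0"
  by (simp add: form_inner_commute[of w])

lemma form_inner_scale_right: "form_inner w (c *\<^sub>R u) = c * form_inner w u"
  using form_inner_scale_left[of c u w] by (simp add: form_inner_commute[of w])

text \<open>The parallelogram identity with the square of the norm of u - v dropped. It takes the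
  place of the triangle inequality in approximation arguments.\<close>

lemma form_inner_add_le:
  assumes "u \<in> L2_forms j UNIV" "v \<in> L2_forms j UNIV"
  shows "form_inner (u + v) (u + v) \<le> 2 * form_inner u u + 2 * form_inner v v"
proof -
  have expand: "form_inner (u + c *\<^sub>R v) (u + c *\<^sub>R v) =
      form_inner u u + 2 * c * form_inner u v + c\<^sup>2 * form_inner v v" for c
  proof -
    have mem: "c *\<^sub>R v \<in> L2_forms j UNIV" "u + c *\<^sub>R v \<in> L2_forms j UNIV"
      using assms by (auto intro: L2_forms_add L2_forms_scale)
    have "form_inner (u + c *\<^sub>R v) w = form_inner u w + c * form_inner v w" if "w \<in> L2_forms j UNIV" for w
      using form_inner_add_left[OF assms(1) mem(1) that] by (simp add: form_inner_scale_left)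
    from this[OF mem(2)] this[OF assms(1)] this[OF assms(2)] show ?thesis
      using form_inner_commute[of u "u + c *\<^sub>R v"] form_inner_commute[of v "u + c *\<^sub>R v"]
        form_inner_commute[of v u]
      by (simp add: power2_eq_square algebra_simps)
  qed
  show ?thesis
    using expand[of 1] expand[of "-1"] form_inner_nonneg[of "u + (-1) *\<^sub>R v"] by simp
qed

lemma graph_energy_add_le:
  assumes "open S" "u \<in> H_forms j S" "v \<in> H_forms j S"
  shows "graph_energy j S (u + v) \<le> 2 * graph_energy j S u + 2 * graph_energy j S v"
  using form_inner_add_le[OF L2_forms_UNIV[OF H_forms_L2[OF assms(2)]] L2_forms_UNIV[OF H_forms_L2[OF assms(3)]]]
    form_inner_add_le[OF L2_forms_UNIV[OF ext_d_H_forms(1)[OF assms(1,2)]] L2_forms_UNIV[OF ext_d_H_forms(1)[OF assms(1,3)]]]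
  by (simp add: graph_energy_def ext_d_add[OF assms])

lemma graph_energy_scale:
  assumes "open S" "u \<in> H_forms j S"
  shows "graph_energy j S (c *\<^sub>R u) = c\<^sup>2 * graph_energy j S u"
  by (simp add: graph_energy_def ext_d_scale[OF assms] form_inner_scale_left form_inner_scale_right
      power2_eq_square algebra_simps)

lemma subspace_H0_forms:
  assumes S: "open S"
  shows "real_vector.subspace (H0_forms j S)"
proof (rule real_vector.subspaceI)
  have "graph_energy j S 0 = 0"
    using graph_energy_scale[OF S test_forms_H_forms[OF zero_test_forms], of j 0] by simp
  then show "0 \<in> H0_forms j S"
    using zero_test_forms by (auto simp: H0_forms_iff test_forms_H_forms intro!: bexI[of _ 0])
next
  fix u v
  assume uv: "u \<in> H0_forms j S" "v \<in> H0_forms j S"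
  note H = H0_forms_H_forms[OF uv(1)] H0_forms_H_forms[OF uv(2)]
  have "\<exists>\<phi>\<in>test_forms j S. graph_energy j S (u + v - \<phi>) < e" if "e > 0" for e
  proof -
    \<comment> \<open>A quarter of \<open>e\<close> each, since \<open>graph_energy_add_le\<close>
      doubles both energies.\<close>
    obtain \<phi> \<psi> where \<phi>: "\<phi> \<in> test_forms j S" "graph_energy j S (u - \<phi>) < e / 4"
        and \<psi>: "\<psi> \<in> test_forms j S" "graph_energy j S (v - \<psi>) < e / 4"
      using uv \<open>e > 0\<close> unfolding H0_forms_iff by (metis divide_pos_pos zero_less_numeral)
    have "graph_energy j S ((u - \<phi>) + (v - \<psi>)) \<le> 2 * graph_energy j S (u - \<phi>) + 2 * graph_energy j S (v - \<psi>)"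
      using H \<phi> \<psi> by (intro graph_energy_add_le[OF S] H_forms_diff_test_forms[OF S])
    then have "graph_energy j S (u + v - (\<phi> + \<psi>)) < e"
      using \<phi> \<psi> by (simp add: add_diff_add)
    then show ?thesis
      using \<phi> \<psi> by (auto intro: test_forms_add)
  qed
  then show "u + v \<in> H0_forms j S"
    using H_forms_add[OF S H] by (simp add: H0_forms_iff)
next
  fix c u
  assume u: "u \<in> H0_forms j S"
  note H = H0_forms_H_forms[OF u]
  have "\<exists>\<phi>\<in>test_forms j S. graph_energy j S (c *\<^sub>R u - \<phi>) < e" if "e > 0" for e
  proof -
    \<comment> \<open>Adding 1 to the scaling factor of the energy covers the case
      \<open>c = 0\<close> as well.\<close>
    have "e / (c\<^sup>2 + 1) > 0"
      using that by (simp add: add_nonneg_pos)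
    then obtain \<phi> where \<phi>: "\<phi> \<in> test_forms j S" "graph_energy j S (u - \<phi>) < e / (c\<^sup>2 + 1)"
      using u unfolding H0_forms_iff by metis
    have nonneg: "0 \<le> graph_energy j S (u - \<phi>)"
      by (simp add: graph_energy_def form_inner_nonneg)
    have "graph_energy j S (c *\<^sub>R (u - \<phi>)) = c\<^sup>2 * graph_energy j S (u - \<phi>)"
      using H \<phi> by (intro graph_energy_scale[OF S] H_forms_diff_test_forms[OF S])
    also have "\<dots> \<le> (c\<^sup>2 + 1) * graph_energy j S (u - \<phi>)"
      using nonneg by (simp add: algebra_simps)
    also have "\<dots> < e"
      using \<phi>(2) by (simp add: pos_less_divide_eq add_nonneg_pos mult.commute)
    finally have "graph_energy j S (c *\<^sub>R u - c *\<^sub>R \<phi>) < e"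
      by (simp add: scaleR_diff_right)
    then show ?thesis
      using test_forms_scale[OF \<phi>(1)] by blast
  qed
  then show "c *\<^sub>R u \<in> H0_forms j S"
    using H_forms_scale[OF S H] by (simp add: H0_forms_iff)
qed

lemma
  assumes S: "open S" and u: "u \<in> H_forms j S"
  shows ext_d_in_H_forms: "ext_d j S u \<in> H_forms (j + 1) S"
    and ext_d_ext_d: "ext_d (j + 1) S (ext_d j S u) = 0"
proof -
  note du = ext_d_H_forms[OF S u]
  note weak = weak_ext_deriv_twice[OF du(2)]
  show "ext_d j S u \<in> H_forms (j + 1) S"
    by (rule H_formsI[OF du(1) zero_L2_forms weak])
  show "ext_d (j + 1) S (ext_d j S u) = 0"
    by (rule ext_d_eqI[OF S du(1) zero_L2_forms weak])
qed

text \<open>As d vanishes when applied twice, the energy of \<open>d(u - \<phi>)\<close> is just one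
  of the two summands in the energy of \<open>u - \<phi>\<close>; and \<open>d\<phi>\<close> is
  again a test form.\<close>

lemma ext_d_H0_forms:
  assumes S: "open S" and u: "u \<in> H0_forms j S"
  shows "ext_d j S u \<in> H0_forms (j + 1) S"
  unfolding H0_forms_iff
proof (intro conjI allI impI)
  note H = H0_forms_H_forms[OF u]
  show "ext_d j S u \<in> H_forms (j + 1) S"
    by (rule ext_d_in_H_forms[OF S H])
  fix e :: real
  assume "e > 0"
  then obtain \<phi> where \<phi>: "\<phi> \<in> test_forms j S" "graph_energy j S (u - \<phi>) < e"
    using u by (auto simp: H0_forms_iff)
  have diff: "u - \<phi> \<in> H_forms j S"
    using H \<phi>(1) by (intro H_forms_diff_test_forms[OF S])
  have "ext_d j S u - ext_d j S \<phi> = ext_d j S (u - \<phi>)"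
    by (rule ext_d_diff[OF S H test_forms_H_forms[OF \<phi>(1)], symmetric])
  then have "graph_energy (j + 1) S (ext_d j S u - ext_d j S \<phi>) \<le> graph_energy j S (u - \<phi>)"
    using form_inner_nonneg[of "u - \<phi>"]
    by (simp add: graph_energy_def ext_d_ext_d[OF S diff])
  then show "\<exists>\<psi>\<in>test_forms (j + 1) S. graph_energy (j + 1) S (ext_d j S u - \<psi>) < e"
    using \<phi> ext_d_test_forms[OF S \<phi>(1)] by (meson le_less_trans)
qed

text \<open>Extension by zero: test forms on \<open>K\<close> satisfy the weak formula against all test functions on
  \<open>S\<close>, and the formula is stable under limits in the graph norm.\<close>
lemma H0_forms_extend:
  assumes K: "open K" "K \<subseteq> S" and u: "u \<in> H0_forms j K"
  shows "u \<in> H_forms j S"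
proof -
  note H = H0_forms_H_forms[OF u]
  note u' = H_forms_L2[OF H] ext_d_H_forms(1)[OF K(1) H]
  have "weak_ext_deriv S u (ext_d j K u)"
  proof (rule weak_ext_deriv_limit[OF L2_forms_UNIV[OF u'(1)] L2_forms_UNIV[OF u'(2)]])
    fix \<epsilon> :: real
    assume "\<epsilon> > 0"
    then obtain \<phi> where \<phi>: "\<phi> \<in> test_forms j K" "graph_energy j K (u - \<phi>) < \<epsilon>\<^sup>2"
      using u unfolding H0_forms_iff by (meson zero_less_power)
    note H' = test_forms_H_forms[OF \<phi>(1)]
    have "form_inner (u - \<phi>) (u - \<phi>) \<le> \<epsilon>\<^sup>2"
        "form_inner (ext_d j K u - ext_d j K \<phi>) (ext_d j K u - ext_d j K \<phi>) \<le> \<epsilon>\<^sup>2"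
      using \<phi>(2) form_inner_nonneg[of "u - \<phi>"] form_inner_nonneg[of "ext_d j K u - ext_d j K \<phi>"]
      by (auto simp: graph_energy_def ext_d_diff[OF K(1) H H'])
    moreover have "\<phi> \<in> L2_forms j UNIV" "ext_d j K \<phi> \<in> L2_forms (j + 1) UNIV"
      using H_forms_L2[OF H'] ext_d_H_forms(1)[OF K(1) H'] by (auto intro: L2_forms_UNIV)
    ultimately show "\<exists>u'\<in>L2_forms j UNIV. \<exists>w'\<in>L2_forms (j + 1) UNIV. weak_ext_deriv S u' w' \<and>
        form_inner (u - u') (u - u') \<le> \<epsilon>\<^sup>2 \<and> form_inner (ext_d j K u - w') (ext_d j K u - w') \<le> \<epsilon>\<^sup>2"
      using weak_ext_deriv_test_forms[OF K(1) \<phi>(1)] by blast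
  qed
  then show ?thesis
    using u' L2_forms_mono[OF K(2)] by (intro H_formsI) auto
qed

section \<open>Dimensions of spaces given by records\<close>

lemma field_real_ring: "field real_ring"
proof (rule cring.cring_fieldI2)
  show "cring real_ring"
  proof (rule cringI)
    show "abelian_group real_ring"
      by (rule abelian_groupI) (auto simp: real_ring_def intro: exI[of _ "- x" for x])
    show "Group.comm_monoid real_ring"
      by (rule monoid.monoid_comm_monoidI, rule monoidI) (auto simp: real_ring_def)
  qed (auto simp: real_ring_def algebra_simps)
  show "\<exists>b\<in>carrier real_ring. a \<otimes>\<^bsub>real_ring\<^esub> b = \<one>\<^bsub>real_ring\<^esub>"
    if "a \<in> carrier real_ring" "a \<noteq> \<zero>\<^bsub>real_ring\<^esub>" for a
    using that by (auto simp: real_ring_def intro!: exI[of _ "inverse a"])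
qed (simp add: real_ring_def)

lemma real_ring_simps [simp]:
  "carrier real_ring = UNIV" "\<zero>\<^bsub>real_ring\<^esub> = 0" "\<one>\<^bsub>real_ring\<^esub> = 1"
  "a \<otimes>\<^bsub>real_ring\<^esub> b = a * b" "a \<oplus>\<^bsub>real_ring\<^esub> b = a + b"
  by (simp_all add: real_ring_def)

lemma lin_space_simps [simp]:
  "carrier (lin_space S) = S" "\<zero>\<^bsub>lin_space S\<^esub> = 0" "u \<oplus>\<^bsub>lin_space S\<^esub> v = u + v" "c \<odot>\<^bsub>lin_space S\<^esub> v = c *\<^sub>R v"
  by (simp_all add: lin_space_def)

lemma lin_space_carrier_update: "(lin_space S)\<lparr>carrier := S'\<rparr> = lin_space S'"
  by (simp add: lin_space_def)

text \<open>Finite dimension is recorded together with the axioms because \<open>dim\<close> is the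
  least size of a finite generating set, which says nothing if there is none.\<close>

definition fin_space :: "(real, 'v, 'm) module_scheme \<Rightarrow> bool" where
  "fin_space V \<longleftrightarrow> vectorspace real_ring V \<and> vectorspace.fin_dim real_ring V"

text \<open>Containment in a finite span passes to smaller subspaces at once;
  \<open>fin_subspaceE\<close> recovers a finite set spanning exactly \<open>S\<close>.\<close>

definition fin_subspace :: "'v::real_vector set \<Rightarrow> bool" where
  "fin_subspace S \<longleftrightarrow> real_vector.subspace S \<and> (\<exists>B. finite B \<and> S \<subseteq> real_vector.span B)"

lemma fin_subspace_subset:
  "fin_subspace S \<Longrightarrow> real_vector.subspace A \<Longrightarrow> A \<subseteq> S \<Longrightarrow> fin_subspace A"
  unfolding fin_subspace_def by blast

lemma fin_subspaceE:
  assumes "fin_subspace S"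
  obtains B where "finite B" "S = real_vector.span B"
proof -
  obtain C where C: "finite C" "S \<subseteq> real_vector.span C"
    using assms by (auto simp: fin_subspace_def)
  obtain B where B: "B \<subseteq> S" "independent B" "S \<subseteq> real_vector.span B"
  proof -
    show thesis
      by (rule real_vector.basis_exists[of S]) (rule that)
  qed
  have "finite B"
    using real_vector.independent_span_bound[OF C(1) B(2) subset_trans[OF B(1) C(2)]] by simp
  moreover have "S = real_vector.span B"
    using B(3) assms real_vector.span_minimal[OF B(1)] by (simp add: fin_subspace_def subset_antisym)
  ultimately show thesis
    by (rule that)
qed

lemma vectorspace_lin_space:
  assumes "real_vector.subspace S"
  shows "vectorspace real_ring (lin_space S)"
proof -
  have "\<exists>w\<in>S. v + w = 0" if "v \<in> S" for v
    using real_vector.subspace_neg[OF assms that] by (intro bexI[of _ "- v"]) auto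
  then show ?thesis
    using assms
    by (intro vs_criteria field_real_ring)
       (auto simp: real_vector.subspace_def scaleR_add_left scaleR_add_right add.commute add.assoc)
qed

text \<open>Links the two notions of span: the span of \<open>B\<close> in the record is a subspace
  in the sense of \<open>real_vector\<close> that contains \<open>B\<close>, hence contains
  \<open>S\<close>.\<close>

lemma fin_space_lin_space:
  fixes S :: "'v::real_vector set"
  assumes "fin_subspace S"
  shows "fin_space (lin_space S)"
proof -
  obtain B where B: "finite B" "S = real_vector.span B"
    using fin_subspaceE[OF assms] .
  have sub: "real_vector.subspace S"
    using assms by (simp add: fin_subspace_def)
  interpret V: vectorspace real_ring "lin_space S"
    by (rule vectorspace_lin_space[OF sub])
  have BS: "B \<subseteq> carrier (lin_space S)"
    using B(2) real_vector.span_superset[of B] by simp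
  have "submodule real_ring (V.span B) (lin_space S)"
    by (rule V.span_is_submodule[OF BS])
  then have "real_vector.subspace (V.span B)"
    by (auto simp: submodule_def intro!: real_vector.subspaceI)
  moreover have "B \<subseteq> V.span B"
    using BS by (rule V.in_own_span)
  ultimately have "S \<subseteq> V.span B"
    unfolding B(2) by (intro real_vector.span_minimal)
  then have "V.gen_set B"
    using V.span_is_subset2[OF BS] by auto
  then have "V.fin_dim"
    unfolding V.fin_dim_def using B(1) BS by blast
  then show ?thesis
    using V.vectorspace_axioms by (simp add: fin_space_def)
qed

lemma vdim_lin_space_zero: "vdim (lin_space {0::'v::real_vector}) = 0"
proof -
  interpret V: vectorspace real_ring "lin_space {0::'v}"
    by (intro vectorspace_lin_space) (simp add: real_vector.subspace_def)
  have "V.gen_set {}"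
    using V.span_empty by simp
  then show ?thesis
    unfolding V.dim_def by (intro Least_eq_0 exI[of _ "{}"]) simp
qed

lemma vdim_eq_0_imp:
  assumes "fin_space V" "vdim V = 0"
  shows "carrier V = {\<zero>\<^bsub>V\<^esub>}"
proof -
  interpret V: vectorspace real_ring V
    using assms by (simp add: fin_space_def)
  have fd: "V.fin_dim"
    using assms by (simp add: fin_space_def)
  obtain B where B: "finite B" "V.basis B"
    using V.finite_basis_exists[OF fd] by blast
  then have "B = {}"
    using V.dim_basis assms(2) by simp
  then show ?thesis
    using B(2) V.span_empty by (simp add: V.basis_def)
qed

lemma vdim_lin_space_eq_0_iff: "fin_subspace S \<Longrightarrow> vdim (lin_space S) = 0 \<longleftrightarrow> S = {0}"
  using vdim_eq_0_imp[OF fin_space_lin_space, of S] vdim_lin_space_zero[where 'v = 'a] by auto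

text \<open>The axioms are transported along \<open>f\<close>. In this way a space of tuples of
  cosets becomes a vector space as an image of \<open>unbroken_forms\<close>.\<close>

lemma vectorspace_hom_image:
  assumes V: "vectorspace real_ring V"
    and surj: "carrier W = f ` carrier V"
    and add: "\<And>u v. u \<in> carrier V \<Longrightarrow> v \<in> carrier V \<Longrightarrow> f (u \<oplus>\<^bsub>V\<^esub> v) = f u \<oplus>\<^bsub>W\<^esub> f v"
    and smult: "\<And>c v. v \<in> carrier V \<Longrightarrow> f (c \<odot>\<^bsub>V\<^esub> v) = c \<odot>\<^bsub>W\<^esub> f v"
    and zero: "f \<zero>\<^bsub>V\<^esub> = \<zero>\<^bsub>W\<^esub>"
  shows "vectorspace real_ring W"
proof -
  interpret V: vectorspace real_ring V
    by (rule V)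
  have V_simps: "c \<odot>\<^bsub>V\<^esub> v \<in> carrier V" "(a * b) \<odot>\<^bsub>V\<^esub> v = a \<odot>\<^bsub>V\<^esub> (b \<odot>\<^bsub>V\<^esub> v)" "1 \<odot>\<^bsub>V\<^esub> v = v"
      "(a + b) \<odot>\<^bsub>V\<^esub> v = a \<odot>\<^bsub>V\<^esub> v \<oplus>\<^bsub>V\<^esub> b \<odot>\<^bsub>V\<^esub> v"
    if "v \<in> carrier V" for a b c v
    using that V.smult_assoc1[of a b v] V.smult_one[of v] V.smult_l_distr[of a b v] V.smult_closed[of c v]
    by auto
  show ?thesis
  proof (rule vs_criteria[OF field_real_ring])
    show "\<zero>\<^bsub>W\<^esub> \<in> carrier W"
      using surj zero by (metis V.zero_closed image_eqI)
    show "\<forall>v w. v \<in> carrier W \<and> w \<in> carrier W \<longrightarrow> v \<oplus>\<^bsub>W\<^esub> w \<in> carrier W"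
      by (auto simp: surj add[symmetric])
    show "\<forall>v\<in>carrier W. \<exists>w\<in>carrier W. v \<oplus>\<^bsub>W\<^esub> w = \<zero>\<^bsub>W\<^esub>"
    proof
      fix v
      assume "v \<in> carrier W"
      then obtain u where u: "u \<in> carrier V" "v = f u"
        by (auto simp: surj)
      have "f u \<oplus>\<^bsub>W\<^esub> f (\<ominus>\<^bsub>V\<^esub> u) = \<zero>\<^bsub>W\<^esub>"
        using u(1) add[of u "\<ominus>\<^bsub>V\<^esub> u"] zero by (simp add: V.r_neg)
      then show "\<exists>w\<in>carrier W. v \<oplus>\<^bsub>W\<^esub> w = \<zero>\<^bsub>W\<^esub>"
        using u by (auto simp: surj)
    qed
    show "\<forall>c v. c \<in> carrier real_ring \<and> v \<in> carrier W \<longrightarrow> c \<odot>\<^bsub>W\<^esub> v \<in> carrier W"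
      by (auto simp: surj smult[symmetric] V_simps)
    show "\<forall>v w. v \<in> carrier W \<and> w \<in> carrier W \<longrightarrow> v \<oplus>\<^bsub>W\<^esub> w = w \<oplus>\<^bsub>W\<^esub> v"
      by (auto simp: surj add[symmetric] V.a_comm)
    show "\<forall>v w x. v \<in> carrier W \<and> w \<in> carrier W \<and> x \<in> carrier W \<longrightarrow>
        v \<oplus>\<^bsub>W\<^esub> w \<oplus>\<^bsub>W\<^esub> x = v \<oplus>\<^bsub>W\<^esub> (w \<oplus>\<^bsub>W\<^esub> x)"
      by (auto simp: surj add[symmetric] V.a_assoc)
    show "\<forall>v\<in>carrier W. v \<oplus>\<^bsub>W\<^esub> \<zero>\<^bsub>W\<^esub> = v"
      by (auto simp: surj zero[symmetric] add[symmetric])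
    show "\<forall>a b v. a \<in> carrier real_ring \<and> b \<in> carrier real_ring \<and> v \<in> carrier W \<longrightarrow>
        (a \<otimes>\<^bsub>real_ring\<^esub> b) \<odot>\<^bsub>W\<^esub> v = a \<odot>\<^bsub>W\<^esub> (b \<odot>\<^bsub>W\<^esub> v)"
      by (auto simp: surj smult[symmetric] V_simps)
    show "\<forall>v\<in>carrier W. \<one>\<^bsub>real_ring\<^esub> \<odot>\<^bsub>W\<^esub> v = v"
      by (auto simp: surj smult[symmetric] V_simps)
    show "\<forall>a b v. a \<in> carrier real_ring \<and> b \<in> carrier real_ring \<and> v \<in> carrier W \<longrightarrow>
        (a \<oplus>\<^bsub>real_ring\<^esub> b) \<odot>\<^bsub>W\<^esub> v = a \<odot>\<^bsub>W\<^esub> v \<oplus>\<^bsub>W\<^esub> b \<odot>\<^bsub>W\<^esub> v"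
      by (auto simp: surj smult[symmetric] add[symmetric] V_simps)
    show "\<forall>a v w. a \<in> carrier real_ring \<and> v \<in> carrier W \<and> w \<in> carrier W \<longrightarrow>
        a \<odot>\<^bsub>W\<^esub> (v \<oplus>\<^bsub>W\<^esub> w) = a \<odot>\<^bsub>W\<^esub> v \<oplus>\<^bsub>W\<^esub> a \<odot>\<^bsub>W\<^esub> w"
      by (auto simp: surj smult[symmetric] add[symmetric] V_simps V.smult_r_distr)
  qed
qed

text \<open>Rank-nullity for such an image. The kernel is kept as a record with replaced carrier, so
  that for \<open>lin_space\<close> it is again a \<open>lin_space\<close>.\<close>

lemma
  assumes V: "fin_space V"
    and surj: "carrier W = f ` carrier V"
    and add: "\<And>u v. u \<in> carrier V \<Longrightarrow> v \<in> carrier V \<Longrightarrow> f (u \<oplus>\<^bsub>V\<^esub> v) = f u \<oplus>\<^bsub>W\<^esub> f v"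
    and smult: "\<And>c v. v \<in> carrier V \<Longrightarrow> f (c \<odot>\<^bsub>V\<^esub> v) = c \<odot>\<^bsub>W\<^esub> f v"
    and zero: "f \<zero>\<^bsub>V\<^esub> = \<zero>\<^bsub>W\<^esub>"
  shows fin_space_hom_image: "fin_space W"
    and vdim_hom_image: "vdim V = vdim W + vdim (V\<lparr>carrier := {v \<in> carrier V. f v = \<zero>\<^bsub>W\<^esub>}\<rparr>)"
    and vdim_iso: "inj_on f (carrier V) \<Longrightarrow> vdim V = vdim W"
proof -
  have vsV: "vectorspace real_ring V" and fd: "vectorspace.fin_dim real_ring V"
    using V by (auto simp: fin_space_def)
  have vsW: "vectorspace real_ring W"
    by (rule vectorspace_hom_image[OF vsV surj add smult zero])
  have hom: "f \<in> LinearCombinations.module_hom real_ring V W"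
    using surj add smult by (auto simp: LinearCombinations.module_hom_def)
  interpret V: vectorspace real_ring V by (rule vsV)
  interpret W: vectorspace real_ring W by (rule vsW)
  interpret L: linear_map real_ring V W f
    by unfold_locales (rule hom)
  show "fin_space W"
    using L.rank_nullity_main(2)[OF fd surj[symmetric]] vsW by (simp add: fin_space_def)
  show "vdim V = vdim W + vdim (V\<lparr>carrier := {v \<in> carrier V. f v = \<zero>\<^bsub>W\<^esub>}\<rparr>)"
    using L.rank_nullity[OF fd] by (simp add: L.ker_def L.im_def surj[symmetric])
  show "vdim V = vdim W" if "inj_on f (carrier V)"
    by (rule L.dim_eq[OF fd that surj[symmetric]])
qed

lemma direct_sum_simps [simp]:
  "carrier (direct_sum V W) = carrier V \<times> carrier W" "\<zero>\<^bsub>direct_sum V W\<^esub> = (\<zero>\<^bsub>V\<^esub>, \<zero>\<^bsub>W\<^esub>)"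
  "(u, w) \<oplus>\<^bsub>direct_sum V W\<^esub> (u', w') = (u \<oplus>\<^bsub>V\<^esub> u', w \<oplus>\<^bsub>W\<^esub> w')"
  "c \<odot>\<^bsub>direct_sum V W\<^esub> (u, w) = (c \<odot>\<^bsub>V\<^esub> u, c \<odot>\<^bsub>W\<^esub> w)"
  by (simp_all add: direct_sum_def)

lemma
  assumes V: "fin_space V" and W: "fin_space W"
  shows fin_space_direct_sum: "fin_space (direct_sum V W)"
    and vdim_direct_sum: "vdim (direct_sum V W) = vdim V + vdim W"
proof -
  have vs: "vectorspace real_ring V" "vectorspace real_ring W"
    using V W by (auto simp: fin_space_def)
  interpret V: vectorspace real_ring V by (rule vs(1))
  interpret W: vectorspace real_ring W by (rule vs(2))
  interpret D: vectorspace real_ring "direct_sum V W"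
    by (rule direct_sum_is_vs[OF vs])
  obtain A where A: "finite A" "A \<subseteq> carrier V" "V.gen_set A"
    using V by (auto simp: fin_space_def V.fin_dim_def)
  obtain B where B: "finite B" "B \<subseteq> carrier W" "W.gen_set B"
    using W by (auto simp: fin_space_def W.fin_dim_def)
  define G where "G = (\<lambda>a. (a, \<zero>\<^bsub>W\<^esub>)) ` A \<union> (\<lambda>b. (\<zero>\<^bsub>V\<^esub>, b)) ` B"
  have G: "finite G" "G \<subseteq> carrier (direct_sum V W)"
    using A B by (auto simp: G_def)
  interpret S: submodule real_ring "D.span G" "direct_sum V W"
    by (rule D.span_is_submodule[OF G(2)])
  have GS: "G \<subseteq> D.span G"
    by (rule D.in_own_span[OF G(2)])
  have c0: "c \<odot>\<^bsub>V\<^esub> \<zero>\<^bsub>V\<^esub> = \<zero>\<^bsub>V\<^esub>" "c \<odot>\<^bsub>W\<^esub> \<zero>\<^bsub>W\<^esub> = \<zero>\<^bsub>W\<^esub>" for c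
    using V.rmult_0[of c] W.rmult_0[of c] by simp_all
  have "submodule real_ring {a \<in> carrier V. (a, \<zero>\<^bsub>W\<^esub>) \<in> D.span G} V"
  proof
    fix a a'
    assume "a \<in> {a \<in> carrier V. (a, \<zero>\<^bsub>W\<^esub>) \<in> D.span G}" "a' \<in> {a \<in> carrier V. (a, \<zero>\<^bsub>W\<^esub>) \<in> D.span G}"
    then show "a \<oplus>\<^bsub>V\<^esub> a' \<in> {a \<in> carrier V. (a, \<zero>\<^bsub>W\<^esub>) \<in> D.span G}"
      using S.m_closed[of "(a, \<zero>\<^bsub>W\<^esub>)" "(a', \<zero>\<^bsub>W\<^esub>)"] by simp
  next
    fix c a
    assume "c \<in> carrier real_ring" "a \<in> {a \<in> carrier V. (a, \<zero>\<^bsub>W\<^esub>) \<in> D.span G}"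
    then show "c \<odot>\<^bsub>V\<^esub> a \<in> {a \<in> carrier V. (a, \<zero>\<^bsub>W\<^esub>) \<in> D.span G}"
      using S.smult_closed[of c "(a, \<zero>\<^bsub>W\<^esub>)"] by (simp add: c0)
  qed (use S.zero_closed in auto)
  then have "V.span A \<subseteq> {a \<in> carrier V. (a, \<zero>\<^bsub>W\<^esub>) \<in> D.span G}"
    using A(2) GS by (intro V.span_is_subset) (auto simp: G_def)
  moreover have "submodule real_ring {b \<in> carrier W. (\<zero>\<^bsub>V\<^esub>, b) \<in> D.span G} W"
  proof
    fix a a'
    assume "a \<in> {b \<in> carrier W. (\<zero>\<^bsub>V\<^esub>, b) \<in> D.span G}" "a' \<in> {b \<in> carrier W. (\<zero>\<^bsub>V\<^esub>, b) \<in> D.span G}"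
    then show "a \<oplus>\<^bsub>W\<^esub> a' \<in> {b \<in> carrier W. (\<zero>\<^bsub>V\<^esub>, b) \<in> D.span G}"
      using S.m_closed[of "(\<zero>\<^bsub>V\<^esub>, a)" "(\<zero>\<^bsub>V\<^esub>, a')"] by simp
  next
    fix c a
    assume "c \<in> carrier real_ring" "a \<in> {b \<in> carrier W. (\<zero>\<^bsub>V\<^esub>, b) \<in> D.span G}"
    then show "c \<odot>\<^bsub>W\<^esub> a \<in> {b \<in> carrier W. (\<zero>\<^bsub>V\<^esub>, b) \<in> D.span G}"
      using S.smult_closed[of c "(\<zero>\<^bsub>V\<^esub>, a)"] by (simp add: c0)
  qed (use S.zero_closed in auto)
  then have "W.span B \<subseteq> {b \<in> carrier W. (\<zero>\<^bsub>V\<^esub>, b) \<in> D.span G}"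
    using B(2) GS by (intro W.span_is_subset) (auto simp: G_def)
  ultimately have "(a, \<zero>\<^bsub>W\<^esub>) \<in> D.span G" "(\<zero>\<^bsub>V\<^esub>, b) \<in> D.span G" if "a \<in> carrier V" "b \<in> carrier W" for a b
    using that A(3) B(3) by auto
  then have "(a, b) \<in> D.span G" if "a \<in> carrier V" "b \<in> carrier W" for a b
    using that S.m_closed[of "(a, \<zero>\<^bsub>W\<^esub>)" "(\<zero>\<^bsub>V\<^esub>, b)"] by simp
  then have "D.gen_set G"
    using D.span_is_subset2[OF G(2)] by auto
  then show fin: "fin_space (direct_sum V W)"
    using G D.vectorspace_axioms by (auto simp: fin_space_def D.fin_dim_def)
  let ?K = "(direct_sum V W)\<lparr>carrier := {p \<in> carrier (direct_sum V W). snd p = \<zero>\<^bsub>W\<^esub>}\<rparr>"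
  \<comment> \<open>Rank-nullity for the second projection; its kernel is \<open>V\<close> embedded
    as the first factor.\<close>
  have "vdim (direct_sum V W) = vdim W + vdim ?K"
    using V.zero_closed
    by (intro vdim_hom_image[OF fin]) (auto simp: image_iff)
  also have "vdim V = vdim ?K"
    by (rule vdim_iso[OF V, where f = "\<lambda>v. (v, \<zero>\<^bsub>W\<^esub>)"])
       (auto simp: c0 inj_on_def direct_sum_def)
  then have "vdim ?K = vdim V" ..
  finally show "vdim (direct_sum V W) = vdim V + vdim W"
    by simp
qed

lemma product_space_simps [simp]:
  "carrier (product_space I V) = (\<Pi>\<^sub>E i\<in>I. carrier (V i))" "\<zero>\<^bsub>product_space I V\<^esub> = (\<lambda>i\<in>I. \<zero>\<^bsub>V i\<^esub>)"
  "f \<oplus>\<^bsub>product_space I V\<^esub> g = (\<lambda>i\<in>I. f i \<oplus>\<^bsub>V i\<^esub> g i)" "c \<odot>\<^bsub>product_space I V\<^esub> f = (\<lambda>i\<in>I. c \<odot>\<^bsub>V i\<^esub> f i)"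
  by (simp_all add: product_space_def)

lemma
  fixes V :: "'i \<Rightarrow> (real, 'v) module"
  assumes "finite I" "\<And>i. i \<in> I \<Longrightarrow> fin_space (V i)"
  shows fin_space_product_space: "fin_space (product_space I V)"
    and vdim_product_space: "vdim (product_space I V) = (\<Sum>i\<in>I. vdim (V i))"
proof -
  have "fin_space (product_space I V) \<and> vdim (product_space I V) = (\<Sum>i\<in>I. vdim (V i))"
    using assms
  proof (induction I rule: finite_induct)
    case empty
    \<comment> \<open>The empty product has a single element, so the zero space maps isomorphically
      onto it.\<close>
    let ?Z = "lin_space {0::real}" and ?f = "\<lambda>_::real. \<lambda>i\<in>{}. \<zero>\<^bsub>V i\<^esub>"
    have Z: "fin_space ?Z"
      by (intro fin_space_lin_space) (auto simp: fin_subspace_def real_vector.subspace_def)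
    have surj: "carrier (product_space {} V) = ?f ` carrier ?Z"
      by (simp add: restrict_def)
    have add: "?f (u \<oplus>\<^bsub>?Z\<^esub> v) = ?f u \<oplus>\<^bsub>product_space {} V\<^esub> ?f v" for u v
      by (simp add: fun_eq_iff)
    have smult: "?f (c \<odot>\<^bsub>?Z\<^esub> v) = c \<odot>\<^bsub>product_space {} V\<^esub> ?f v" for c v
      by (simp add: fun_eq_iff)
    have zero: "?f \<zero>\<^bsub>?Z\<^esub> = \<zero>\<^bsub>product_space {} V\<^esub>"
      by simp
    have inj: "inj_on ?f (carrier ?Z)"
      by simp
    show ?case
      using fin_space_hom_image[OF Z surj add smult zero] vdim_iso[OF Z surj add smult zero inj]
      by (simp add: vdim_lin_space_zero)
  next
    case (insert i I)
    have Vi: "fin_space (V i)" and IH: "fin_space (product_space I V)"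
        "vdim (product_space I V) = (\<Sum>i\<in>I. vdim (V i))"
      using insert by auto
    let ?D = "direct_sum (V i) (product_space I V)"
    let ?f = "\<lambda>(x, g). g(i := x)"
    have D: "fin_space ?D"
      by (rule fin_space_direct_sum[OF Vi IH(1)])
    have surj: "carrier (product_space (insert i I) V) = ?f ` carrier ?D"
      using PiE_insert_eq[of i I "\<lambda>i. carrier (V i)"] by (simp add: case_prod_unfold)
    have add: "?f (p \<oplus>\<^bsub>?D\<^esub> q) = ?f p \<oplus>\<^bsub>product_space (insert i I) V\<^esub> ?f q" for p q
      using insert.hyps(2) by (cases p; cases q) (auto simp: fun_eq_iff)
    have smult: "?f (c \<odot>\<^bsub>?D\<^esub> p) = c \<odot>\<^bsub>product_space (insert i I) V\<^esub> ?f p" for c p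
      using insert.hyps(2) by (cases p) (auto simp: fun_eq_iff)
    have zero: "?f \<zero>\<^bsub>?D\<^esub> = \<zero>\<^bsub>product_space (insert i I) V\<^esub>"
      by (auto simp: fun_eq_iff)
    have inj: "inj_on ?f (carrier ?D)"
    proof (rule inj_onI, clarsimp)
      fix a f b g
      assume "f \<in> (\<Pi>\<^sub>E i\<in>I. carrier (V i))" "g \<in> (\<Pi>\<^sub>E i\<in>I. carrier (V i))" and eq: "f(i := a) = g(i := b)"
      \<comment> \<open>The update hides the values of \<open>f\<close> and \<open>g\<close> at
        \<open>i\<close>; extensionality recovers them, as \<open>i\<close> lies outside
        \<open>I\<close>.\<close>
      then have "f i = undefined" "g i = undefined"
        using insert.hyps(2) by (auto simp: PiE_def extensional_def)
      moreover have "f j = g j" if "j \<noteq> i" for j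
        using fun_cong[OF eq, of j] that by simp
      ultimately show "a = b \<and> f = g"
        using fun_cong[OF eq, of i] by (intro conjI ext) (simp, metis)
    qed
    show ?case
      using fin_space_hom_image[OF D surj add smult zero] vdim_iso[OF D surj add smult zero inj]
        vdim_direct_sum[OF Vi IH(1)] IH(2) insert.hyps
      by simp
  qed
  then show "fin_space (product_space I V)" "vdim (product_space I V) = (\<Sum>i\<in>I. vdim (V i))"
    by auto
qed

section \<open>Orthogonal projections and restriction to subdomains\<close>

text \<open>One Gram-Schmidt step per generator. The projection is built by hand because
  \<open>form_inner\<close> is an inner product on L2 forms of one degree rather than on the whole
  type.\<close>

lemma orthogonal_projection_exists:
  assumes "finite B" "B \<subseteq> L2_forms j UNIV" "v \<in> L2_forms j UNIV"
  shows "\<exists>a\<in>real_vector.span B. \<forall>b\<in>real_vector.span B. form_inner (v - a) b = 0"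
  using assms
proof (induction B arbitrary: v rule: finite_induct)
  case empty
  then show ?case
    using form_inner_zero_right by simp
next
  case (insert b B)
  note sub = subspace_L2_forms[of j UNIV]
  have span: "real_vector.span B \<subseteq> L2_forms j UNIV"
    using insert.prems by (intro real_vector.span_minimal sub) auto
  obtain p where p: "p \<in> real_vector.span B" "\<forall>c\<in>real_vector.span B. form_inner (b - p) c = 0"
    using insert.IH[of b] insert.prems by auto
  obtain a where a: "a \<in> real_vector.span B" "\<forall>c\<in>real_vector.span B. form_inner (v - a) c = 0"
    using insert.IH[of v] insert.prems by auto
  \<comment> \<open>The part of the new generator orthogonal to the old span.\<close>
  define c where "c = b - p"
  have mem: "c \<in> L2_forms j UNIV" "v - a \<in> L2_forms j UNIV"
    using insert.prems p(1) a(1) span by (auto simp: c_def intro!: real_vector.subspace_diff[OF sub])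
  have c_span: "c \<in> real_vector.span (insert b B)"
    using p(1) real_vector.span_mono[of B "insert b B"]
    unfolding c_def by (intro real_vector.span_diff) (auto intro: real_vector.span_base)
  \<comment> \<open>The Fourier coefficient along \<open>c\<close>. If \<open>c\<close> is 0, the
    quotient is 0 by convention and \<open>a'\<close> is simply \<open>a\<close>.\<close>
  define t where "t = form_inner (v - a) c / form_inner c c"
  define a' where "a' = a + t *\<^sub>R c"
  have a'_span: "a' \<in> real_vector.span (insert b B)"
    using a(1) c_span real_vector.span_mono[of B "insert b B"]
    unfolding a'_def by (intro real_vector.span_add real_vector.span_scale) auto
  have inner: "form_inner (v - a') x = form_inner (v - a) x - t * form_inner c x" if "x \<in> L2_forms j UNIV" for x
    using form_inner_add_left[OF mem(2) L2_forms_scale[OF mem(1), of "- t"] that] form_inner_scale_left[of "- t" c x]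
    by (simp add: a'_def algebra_simps)
  have "form_inner (v - a') c = 0"
  proof (cases "form_inner c c = 0")
    case True
    then have "c = 0"
      by (rule form_inner_eq_0_imp[OF mem(1)])
    then show ?thesis
      using form_inner_zero_right by simp
  qed (use inner[OF mem(1)] in \<open>simp add: t_def\<close>)
  moreover have "form_inner (v - a') x = 0" if "x \<in> real_vector.span B" for x
    using inner[of x] that a(2) p(2) span by (auto simp: c_def)
  moreover have "v - a' \<in> L2_forms j UNIV"
    using a'_span real_vector.span_minimal[OF insert.prems(1) sub] insert.prems(2)
    by (intro real_vector.subspace_diff[OF sub]) auto
  ultimately have "form_inner (v - a') (s *\<^sub>R c + y) = 0" if "y \<in> real_vector.span B" for s y
    using that span form_inner_add_left[OF L2_forms_scale[OF mem(1), of s], of y "v - a'"]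
      form_inner_commute[of c "v - a'"] form_inner_commute[of y "v - a'"]
      form_inner_commute[of "s *\<^sub>R c + y" "v - a'"]
    by (auto simp: form_inner_scale_left)
  moreover have "\<exists>s y. x = s *\<^sub>R c + y \<and> y \<in> real_vector.span B" if x: "x \<in> real_vector.span (insert b B)" for x
  proof -
    obtain s where "x - s *\<^sub>R b \<in> real_vector.span B"
      using x by (auto simp: real_vector.span_insert)
    then have "(x - s *\<^sub>R b) + s *\<^sub>R p \<in> real_vector.span B"
      using p(1) by (intro real_vector.span_add real_vector.span_scale)
    then show ?thesis
      by (intro exI[of _ s] exI[of _ "(x - s *\<^sub>R b) + s *\<^sub>R p"]) (auto simp: c_def algebra_simps)
  qed
  ultimately have "form_inner (v - a') x = 0" if "x \<in> real_vector.span (insert b B)" for x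
    using that by blast
  then show ?case
    using a'_span by blast
qed

lemma fin_subspace_projection:
  assumes A: "fin_subspace A" "A \<subseteq> L2_forms j UNIV" and v: "v \<in> L2_forms j UNIV"
  obtains a where "a \<in> A" "\<forall>b\<in>A. form_inner (v - a) b = 0"
proof -
  obtain B where B: "finite B" "A = real_vector.span B"
    using fin_subspaceE[OF A(1)] .
  have "B \<subseteq> L2_forms j UNIV"
    using A(2) B(2) real_vector.span_superset[of B] by auto
  then show thesis
    using orthogonal_projection_exists[OF B(1) _ v] B(2) that by auto
qed

text \<open>Addition is an isomorphism from the direct sum of \<open>A\<close> and its complement
  onto \<open>S\<close>: projection gives surjectivity, definiteness gives injectivity.\<close>

lemma
  assumes S: "fin_subspace S" "S \<subseteq> L2_forms j UNIV" and A: "real_vector.subspace A" "A \<subseteq> S"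
  shows fin_subspace_orthogonal: "fin_subspace {v \<in> S. \<forall>a\<in>A. form_inner v a = 0}"
    and vdim_orthogonal_split:
      "vdim (lin_space S) = vdim (lin_space A) + vdim (lin_space {v \<in> S. \<forall>a\<in>A. form_inner v a = 0})"
proof -
  let ?P = "{v \<in> S. \<forall>a\<in>A. form_inner v a = 0}"
  have subS: "real_vector.subspace S"
    using S by (simp add: fin_subspace_def)
  have AL: "A \<subseteq> L2_forms j UNIV"
    using S A by auto
  have "real_vector.subspace ?P"
  proof (rule real_vector.subspaceI)
    show "u + v \<in> ?P" if "u \<in> ?P" "v \<in> ?P" for u v
    proof -
      have "form_inner (u + v) a = 0" if "a \<in> A" for a
        using form_inner_add_left[of u j v a] that \<open>u \<in> ?P\<close> \<open>v \<in> ?P\<close> S(2) AL by auto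
      then show ?thesis
        using that real_vector.subspace_add[OF subS] by simp
    qed
  qed (use real_vector.subspace_0[OF subS] real_vector.subspace_scale[OF subS] in
      \<open>auto simp: form_inner_scale_left\<close>)
  then show P: "fin_subspace ?P"
    by (rule fin_subspace_subset[OF S(1)]) auto
  have finA: "fin_subspace A"
    by (rule fin_subspace_subset[OF S(1) A])
  let ?D = "direct_sum (lin_space A) (lin_space ?P)"
  have fin: "fin_space (lin_space A)" "fin_space (lin_space ?P)"
    by (intro fin_space_lin_space finA P)+
  have surj: "carrier (lin_space S) = (\<lambda>(a, p). a + p) ` carrier ?D"
  proof
    show "carrier (lin_space S) \<subseteq> (\<lambda>(a, p). a + p) ` carrier ?D"
    proof
      fix v
      assume "v \<in> carrier (lin_space S)"
      then have v: "v \<in> S" "v \<in> L2_forms j UNIV"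
        using S(2) by auto
      obtain a where a: "a \<in> A" "\<forall>b\<in>A. form_inner (v - a) b = 0"
        using fin_subspace_projection[OF finA AL v(2)] .
      moreover have "v - a \<in> S"
        using a(1) A(2) v(1) by (intro real_vector.subspace_diff[OF subS]) auto
      ultimately show "v \<in> (\<lambda>(a, p). a + p) ` carrier ?D"
        by (auto intro!: image_eqI[where x = "(a, v - a)"])
    qed
    show "(\<lambda>(a, p). a + p) ` carrier ?D \<subseteq> carrier (lin_space S)"
      using A(2) real_vector.subspace_add[OF subS] by auto
  qed
  have inj: "inj_on (\<lambda>(a, p). a + p) (carrier ?D)"
  proof (rule inj_onI, clarsimp)
    fix a p b q
    assume a: "a \<in> A" and b: "b \<in> A" and p: "p \<in> S" "\<forall>x\<in>A. form_inner p x = 0"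
      and q: "q \<in> S" "\<forall>x\<in>A. form_inner q x = 0" and eq: "a + p = b + q"
    have "a - b = q - p"
      using eq by (simp add: algebra_simps)
    moreover have ab: "a - b \<in> A"
      by (rule real_vector.subspace_diff[OF A(1) a b])
    moreover have "form_inner (q - p) (a - b) = 0"
      using form_inner_add_left[of q j "(-1) *\<^sub>R p" "a - b"] form_inner_scale_left[of "-1" p "a - b"]
        p q ab S(2) AL L2_forms_scale[of p j UNIV "-1"] by auto
    ultimately have "form_inner (a - b) (a - b) = 0"
      by simp
    then have "a - b = 0"
      using ab AL by (intro form_inner_eq_0_imp) auto
    then show "a = b \<and> p = q"
      using eq by simp
  qed
  have "vdim ?D = vdim (lin_space S)"
    by (rule vdim_iso[OF fin_space_direct_sum[OF fin] surj _ _ _ inj]) (auto simp: algebra_simps scaleR_add_right)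
  then show "vdim (lin_space S) = vdim (lin_space A) + vdim (lin_space ?P)"
    using vdim_direct_sum[OF fin] by simp
qed

section \<open>Boundaries of Lipschitz domains\<close>

lemma lipschitz_domain_open: "lipschitz_domain S \<Longrightarrow> open S"
  by (simp add: lipschitz_domain_def)

text \<open>Near each of its points the frontier lies in the graph of \<open>g\<close>, the image of
  a hyperplane, hence of a null set, under a Lipschitz map.\<close>

lemma negligible_frontier_lipschitz_domain:
  fixes S :: "'a::euclidean_space set"
  assumes "lipschitz_domain S"
  shows "negligible (frontier S)"
  unfolding locally_negligible_alt[of "frontier S"]
proof
  fix x
  assume "x \<in> frontier S"
  then obtain U e L and g :: "'a \<Rightarrow> real" where U: "open U" "x \<in> U" and e: "norm e = 1"
      and g: "L-lipschitz_on {y. y \<bullet> e = 0} g" and SU: "S \<inter> U = {y \<in> U. g (y - (y \<bullet> e) *\<^sub>R e) < y \<bullet> e}"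
  proof -
    have "\<exists>U e L g. open U \<and> x \<in> U \<and> norm e = 1 \<and> L-lipschitz_on {y. y \<bullet> e = 0} g \<and>
        S \<inter> U = {y \<in> U. g (y - (y \<bullet> e) *\<^sub>R e) < y \<bullet> e}"
      using assms \<open>x \<in> frontier S\<close> by (simp add: lipschitz_domain_def)
    then show thesis
      by (elim exE conjE) (rule that)
  qed
  have ee: "e \<bullet> e = 1"
    using e by (simp add: dot_square_norm)
  have proj: "y - (y \<bullet> e) *\<^sub>R e \<in> {y. y \<bullet> e = 0}" for y
    by (simp add: inner_diff_left ee)
  \<comment> \<open>Within \<open>U\<close> the domain is the set where \<open>h\<close> is
    negative; the next steps place the frontier on the zero set.\<close>
  define h where "h = (\<lambda>y. g (y - (y \<bullet> e) *\<^sub>R e) - y \<bullet> e)"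
  have "continuous_on UNIV (\<lambda>y. g (y - (y \<bullet> e) *\<^sub>R e))"
    by (rule continuous_on_compose2[OF lipschitz_on_continuous_on[OF g]]) (use proj in \<open>auto intro!: continuous_intros\<close>)
  then have h: "continuous_on UNIV h"
    unfolding h_def by (intro continuous_intros)
  have graph: "y \<in> (\<lambda>z. z + g z *\<^sub>R e) ` {z. e \<bullet> z = 0}" if y: "y \<in> frontier S \<inter> U" for y
  proof -
    have "y \<notin> S"
      using y lipschitz_domain_open[OF assms] by (auto simp: frontier_def interior_open)
    then have "\<not> h y < 0"
      using SU y by (auto simp: h_def)
    moreover have "\<not> h y > 0"
    proof
      assume "h y > 0"
      \<comment> \<open>An open set disjoint from \<open>S\<close> is disjoint from its closure, so
        \<open>h\<close> cannot be positive at a frontier point.\<close>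
      have "open (U \<inter> {z. h z > 0})"
        using U(1) open_Collect_less[OF continuous_on_const h, of 0] by auto
      moreover have "h z < 0" if "z \<in> S \<inter> U" for z
        using that unfolding SU by (simp add: h_def)
      then have "(U \<inter> {z. h z > 0}) \<inter> S = {}"
        by force
      ultimately have "(U \<inter> {z. h z > 0}) \<inter> closure S = {}"
        by (simp add: open_Int_closure_eq_empty)
      then show False
        using y \<open>h y > 0\<close> by (auto simp: frontier_def)
    qed
    ultimately have "g (y - (y \<bullet> e) *\<^sub>R e) = y \<bullet> e"
      by (simp add: h_def)
    then show ?thesis
      using proj[of y] by (intro image_eqI[where x = "y - (y \<bullet> e) *\<^sub>R e"]) (auto simp: inner_commute)
  qed
  have "negligible ((\<lambda>z. z + g z *\<^sub>R e) ` {z. e \<bullet> z = 0})"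
  proof (rule negligible_locally_Lipschitz_image)
    show "negligible {z. e \<bullet> z = 0}"
      using e by (intro negligible_hyperplane) auto
    fix z
    assume z: "z \<in> {z. e \<bullet> z = 0}"
    \<comment> \<open>The horizontal part contributes 1 to the Lipschitz constant, the vertical part
      \<open>L\<close>, since \<open>e\<close> is a unit vector.\<close>
    have "norm (y + g y *\<^sub>R e - (z + g z *\<^sub>R e)) \<le> (1 + L) * norm (y - z)" if "y \<in> {z. e \<bullet> z = 0}" for y
    proof -
      have "\<bar>g y - g z\<bar> \<le> L * norm (y - z)"
        using lipschitz_onD[OF g, of y z] that z by (simp add: dist_norm inner_commute)
      moreover have "norm (y + g y *\<^sub>R e - (z + g z *\<^sub>R e)) \<le> norm (y - z) + norm ((g y - g z) *\<^sub>R e)"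
        using norm_triangle_ineq[of "y - z" "(g y - g z) *\<^sub>R e"] by (simp add: algebra_simps)
      moreover have "norm ((g y - g z) *\<^sub>R e) = \<bar>g y - g z\<bar>"
        using e by simp
      ultimately show ?thesis
        unfolding distrib_right mult_1 by linarith
    qed
    then show "\<exists>T B. open T \<and> z \<in> T \<and>
        (\<forall>y\<in>{z. e \<bullet> z = 0} \<inter> T. norm (y + g y *\<^sub>R e - (z + g z *\<^sub>R e)) \<le> B * norm (y - z))"
      by (intro exI[of _ UNIV] exI[of _ "1 + L"]) auto
  qed simp
  then have "negligible (frontier S \<inter> U)"
    by (rule negligible_subset) (use graph in auto)
  moreover have "openin (top_of_set (frontier S)) (frontier S \<inter> U)"
    using U(1) by (rule openin_open_Int)
  ultimately show "\<exists>N. openin (top_of_set (frontier S)) N \<and> x \<in> N \<and> negligible N"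
    using \<open>x \<in> frontier S\<close> U(2) by blast
qed

section \<open>Restriction of forms to subdomains\<close>

lemma restrict_form_add: "restrict_form S (u + v) = restrict_form S u + restrict_form S v"
  by transfer (auto intro!: AE_I2)

lemma restrict_form_scale: "restrict_form S (c *\<^sub>R u) = c *\<^sub>R restrict_form S u"
  by transfer (auto intro!: AE_I2)

lemma restrict_form_zero [simp]: "restrict_form S 0 = 0"
  by transfer auto

lemma restrict_form_sum: "restrict_form S (\<Sum>i\<in>I. f i) = (\<Sum>i\<in>I. restrict_form S (f i))"
  by (induction I rule: infinite_finite_induct) (auto simp: restrict_form_add)

lemma restrict_form_empty: "restrict_form {} u = 0"
  by transfer auto

lemma restrict_form_Un: "A \<inter> B = {} \<Longrightarrow> restrict_form (A \<union> B) u = restrict_form A u + restrict_form B u"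
  by transfer (auto intro!: AE_I2)

lemma restrict_form_disjoint:
  assumes "u \<in> L2_forms j A" "A \<inter> B = {}"
  shows "restrict_form B u = 0"
proof -
  obtain f where f: "u = abs_dform f" "L2_fun j A f"
    using L2_forms_cases[OF assms(1)] .
  then have "(\<lambda>x. if x \<in> B then f x else (\<lambda>vs. 0)) = (\<lambda>x vs. 0)"
    using assms(2) by (auto simp: L2_fun_def fun_eq_iff)
  then show ?thesis
    by (simp add: f(1) restrict_form.abs_eq zero_dform_def)
qed

lemma restrict_form_AE_cover:
  assumes "u \<in> L2_forms j S" "negligible (S - B)"
  shows "restrict_form B u = u"
proof -
  obtain f where f: "u = abs_dform f" "L2_fun j S f"
    using L2_forms_cases[OF assms(1)] .
  have "AE x in lebesgue. x \<notin> S - B"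
    using assms(2) by (intro AE_not_in) (simp add: negligible_iff_null_sets)
  then have "AE x in lebesgue. (if x \<in> B then f x else (\<lambda>vs. 0)) = f x"
    by eventually_elim (use f(2) in \<open>auto simp: L2_fun_def\<close>)
  then show ?thesis
    by (simp add: f(1) restrict_form.abs_eq dform.abs_eq_iff)
qed

lemma restrict_form_self: "u \<in> L2_forms j S \<Longrightarrow> restrict_form S u = u"
  by (rule restrict_form_AE_cover) auto

lemma sum_restrict_form:
  assumes "finite T" "pairwise disjnt T"
  shows "(\<Sum>K\<in>T. restrict_form K u) = restrict_form (\<Union>T) u"
  using assms
proof (induction T rule: finite_induct)
  case (insert K T)
  then have "K \<inter> \<Union>T = {}"
    by (auto simp: pairwise_insert disjnt_def)
  then show ?case
    using insert by (simp add: restrict_form_Un pairwise_insert)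
qed (simp add: restrict_form_empty)

text \<open>A point of \<open>\<Omega>\<close> in no subdomain lies in the closure of one of them,
  hence on its frontier; finitely many frontiers form a null set.\<close>

lemma sum_restrict_form_decomposition:
  assumes T: "lipschitz_decomposition \<Omega> T" and u: "u \<in> L2_forms j \<Omega>"
  shows "(\<Sum>K\<in>T. restrict_form K u) = u"
proof -
  have T': "finite T" "pairwise disjnt T" "closure \<Omega> = (\<Union>K\<in>T. closure K)" "\<And>K. K \<in> T \<Longrightarrow> lipschitz_domain K"
    using T by (auto simp: lipschitz_decomposition_def)
  have "\<Omega> - \<Union>T \<subseteq> (\<Union>K\<in>T. frontier K)"
  proof
    fix x
    assume x: "x \<in> \<Omega> - \<Union>T"
    then have "x \<in> (\<Union>K\<in>T. closure K)"
      using closure_subset[of \<Omega>] T'(3) by auto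
    then obtain K where "K \<in> T" "x \<in> closure K"
      by auto
    then show "x \<in> (\<Union>K\<in>T. frontier K)"
      using x interior_subset[of K] by (auto simp: frontier_def)
  qed
  moreover have "negligible (\<Union>K\<in>T. frontier K)"
    using T'(1,4) by (intro negligible_Union) (auto intro: negligible_frontier_lipschitz_domain)
  ultimately have "negligible (\<Omega> - \<Union>T)"
    by (rule negligible_subset[rotated])
  then show ?thesis
    using restrict_form_AE_cover[OF u] sum_restrict_form[OF T'(1,2)] by simp
qed

section \<open>Local spaces and traces\<close>

lemma finite_dim_subcomplexD:
  assumes "finite_dim_subcomplex K W"
  shows "fin_subspace (W j)" "W j \<subseteq> H_forms j K" "\<And>u. u \<in> W j \<Longrightarrow> ext_d j K u \<in> W (j + 1)"
proof -
  have "\<exists>B. finite B \<and> W j = real_vector.span B"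
    using assms by (simp add: finite_dim_subcomplex_def)
  then show "fin_subspace (W j)"
    by (auto simp: fin_subspace_def)
qed (use assms in \<open>auto simp: finite_dim_subcomplex_def\<close>)

lemma fin_subspace_local_W0:
  assumes "open K" "finite_dim_subcomplex K W"
  shows "fin_subspace (local_W0 K W j)"
proof (rule fin_subspace_subset[OF finite_dim_subcomplexD(1)[OF assms(2), of j]])
  show "real_vector.subspace (local_W0 K W j)"
    using finite_dim_subcomplexD(1)[OF assms(2), of j] subspace_H0_forms[OF assms(1), of j]
    unfolding local_W0_def fin_subspace_def by (intro real_vector.subspace_inter) auto
qed (simp add: local_W0_def)

lemma local_W0_H_forms: "finite_dim_subcomplex K W \<Longrightarrow> local_W0 K W j \<subseteq> H_forms j K"
  using finite_dim_subcomplexD(2) by (auto simp: local_W0_def)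

text \<open>The chain of boundaries in cycles in the whole local space is split orthogonally twice.
  If the complement of the cycles and the boundaries both vanish, every local form is a cycle and
  harmonicity is an empty condition; this is the core of the equality case.\<close>

lemma
  assumes K: "open K" and W: "finite_dim_subcomplex K W"
  shows fin_subspace_local_B0: "fin_subspace (local_B0 K W k)"
    and local_spaces_trivial_iff:
      "local_W0 K W (k - 1) = {0} \<and> local_B0 K W k = {0} \<and> local_Z0_perp K W k = {0} \<longleftrightarrow>
        local_W0 K W (k - 1) = {0} \<and> local_W0 K W k = local_H0 K W k"
    and fin_subspace_local_H0: "fin_subspace (local_H0 K W k)"
    and fin_subspace_local_Z0_perp: "fin_subspace (local_Z0_perp K W k)"
    and vdim_local_W0: "vdim (lin_space (local_W0 K W k)) = vdim (lin_space (local_B0 K W k)) +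
      vdim (lin_space (local_H0 K W k)) + vdim (lin_space (local_Z0_perp K W k))"
proof -
  note W0 = fin_subspace_local_W0[OF K W]
  have subW0: "real_vector.subspace (local_W0 K W j)" for j
    using W0 by (simp add: fin_subspace_def)
  have H: "u \<in> H_forms j K" if "u \<in> local_W0 K W j" for u j
    using local_W0_H_forms[OF W] that by auto
  have L2: "local_W0 K W k \<subseteq> L2_forms k UNIV"
  proof
    show "u \<in> L2_forms k UNIV" if "u \<in> local_W0 K W k" for u
      by (rule L2_forms_UNIV[OF H_forms_L2[OF H[OF that]]])
  qed
  have subZ0: "real_vector.subspace (local_Z0 K W k)"
  proof (rule real_vector.subspaceI)
    show "0 \<in> local_Z0 K W k"
      using real_vector.subspace_0[OF subW0] ext_d_zero[OF K] by (simp add: local_Z0_def)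
    show "u + v \<in> local_Z0 K W k" if "u \<in> local_Z0 K W k" "v \<in> local_Z0 K W k" for u v
      using that real_vector.subspace_add[OF subW0, of u k v] ext_d_add[OF K H H, of u k v]
      by (simp add: local_Z0_def)
    show "c *\<^sub>R u \<in> local_Z0 K W k" if "u \<in> local_Z0 K W k" for c u
      using that real_vector.subspace_scale[OF subW0, of u k c] ext_d_scale[OF K H, of u k c]
      by (simp add: local_Z0_def)
  qed
  have Z0_W0: "local_Z0 K W k \<subseteq> local_W0 K W k"
    by (auto simp: local_Z0_def)
  have subB0: "real_vector.subspace (local_B0 K W k)"
  proof (rule real_vector.subspaceI)
    show "0 \<in> local_B0 K W k"
      unfolding local_B0_def
      by (rule image_eqI[where x = 0]) (simp_all add: ext_d_zero[OF K] real_vector.subspace_0[OF subW0])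
    show "u + v \<in> local_B0 K W k" if uv: "u \<in> local_B0 K W k" "v \<in> local_B0 K W k" for u v
    proof -
      obtain u' v' where u': "u = ext_d (k - 1) K u'" "u' \<in> local_W0 K W (k - 1)"
          and v': "v = ext_d (k - 1) K v'" "v' \<in> local_W0 K W (k - 1)"
        using uv by (auto simp: local_B0_def)
      have "u + v = ext_d (k - 1) K (u' + v')"
        using ext_d_add[OF K H[OF u'(2)] H[OF v'(2)]] by (simp add: u' v')
      then show ?thesis
        unfolding local_B0_def by (rule image_eqI) (rule real_vector.subspace_add[OF subW0 u'(2) v'(2)])
    qed
    show "c *\<^sub>R u \<in> local_B0 K W k" if u: "u \<in> local_B0 K W k" for c u
    proof -
      obtain u' where u': "u = ext_d (k - 1) K u'" "u' \<in> local_W0 K W (k - 1)"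
        using u by (auto simp: local_B0_def)
      have "c *\<^sub>R u = ext_d (k - 1) K (c *\<^sub>R u')"
        using ext_d_scale[OF K H[OF u'(2)]] by (simp add: u')
      then show ?thesis
        unfolding local_B0_def by (rule image_eqI) (rule real_vector.subspace_scale[OF subW0 u'(2)])
    qed
  qed
  \<comment> \<open>Three facts combine: \<open>W\<close> is a subcomplex, d preserves vanishing
    traces, and d applied twice is 0.\<close>
  have B0_Z0: "local_B0 K W k \<subseteq> local_Z0 K W k"
  proof
    fix v
    assume "v \<in> local_B0 K W k"
    then obtain u where u: "u \<in> local_W0 K W (k - 1)" "v = ext_d (k - 1) K u"
      by (auto simp: local_B0_def)
    then have "v \<in> W k" "v \<in> H0_forms k K" "ext_d k K v = 0"
      using finite_dim_subcomplexD(3)[OF W, of u "k - 1"] ext_d_H0_forms[OF K, of u "k - 1"]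
        ext_d_ext_d[OF K H[OF u(1)]] by (auto simp: local_W0_def)
    then show "v \<in> local_Z0 K W k"
      by (simp add: local_Z0_def local_W0_def)
  qed
  have Z0: "fin_subspace (local_Z0 K W k)"
    by (rule fin_subspace_subset[OF W0 subZ0 Z0_W0])
  show "fin_subspace (local_B0 K W k)"
    by (rule fin_subspace_subset[OF Z0 subB0 B0_Z0])
  have LZ: "local_Z0 K W k \<subseteq> L2_forms k UNIV"
    using Z0_W0 L2 by auto
  show "fin_subspace (local_H0 K W k)"
    unfolding local_H0_def by (rule fin_subspace_orthogonal[OF Z0 LZ subB0 B0_Z0])
  show "fin_subspace (local_Z0_perp K W k)"
    unfolding local_Z0_perp_def by (rule fin_subspace_orthogonal[OF W0 L2 subZ0 Z0_W0])
  show "vdim (lin_space (local_W0 K W k)) = vdim (lin_space (local_B0 K W k)) +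
      vdim (lin_space (local_H0 K W k)) + vdim (lin_space (local_Z0_perp K W k))"
    using vdim_orthogonal_split[OF W0 L2 subZ0 Z0_W0] vdim_orthogonal_split[OF Z0 LZ subB0 B0_Z0]
    by (simp add: local_H0_def local_Z0_perp_def)
  have 1: "local_W0 K W k = local_H0 K W k" if 0: "local_B0 K W k = {0}" "local_Z0_perp K W k = {0}"
  proof -
    have "v \<in> local_Z0 K W k" if v: "v \<in> local_W0 K W k" for v
    proof -
      have "v \<in> L2_forms k UNIV"
        using v L2 by auto
      then obtain a where a: "a \<in> local_Z0 K W k" "\<forall>b\<in>local_Z0 K W k. form_inner (v - a) b = 0"
        by (rule fin_subspace_projection[OF Z0 LZ])
      then have "v - a \<in> local_Z0_perp K W k"
        using v Z0_W0 real_vector.subspace_diff[OF subW0, of v k a] by (auto simp: local_Z0_perp_def)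
      then show ?thesis
        using a(1) 0(2) by simp
    qed
    then show ?thesis
      using 0(1) Z0_W0 by (auto simp: local_H0_def)
  qed
  have 2: "local_B0 K W k = {0}" if "local_W0 K W (k - 1) = {0}"
    using that by (simp add: local_B0_def ext_d_zero[OF K])
  \<comment> \<open>If all local forms are harmonic, an element of the complement of the cycles is
    itself a cycle, hence orthogonal to itself.\<close>
  have 3: "local_Z0_perp K W k = {0}" if eq: "local_W0 K W k = local_H0 K W k"
  proof -
    have "v = 0" if v: "v \<in> local_Z0_perp K W k" for v
    proof -
      have "v \<in> local_Z0 K W k"
        using v eq by (auto simp: local_Z0_perp_def local_H0_def)
      moreover from this have "form_inner v v = 0"
        using v by (simp add: local_Z0_perp_def)
      ultimately show ?thesis
        using LZ by (intro form_inner_eq_0_imp[of v k]) auto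
    qed
    moreover have "0 \<in> local_Z0_perp K W k"
      using real_vector.subspace_0[OF subW0] by (simp add: local_Z0_perp_def)
    ultimately show ?thesis
      by auto
  qed
  show "local_W0 K W (k - 1) = {0} \<and> local_B0 K W k = {0} \<and> local_Z0_perp K W k = {0} \<longleftrightarrow>
      local_W0 K W (k - 1) = {0} \<and> local_W0 K W k = local_H0 K W k"
    by (intro iffI conjI; elim conjE) (assumption | rule 1 2 3)+
qed

section \<open>Unbroken forms, cosets and tangential traces\<close>

lemma mem_unbroken_forms:
  "v \<in> unbroken_forms \<Omega> T W j \<longleftrightarrow> v \<in> H_forms j \<Omega> \<and> (\<forall>K\<in>T. restrict_form K v \<in> W K j)"
  by (auto simp: unbroken_forms_def broken_forms_def)

lemma mem_coset_iff: "w \<in> a_r_coset (lin_space S) N v \<longleftrightarrow> w - v \<in> N"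
proof -
  have "w \<in> a_r_coset (lin_space S) N v \<longleftrightarrow> (\<exists>h\<in>N. w = h + v)"
    by (auto simp: a_r_coset_def r_coset_def)
  also have "\<dots> \<longleftrightarrow> w - v \<in> N"
    by (metis add_diff_cancel_right' diff_add_cancel)
  finally show ?thesis .
qed

lemma coset_add:
  assumes "real_vector.subspace N"
  shows "a_r_coset (lin_space S) N (u + v) =
    a_r_coset (lin_space S) N u <+>\<^bsub>lin_space S\<^esub> a_r_coset (lin_space S) N v"
proof (rule Set.set_eqI)
  fix w
  have "w - (u + v) \<in> N \<longleftrightarrow> (\<exists>a b. a - u \<in> N \<and> b - v \<in> N \<and> w = a + b)"
  proof
    assume "w - (u + v) \<in> N"
    then show "\<exists>a b. a - u \<in> N \<and> b - v \<in> N \<and> w = a + b"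
      using real_vector.subspace_0[OF assms] by (intro exI[of _ u] exI[of _ "w - u"]) (simp add: algebra_simps)
  next
    assume "\<exists>a b. a - u \<in> N \<and> b - v \<in> N \<and> w = a + b"
    then obtain a b where "a - u \<in> N" "b - v \<in> N" "w = a + b"
      by blast
    then show "w - (u + v) \<in> N"
      using real_vector.subspace_add[OF assms, of "a - u" "b - v"] by (simp add: algebra_simps)
  qed
  moreover have "w \<in> A <+>\<^bsub>lin_space S\<^esub> B \<longleftrightarrow> (\<exists>a b. a \<in> A \<and> b \<in> B \<and> w = a + b)" for A B
    by (auto simp: set_add_def set_mult_def)
  ultimately show "w \<in> a_r_coset (lin_space S) N (u + v) \<longleftrightarrow>
      w \<in> a_r_coset (lin_space S) N u <+>\<^bsub>lin_space S\<^esub> a_r_coset (lin_space S) N v"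
    by (simp only: mem_coset_iff)
qed

text \<open>The union is the scalar multiplication of \<open>quotient_space\<close>. Taking cosets
  again after scaling matters for \<open>c = 0\<close>, where the bare multiples of a coset would
  collapse to 0 instead of filling \<open>N\<close>.\<close>

lemma coset_scale:
  assumes "real_vector.subspace N"
  shows "a_r_coset (lin_space S) N (c *\<^sub>R v) =
    (\<Union>a\<in>a_r_coset (lin_space S) N v. a_r_coset (lin_space S) N (c *\<^sub>R a))"
proof (rule Set.set_eqI)
  fix w
  have "w - c *\<^sub>R v \<in> N \<longleftrightarrow> (\<exists>a. a - v \<in> N \<and> w - c *\<^sub>R a \<in> N)"
  proof
    assume "w - c *\<^sub>R v \<in> N"
    then show "\<exists>a. a - v \<in> N \<and> w - c *\<^sub>R a \<in> N"
      using real_vector.subspace_0[OF assms] by (intro exI[of _ v]) simp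
  next
    assume "\<exists>a. a - v \<in> N \<and> w - c *\<^sub>R a \<in> N"
    then obtain a where "a - v \<in> N" "w - c *\<^sub>R a \<in> N"
      by blast
    then show "w - c *\<^sub>R v \<in> N"
      using real_vector.subspace_add[OF assms, of "w - c *\<^sub>R a" "c *\<^sub>R (a - v)"]
        real_vector.subspace_scale[OF assms, of "a - v" c] by (simp add: algebra_simps)
  qed
  then show "w \<in> a_r_coset (lin_space S) N (c *\<^sub>R v) \<longleftrightarrow>
      w \<in> (\<Union>a\<in>a_r_coset (lin_space S) N v. a_r_coset (lin_space S) N (c *\<^sub>R a))"
    using mem_coset_iff[where S = S] by auto
qed

lemma coset_eq_iff:
  assumes "real_vector.subspace N"
  shows "a_r_coset (lin_space S) N v = N \<longleftrightarrow> v \<in> N"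
proof
  assume eq: "a_r_coset (lin_space S) N v = N"
  have "v \<in> a_r_coset (lin_space S) N v"
    unfolding mem_coset_iff using real_vector.subspace_0[OF assms] by simp
  then show "v \<in> N"
    unfolding eq .
next
  assume v: "v \<in> N"
  show "a_r_coset (lin_space S) N v = N"
  proof (rule Set.set_eqI)
    fix w
    have "w \<in> N" if "w - v \<in> N"
      using real_vector.subspace_add[OF assms that v] by simp
    then show "w \<in> a_r_coset (lin_space S) N v \<longleftrightarrow> w \<in> N"
      unfolding mem_coset_iff using real_vector.subspace_diff[OF assms _ v] by metis
  qed
qed

lemma tan_trace_space_simps:
  "\<zero>\<^bsub>tan_trace_space j K\<^esub> = H0_forms j K"
  "A \<oplus>\<^bsub>tan_trace_space j K\<^esub> B = A <+>\<^bsub>lin_space (H_forms j K)\<^esub> B"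
  "c \<odot>\<^bsub>tan_trace_space j K\<^esub> A = (\<Union>a\<in>A. a_r_coset (lin_space (H_forms j K)) (H0_forms j K) (c *\<^sub>R a))"
  by (simp_all add: tan_trace_space_def quotient_space_def)

lemma
  assumes K: "open K"
  shows tan_trace_add: "tan_trace j K (u + v) = tan_trace j K u \<oplus>\<^bsub>tan_trace_space j K\<^esub> tan_trace j K v"
    and tan_trace_scale: "tan_trace j K (c *\<^sub>R u) = c \<odot>\<^bsub>tan_trace_space j K\<^esub> tan_trace j K u"
    and tan_trace_eq_zero_iff: "tan_trace j K u = \<zero>\<^bsub>tan_trace_space j K\<^esub> \<longleftrightarrow> u \<in> H0_forms j K"
  unfolding tan_trace_def tan_trace_space_simps
  by (rule coset_add[OF subspace_H0_forms[OF K]] coset_scale[OF subspace_H0_forms[OF K]]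
      coset_eq_iff[OF subspace_H0_forms[OF K]])+

lemma unbroken_traces_simps:
  "carrier (unbroken_traces \<Omega> T W j) =
    (\<lambda>v. \<lambda>K\<in>T. tan_trace j K (restrict_form K v)) ` unbroken_forms \<Omega> T W j"
  "\<zero>\<^bsub>unbroken_traces \<Omega> T W j\<^esub> = (\<lambda>K\<in>T. \<zero>\<^bsub>tan_trace_space j K\<^esub>)"
  "f \<oplus>\<^bsub>unbroken_traces \<Omega> T W j\<^esub> g = (\<lambda>K\<in>T. f K \<oplus>\<^bsub>tan_trace_space j K\<^esub> g K)"
  "c \<odot>\<^bsub>unbroken_traces \<Omega> T W j\<^esub> f = (\<lambda>K\<in>T. c \<odot>\<^bsub>tan_trace_space j K\<^esub> f K)"
  by (simp_all add: unbroken_traces_def)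

text \<open>An unbroken form is the sum of its restrictions, so the generators of all the local
  spaces together span a space containing every unbroken form.\<close>

lemma fin_subspace_unbroken_forms:
  assumes \<Omega>: "open \<Omega>" and T: "lipschitz_decomposition \<Omega> T"
    and W: "\<And>K. K \<in> T \<Longrightarrow> finite_dim_subcomplex K (W K)"
  shows "fin_subspace (unbroken_forms \<Omega> T W j)"
proof -
  have subW: "real_vector.subspace (W K j)" if "K \<in> T" for K
    using finite_dim_subcomplexD(1)[OF W[OF that], of j] by (simp add: fin_subspace_def)
  have "real_vector.subspace (unbroken_forms \<Omega> T W j)"
    using real_vector.subspace_0[OF subW] real_vector.subspace_add[OF subW] real_vector.subspace_scale[OF subW]
      real_vector.subspace_0[OF subspace_H_forms[OF \<Omega>]]
    by (intro real_vector.subspaceI)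
       (auto simp: mem_unbroken_forms restrict_form_add restrict_form_scale H_forms_add[OF \<Omega>] H_forms_scale[OF \<Omega>])
  moreover have "\<forall>K\<in>T. \<exists>B. finite B \<and> W K j \<subseteq> real_vector.span B"
    using finite_dim_subcomplexD(1)[OF W] by (simp add: fin_subspace_def)
  from bchoice[OF this] obtain B where "\<forall>K\<in>T. finite (B K) \<and> W K j \<subseteq> real_vector.span (B K)" ..
  then have B: "finite (B K)" "W K j \<subseteq> real_vector.span (B K)" if "K \<in> T" for K
    using that by auto
  have "unbroken_forms \<Omega> T W j \<subseteq> real_vector.span (\<Union>K\<in>T. B K)"
  proof
    fix v
    assume v: "v \<in> unbroken_forms \<Omega> T W j"
    then have "(\<Sum>K\<in>T. restrict_form K v) = v"
      by (intro sum_restrict_form_decomposition[OF T, of _ j] H_forms_L2) (simp add: mem_unbroken_forms)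
    moreover have "restrict_form K v \<in> real_vector.span (\<Union>K\<in>T. B K)" if "K \<in> T" for K
      using that v B(2)[OF that] real_vector.span_mono[of "B K" "\<Union>K\<in>T. B K"] by (auto simp: mem_unbroken_forms)
    then have "(\<Sum>K\<in>T. restrict_form K v) \<in> real_vector.span (\<Union>K\<in>T. B K)"
      by (rule real_vector.span_sum)
    ultimately show "v \<in> real_vector.span (\<Union>K\<in>T. B K)"
      by simp
  qed
  moreover have "finite (\<Union>K\<in>T. B K)"
    using B(1) T by (auto simp: lipschitz_decomposition_def)
  ultimately show ?thesis
    by (auto simp: fin_subspace_def)
qed

lemma
  assumes \<Omega>: "open \<Omega>" and T: "lipschitz_decomposition \<Omega> T"
    and W: "\<And>K. K \<in> T \<Longrightarrow> finite_dim_subcomplex K (W K)"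
  shows fin_space_unbroken_traces: "fin_space (unbroken_traces \<Omega> T W j)"
    and vdim_unbroken_forms: "vdim (lin_space (unbroken_forms \<Omega> T W j)) =
      vdim (unbroken_traces \<Omega> T W j) + (\<Sum>K\<in>T. vdim (lin_space (local_W0 K (W K) j)))"
proof -
  let ?V = "lin_space (unbroken_forms \<Omega> T W j)" and ?R = "unbroken_traces \<Omega> T W j"
  let ?f = "\<lambda>v. \<lambda>K\<in>T. tan_trace j K (restrict_form K v)"
  have T': "finite T" "\<And>K. K \<in> T \<Longrightarrow> open K" "\<And>K. K \<in> T \<Longrightarrow> K \<subseteq> \<Omega>"
      "\<And>K K'. K \<in> T \<Longrightarrow> K' \<in> T \<Longrightarrow> K \<noteq> K' \<Longrightarrow> K \<inter> K' = {}"
    using T lipschitz_domain_open by (auto simp: lipschitz_decomposition_def pairwise_def disjnt_def)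
  have fsV: "fin_subspace (unbroken_forms \<Omega> T W j)"
    by (rule fin_subspace_unbroken_forms[OF \<Omega> T W])
  have V: "fin_space ?V"
    by (rule fin_space_lin_space[OF fsV])
  have subV: "real_vector.subspace (unbroken_forms \<Omega> T W j)"
    using fsV by (simp add: fin_subspace_def)
  have surj: "carrier ?R = ?f ` carrier ?V"
    by (simp add: unbroken_traces_simps)
  have add: "?f (u \<oplus>\<^bsub>?V\<^esub> v) = ?f u \<oplus>\<^bsub>?R\<^esub> ?f v" for u v
    by (auto simp: unbroken_traces_simps restrict_form_add tan_trace_add[OF T'(2)] intro!: restrict_ext)
  have smult: "?f (c \<odot>\<^bsub>?V\<^esub> v) = c \<odot>\<^bsub>?R\<^esub> ?f v" for c v
    by (auto simp: unbroken_traces_simps restrict_form_scale tan_trace_scale[OF T'(2)] intro!: restrict_ext)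
  have ker: "?f v = \<zero>\<^bsub>?R\<^esub> \<longleftrightarrow> (\<forall>K\<in>T. restrict_form K v \<in> H0_forms j K)" for v
    using tan_trace_eq_zero_iff[OF T'(2), of _ j "restrict_form _ v"]
    by (auto simp: unbroken_traces_simps fun_eq_iff restrict_def)
  have zero: "?f \<zero>\<^bsub>?V\<^esub> = \<zero>\<^bsub>?R\<^esub>"
    using ker[of 0] real_vector.subspace_0[OF subspace_H0_forms[OF T'(2)]] by simp
  define N where "N = {v \<in> unbroken_forms \<Omega> T W j. \<forall>K\<in>T. restrict_form K v \<in> H0_forms j K}"
  let ?P = "product_space T (\<lambda>K. lin_space (local_W0 K (W K) j))"
  let ?g = "\<lambda>v. \<lambda>K\<in>T. restrict_form K v"
  have vdimV: "vdim ?V = vdim ?R + vdim (lin_space N)"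
    using vdim_hom_image[OF V surj add smult zero]
    unfolding ker lin_space_carrier_update lin_space_simps N_def .
  have "real_vector.subspace N"
    using real_vector.subspace_0[OF subV] real_vector.subspace_add[OF subV] real_vector.subspace_scale[OF subV]
      real_vector.subspace_0[OF subspace_H0_forms[OF T'(2)]] real_vector.subspace_add[OF subspace_H0_forms[OF T'(2)]]
      real_vector.subspace_scale[OF subspace_H0_forms[OF T'(2)]]
    unfolding N_def by (intro real_vector.subspaceI) (auto simp: restrict_form_add restrict_form_scale)
  then have N: "fin_space (lin_space N)"
    by (intro fin_space_lin_space fin_subspace_subset[OF fsV]) (auto simp: N_def)
  have surjP: "carrier ?P = ?g ` carrier (lin_space N)"
  proof
    show "?g ` carrier (lin_space N) \<subseteq> carrier ?P"
      by (auto simp: N_def mem_unbroken_forms local_W0_def)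
    show "carrier ?P \<subseteq> ?g ` carrier (lin_space N)"
    proof
      fix w
      assume w: "w \<in> carrier ?P"
      then have "w K \<in> local_W0 K (W K) j" if "K \<in> T" for K
        using PiE_mem[of w T "\<lambda>K. local_W0 K (W K) j" K] that by simp
      then have wK: "w K \<in> W K j" "w K \<in> H0_forms j K" if "K \<in> T" for K
        using that by (auto simp: local_W0_def)
      \<comment> \<open>The glued form. Each summand vanishes outside its own subdomain and the
        subdomains are disjoint, so restricting to \<open>K\<close> returns
        \<open>w K\<close>.\<close>
      define v where "v = (\<Sum>K\<in>T. w K)"
      have "restrict_form K v = w K" if K: "K \<in> T" for K
      proof -
        have L2: "w K' \<in> L2_forms j K'" if "K' \<in> T" for K'
          using wK(2)[OF that] H0_forms_H_forms H_forms_L2 by blast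
        have "restrict_form K (w K') = (if K' = K then w K else 0)" if "K' \<in> T" for K'
          using restrict_form_self[OF L2[OF K]] restrict_form_disjoint[OF L2[OF that] T'(4)[OF that K]] by auto
        then have "restrict_form K v = (\<Sum>K'\<in>T. if K' = K then w K else 0)"
          unfolding v_def restrict_form_sum by (intro sum.cong) auto
        then show ?thesis
          using K T'(1) by simp
      qed
      \<comment> \<open>Each summand lies in this space separately, by extension by zero.\<close>
      moreover have "v \<in> H_forms j \<Omega>"
        unfolding v_def using H0_forms_extend[OF T'(2) T'(3) wK(2)]
        by (intro real_vector.subspace_sum[OF subspace_H_forms[OF \<Omega>]])
      ultimately have "v \<in> N"
        using wK by (simp add: N_def mem_unbroken_forms)
      moreover have "?g v = w"
        using \<open>\<And>K. K \<in> T \<Longrightarrow> restrict_form K v = w K\<close> w by (auto simp: fun_eq_iff PiE_def extensional_def)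
      ultimately show "w \<in> ?g ` carrier (lin_space N)"
        by (auto intro!: image_eqI[where x = v])
    qed
  qed
  have inj: "inj_on ?g (carrier (lin_space N))"
  proof (rule inj_onI)
    fix u v
    assume u: "u \<in> carrier (lin_space N)" and v: "v \<in> carrier (lin_space N)" and eq: "?g u = ?g v"
    \<comment> \<open>Injectivity is where the null boundaries enter: a form is recovered from its
      restrictions.\<close>
    have rec: "(\<Sum>K\<in>T. restrict_form K x) = x" if "x \<in> N" for x
      using that by (intro sum_restrict_form_decomposition[OF T, of _ j] H_forms_L2) (simp add: N_def mem_unbroken_forms)
    have "u = (\<Sum>K\<in>T. restrict_form K u)"
      using rec[of u] u by simp
    also have "\<dots> = (\<Sum>K\<in>T. restrict_form K v)"
    proof (rule sum.cong)
      show "restrict_form K u = restrict_form K v" if "K \<in> T" for K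
        using fun_cong[OF eq, of K] that by simp
    qed simp
    also have "\<dots> = v"
      using rec[of v] v by simp
    finally show "u = v" .
  qed
  have "vdim (lin_space N) = vdim ?P"
    by (rule vdim_iso[OF N surjP _ _ _ inj])
       (auto simp: restrict_form_add restrict_form_scale intro!: restrict_ext)
  also have "\<dots> = (\<Sum>K\<in>T. vdim (lin_space (local_W0 K (W K) j)))"
    using T'(1,2) W by (intro vdim_product_space fin_space_lin_space fin_subspace_local_W0)
  finally show "vdim ?V = vdim ?R + (\<Sum>K\<in>T. vdim (lin_space (local_W0 K (W K) j)))"
    using vdimV by simp
  show "fin_space ?R"
    by (rule fin_space_hom_image[OF V surj add smult zero])
qed

text \<open>Finite dimension allows \<open>vdim_direct_sum\<close> to split off the harmonic forms,
  which occur in both systems and cancel.\<close>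

lemma fin_subspace_harmonic_forms:
  assumes \<Omega>: "open \<Omega>" and V: "\<And>j. fin_subspace (unbroken_forms \<Omega> T W j)"
  shows "fin_subspace (harmonic_forms \<Omega> T W k)"
proof (rule fin_subspace_subset[OF V])
  have subV: "real_vector.subspace (unbroken_forms \<Omega> T W j)" for j
    using V by (simp add: fin_subspace_def)
  have H: "u \<in> H_forms j \<Omega>" if "u \<in> unbroken_forms \<Omega> T W j" for u j
    using that by (simp add: mem_unbroken_forms)
  show "real_vector.subspace (harmonic_forms \<Omega> T W k)"
  proof (rule real_vector.subspaceI)
    show "0 \<in> harmonic_forms \<Omega> T W k"
      using real_vector.subspace_0[OF subV] by (simp add: harmonic_forms_def ext_d_zero[OF \<Omega>])
  next
    fix u v
    assume uv: "u \<in> harmonic_forms \<Omega> T W k" "v \<in> harmonic_forms \<Omega> T W k"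
    then have mem: "u \<in> unbroken_forms \<Omega> T W k" "v \<in> unbroken_forms \<Omega> T W k"
      by (auto simp: harmonic_forms_def)
    have "form_inner (u + v) (ext_d (k - 1) \<Omega> w) = 0" if w: "w \<in> unbroken_forms \<Omega> T W (k - 1)" for w
    proof -
      have "ext_d (k - 1) \<Omega> w \<in> L2_forms k UNIV"
        using L2_forms_UNIV[OF ext_d_H_forms(1)[OF \<Omega> H[OF w]]] by simp
      then show ?thesis
        using form_inner_add_left[OF L2_forms_UNIV[OF H_forms_L2[OF H[OF mem(1)]]]
            L2_forms_UNIV[OF H_forms_L2[OF H[OF mem(2)]]]] uv w
        by (simp add: harmonic_forms_def)
    qed
    then show "u + v \<in> harmonic_forms \<Omega> T W k"
      using uv real_vector.subspace_add[OF subV mem] ext_d_add[OF \<Omega> H[OF mem(1)] H[OF mem(2)]]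
      by (simp add: harmonic_forms_def)
  next
    fix c u
    assume u: "u \<in> harmonic_forms \<Omega> T W k"
    then have mem: "u \<in> unbroken_forms \<Omega> T W k"
      by (simp add: harmonic_forms_def)
    then show "c *\<^sub>R u \<in> harmonic_forms \<Omega> T W k"
      using u real_vector.subspace_scale[OF subV mem] ext_d_scale[OF \<Omega> H[OF mem]]
      by (simp add: harmonic_forms_def form_inner_scale_left)
  qed
qed (auto simp: harmonic_forms_def)

theorem theorem4p4:
  fixes \<Omega> :: "'a::euclidean_space set"
    and T :: "'a set set"
    and W :: "'a set \<Rightarrow> int \<Rightarrow> 'a dform set"
    and k :: int
  assumes "bounded \<Omega>" and "lipschitz_domain \<Omega>"
    and "lipschitz_decomposition \<Omega> T"
    and "\<And>K. K \<in> T \<Longrightarrow> finite_dim_subcomplex K (W K)"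
    and "0 \<le> k" and "k \<le> int DIM('a)"
  shows
    "(int (vdim (lin_space (unbroken_forms \<Omega> T W (k - 1)))) +
        int (vdim (lin_space (unbroken_forms \<Omega> T W k)))) -
     (int (vdim (local_harmonics T W k)) +
        int (vdim (unbroken_traces \<Omega> T W (k - 1))) + int (vdim (unbroken_traces \<Omega> T W k))) =
     (\<Sum>K\<in>T. int (vdim (lin_space (local_W0 K (W K) (k - 1)))) +
             int (vdim (lin_space (local_B0 K (W K) k))) +
             int (vdim (lin_space (local_Z0_perp K (W K) k)))) \<and>
     vdim (condensed_unknowns \<Omega> T W k) \<le> vdim (standard_unknowns \<Omega> T W k) \<and>
     (vdim (condensed_unknowns \<Omega> T W k) = vdim (standard_unknowns \<Omega> T W k) \<longleftrightarrow>
       (\<forall>K\<in>T. local_W0 K (W K) (k - 1) = {0} \<and> local_W0 K (W K) k = local_H0 K (W K) k))"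
proof -
  note T = assms(3) and W = assms(4)
  have \<Omega>: "open \<Omega>"
    by (rule lipschitz_domain_open[OF assms(2)])
  have finT: "finite T" and openK: "\<And>K. K \<in> T \<Longrightarrow> open K"
    using T lipschitz_domain_open by (auto simp: lipschitz_decomposition_def)
  have fsV: "fin_subspace (unbroken_forms \<Omega> T W j)" for j
    by (rule fin_subspace_unbroken_forms[OF \<Omega> T W])
  note V = fin_space_lin_space[OF fsV]
  note R = fin_space_unbroken_traces[OF \<Omega> T W]
  note h = fin_space_lin_space[OF fin_subspace_harmonic_forms[OF \<Omega> fsV]]
  define w where "w = (\<lambda>K. vdim (lin_space (local_W0 K (W K) (k - 1))))"
  define b where "b = (\<lambda>K. vdim (lin_space (local_B0 K (W K) k)))"
  define z where "z = (\<lambda>K. vdim (lin_space (local_Z0_perp K (W K) k)))"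
  have H0: "fin_space (lin_space (local_H0 K (W K) k))" if "K \<in> T" for K
    by (intro fin_space_lin_space fin_subspace_local_H0 openK W that)
  have loc: "fin_space (local_harmonics T W k)"
    unfolding local_harmonics_def by (rule fin_space_product_space[OF finT H0])
  have vdim_loc: "vdim (local_harmonics T W k) = (\<Sum>K\<in>T. vdim (lin_space (local_H0 K (W K) k)))"
    unfolding local_harmonics_def by (rule vdim_product_space[OF finT H0])
  have "(\<Sum>K\<in>T. vdim (lin_space (local_W0 K (W K) k))) =
      (\<Sum>K\<in>T. b K + vdim (lin_space (local_H0 K (W K) k)) + z K)"
    unfolding b_def z_def by (intro sum.cong refl vdim_local_W0 openK W)
  then have "vdim (lin_space (unbroken_forms \<Omega> T W k)) =
      vdim (unbroken_traces \<Omega> T W k) + (sum b T + vdim (local_harmonics T W k) + sum z T)"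
    using vdim_unbroken_forms[OF \<Omega> T W, of k] by (simp add: vdim_loc sum.distrib)
  moreover have "vdim (lin_space (unbroken_forms \<Omega> T W (k - 1))) =
      vdim (unbroken_traces \<Omega> T W (k - 1)) + sum w T"
    unfolding w_def by (rule vdim_unbroken_forms[OF \<Omega> T W])
  ultimately have total: "vdim (lin_space (unbroken_forms \<Omega> T W (k - 1))) + vdim (lin_space (unbroken_forms \<Omega> T W k)) =
      vdim (local_harmonics T W k) + vdim (unbroken_traces \<Omega> T W (k - 1)) + vdim (unbroken_traces \<Omega> T W k) +
      (\<Sum>K\<in>T. w K + b K + z K)"
    by (simp add: sum.distrib)
  \<comment> \<open>Together with \<open>total\<close> this makes the difference of the sizes the
    sum of the local contributions. All counts stay natural numbers, so the inequality and the
    reduction of the equality case to vanishing summands are immediate.\<close>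
  have "vdim (condensed_unknowns \<Omega> T W k) = vdim (lin_space (harmonic_forms \<Omega> T W k)) +
      (vdim (local_harmonics T W k) + (vdim (unbroken_traces \<Omega> T W (k - 1)) + vdim (unbroken_traces \<Omega> T W k)))"
    unfolding condensed_unknowns_def
    by (simp only: vdim_direct_sum fin_space_direct_sum h loc R)
  moreover have "vdim (standard_unknowns \<Omega> T W k) = vdim (lin_space (unbroken_forms \<Omega> T W (k - 1))) +
      (vdim (lin_space (unbroken_forms \<Omega> T W k)) + vdim (lin_space (harmonic_forms \<Omega> T W k)))"
    unfolding standard_unknowns_def
    by (simp only: vdim_direct_sum fin_space_direct_sum h V)
  ultimately have sizes: "vdim (standard_unknowns \<Omega> T W k) =
      vdim (condensed_unknowns \<Omega> T W k) + (\<Sum>K\<in>T. w K + b K + z K)"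
    using total by simp
  have "(\<Sum>K\<in>T. w K + b K + z K) = 0 \<longleftrightarrow> (\<forall>K\<in>T. w K = 0 \<and> b K = 0 \<and> z K = 0)"
    using finT by auto
  also have "\<dots> \<longleftrightarrow> (\<forall>K\<in>T. local_W0 K (W K) (k - 1) = {0} \<and> local_W0 K (W K) k = local_H0 K (W K) k)"
  proof (rule ball_cong[OF refl])
    fix K
    assume K: "K \<in> T"
    note K' = openK[OF K] W[OF K]
    show "w K = 0 \<and> b K = 0 \<and> z K = 0 \<longleftrightarrow>
        local_W0 K (W K) (k - 1) = {0} \<and> local_W0 K (W K) k = local_H0 K (W K) k"
      unfolding w_def b_def z_def local_spaces_trivial_iff[OF K', symmetric]
        vdim_lin_space_eq_0_iff[OF fin_subspace_local_W0[OF K']]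
        vdim_lin_space_eq_0_iff[OF fin_subspace_local_B0[OF K']]
        vdim_lin_space_eq_0_iff[OF fin_subspace_local_Z0_perp[OF K']] ..
  qed
  finally have zero: "(\<Sum>K\<in>T. w K + b K + z K) = 0 \<longleftrightarrow>
      (\<forall>K\<in>T. local_W0 K (W K) (k - 1) = {0} \<and> local_W0 K (W K) k = local_H0 K (W K) k)" .
  have "(\<Sum>K\<in>T. int (w K) + int (b K) + int (z K)) = int (\<Sum>K\<in>T. w K + b K + z K)"
    by simp
  then have "(int (vdim (lin_space (unbroken_forms \<Omega> T W (k - 1)))) +
        int (vdim (lin_space (unbroken_forms \<Omega> T W k)))) -
     (int (vdim (local_harmonics T W k)) +
        int (vdim (unbroken_traces \<Omega> T W (k - 1))) + int (vdim (unbroken_traces \<Omega> T W k))) =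
     (\<Sum>K\<in>T. int (w K) + int (b K) + int (z K))"
    using total by linarith
  moreover have "vdim (condensed_unknowns \<Omega> T W k) \<le> vdim (standard_unknowns \<Omega> T W k)"
    and "vdim (condensed_unknowns \<Omega> T W k) = vdim (standard_unknowns \<Omega> T W k) \<longleftrightarrow>
      (\<Sum>K\<in>T. w K + b K + z K) = 0"
    using sizes by simp_all
  ultimately show ?thesis
    unfolding w_def[symmetric] zero[symmetric] unfolding w_def b_def z_def by (intro conjI)
qed

end
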